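(* Consider an asynchronous restless bandit problem $(\mathbf Q^0,\mathbf Q^1,\mathbf R^0,\mathbf R^1;\alpha)$ such that: (i) the bandit is unichain and strictly indexable; (ii) the unique fixed point $\mathbf m^*$ of the ODE $\dot{\mathbf m}=\tau(\phi(\mathbf m)-\mathbf m)$ is a uniform global attractor of its trajectories, i.e. for every $\epsilon>0$ there is $T(\epsilon)$ such that the solution $\Phi_t\mathbf m$ started at any $\mathbf m\in\Delta^d$ satisfies $\|\Phi_t\mathbf m-\mathbf m^*\|\le\epsilon$ for all $t\ge T(\epsilon)$; (iii) $\mathbf m^*$ is not singular. Then there exist constants $b,c>0$ depending only on $\mathbf Q^0,\mathbf Q^1,\mathbf R^0,\mathbf R^1,\alpha$ such that for every $N$ with $\alpha N\in\mathbb N$, $$0\le V^{(N)}_{\mathrm{rel}}(\alpha)-V^{(N)}_{\mathrm{WIP\text{-}async.}}(\alpha)\le b\,e^{-cN}.$$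
   Context: Asynchronous restless bandit model with parameters $(\mathbf Q^0,\mathbf Q^1,\mathbf R^0,\mathbf R^1;\alpha,N)$: $\mathbf Q^0,\mathbf Q^1$ are $d\times d$ generator matrices ($Q^a_{ij}\ge0$ for $i\ne j$, rows summing to $0$); $N$ bandits with states $S_n(t)\in\{1,\dots,d\}$, $t\in\mathbb R_+$; the action vector $\mathbf a(t)\in\{0,1\}^N$ with $\sum_na_n(t)=\alpha N$ may be changed only at jump times of $\mathbf S(t)$; given actions, bandits evolve independently, bandit $n$ jumping from $i$ to $j\ne i$ at rate $Q^{a_n(t)}_{ij}$; the reward rate is $\sum_nR^{a_n(t)}_{S_n(t)}$. $V^{(N)}_{\mathrm{rel}}(\alpha)$ is the supremum over stationary Markov policies of $\lim_T\frac1T\mathbb E[\int_0^T\sum_nR^{a_n(t)}_{S_n(t)}dt]$ under $\lim_T\frac1T\int_0^T\sum_na_n(t)dt=\alpha N$. Unichain: under every policy a single bandit's state space is one recurrent class. Indexability and Whittle indices: subsidy-$\nu$ problem for one bandit with extra reward $\nu$ per unit time under the passive action, $\omega(\nu)$ the set of states where passivity is optimal, indexable if $\omega$ is nondecreasing in $\nu$, $\nu_i=\inf\{\nu:i\in\omega(\nu)\}$; strictly indexable: all $\nu_i$ distinct, states labeled $\nu_1>\dots>\nu_d$. WIP-async: at every time the $\alpha N$ bandits with highest indices are active; $V^{(N)}_{\mathrm{WIP\text{-}async.}}(\alpha)$ is its long-run average reward per unit time. Let $\tau:=\max_i\max_a|Q^a_{ii}|$, $P^a_{ij}:=Q^a_{ij}/\tau$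 ($i\ne j$), $P^a_{ii}:=1-\sum_{k\neq i}P^a_{ik}$. $\Delta^d=\{\mathbf m\in[0,1]^d:\sum m_i=1\}$; $s(\mathbf m)$ is the unique $s$ with $\sum_{i<s}m_i\le\alpha<\sum_{i\le s}m_i$; $\phi_j(\mathbf m)=\sum_{i=1}^{s(\mathbf m)-1} m_i P^1_{ij} + (\alpha-\sum_{i=1}^{s(\mathbf m)-1}m_i)P^1_{s(\mathbf m)j} + (\sum_{i=1}^{s(\mathbf m)}m_i - \alpha)P^0_{s(\mathbf m)j} + \sum_{i=s(\mathbf m)+1}^{d} m_i P^0_{ij}$. $\mathbf m$ is singular if $\sum_{j\le i}m_j=\alpha$ for some $i$. $\|\cdot\|$ is the sup norm. *)

theory Defs
  imports "HOL-Analysis.Analysis"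
begin

text \<open>Conventions. States of a single bandit are 1..d (nat). The model data are
  Q :: nat => nat => nat => real  with  Q a i j  the rate from i to j under action a (a = 0,1),
  R :: nat => nat => real        with  R a i  the reward rate in state i under action a.\<close>

definition is_generator :: "nat \<Rightarrow> (nat \<Rightarrow> nat \<Rightarrow> real) \<Rightarrow> bool" where
  "is_generator d M \<longleftrightarrow>
     (\<forall>i\<in>{1..d}. \<forall>j\<in>{1..d}. i \<noteq> j \<longrightarrow> 0 \<le> M i j) \<and>
     (\<forall>i\<in>{1..d}. (\<Sum>j\<in>{1..d}. M i j) = 0)"

text \<open>Unichain (as in the context): under every (deterministic stationary) policy u the
  state space of a single bandit forms one recurrent class, i.e. the chain is irreducible.\<close>
definition unichain :: "nat \<Rightarrow> (nat \<Rightarrow> nat \<Rightarrow> nat \<Rightarrow> real) \<Rightarrow> bool" where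
  "unichain d Q \<longleftrightarrow>
     (\<forall>u::nat \<Rightarrow> nat. (\<forall>i\<in>{1..d}. u i \<in> {0,1}) \<longrightarrow>
        (\<forall>i\<in>{1..d}. \<forall>j\<in>{1..d}.
           (i, j) \<in> {(k, l). k \<in> {1..d} \<and> l \<in> {1..d} \<and> k \<noteq> l \<and> 0 < Q (u k) k l}\<^sup>*))"

text \<open>Average-reward optimality (Bellman) equation of the single-bandit subsidy-nu problem
  (continuous time): g = max_a ( R a i + nu [a = 0] + sum_j Q a i j h j ).\<close>
definition qval :: "nat \<Rightarrow> (nat \<Rightarrow> nat \<Rightarrow> nat \<Rightarrow> real) \<Rightarrow> (nat \<Rightarrow> nat \<Rightarrow> real) \<Rightarrow> real
                     \<Rightarrow> (nat \<Rightarrow> real) \<Rightarrow> nat \<Rightarrow> nat \<Rightarrow> real" where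
  "qval d Q R \<nu> h a i = R a i + (if a = 0 then \<nu> else 0) + (\<Sum>j\<in>{1..d}. Q a i j * h j)"

definition subsidy_opt_eq :: "nat \<Rightarrow> (nat \<Rightarrow> nat \<Rightarrow> nat \<Rightarrow> real) \<Rightarrow> (nat \<Rightarrow> nat \<Rightarrow> real) \<Rightarrow> real
                     \<Rightarrow> real \<Rightarrow> (nat \<Rightarrow> real) \<Rightarrow> bool" where
  "subsidy_opt_eq d Q R \<nu> g h \<longleftrightarrow>
     (\<forall>i\<in>{1..d}. g = max (qval d Q R \<nu> h 0 i) (qval d Q R \<nu> h 1 i))"

text \<open>omega(nu): set of states where the passive action is optimal in the subsidy-nu problem.\<close>
definition passive_set :: "nat \<Rightarrow> (nat \<Rightarrow> nat \<Rightarrow> nat \<Rightarrow> real) \<Rightarrow> (nat \<Rightarrow> nat \<Rightarrow> real) \<Rightarrow> real \<Rightarrow> nat set" where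
  "passive_set d Q R \<nu> =
     {i\<in>{1..d}. \<exists>g h. subsidy_opt_eq d Q R \<nu> g h \<and> qval d Q R \<nu> h 1 i \<le> qval d Q R \<nu> h 0 i}"

definition indexable :: "nat \<Rightarrow> (nat \<Rightarrow> nat \<Rightarrow> nat \<Rightarrow> real) \<Rightarrow> (nat \<Rightarrow> nat \<Rightarrow> real) \<Rightarrow> bool" where
  "indexable d Q R \<longleftrightarrow> (\<forall>\<nu> \<nu>'. \<nu> \<le> \<nu>' \<longrightarrow> passive_set d Q R \<nu> \<subseteq> passive_set d Q R \<nu>')"

definition whittle_index :: "nat \<Rightarrow> (nat \<Rightarrow> nat \<Rightarrow> nat \<Rightarrow> real) \<Rightarrow> (nat \<Rightarrow> nat \<Rightarrow> real) \<Rightarrow> nat \<Rightarrow> real" where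
  "whittle_index d Q R i = Inf {\<nu>. i \<in> passive_set d Q R \<nu>}"

definition strictly_indexable :: "nat \<Rightarrow> (nat \<Rightarrow> nat \<Rightarrow> nat \<Rightarrow> real) \<Rightarrow> (nat \<Rightarrow> nat \<Rightarrow> real) \<Rightarrow> bool" where
  "strictly_indexable d Q R \<longleftrightarrow> indexable d Q R \<and>
     inj_on (whittle_index d Q R) {1..d}"

text \<open>Labeling convention nu_1 > nu_2 > ... > nu_d.\<close>
definition index_decreasing_labels :: "nat \<Rightarrow> (nat \<Rightarrow> nat \<Rightarrow> nat \<Rightarrow> real) \<Rightarrow> (nat \<Rightarrow> nat \<Rightarrow> real) \<Rightarrow> bool" where
  "index_decreasing_labels d Q R \<longleftrightarrow>
     (\<forall>i\<in>{1..d}. \<forall>j\<in>{1..d}. i < j \<longrightarrow> whittle_index d Q R j < whittle_index d Q R i)"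

subsection \<open>Mean-field objects\<close>

definition tau :: "nat \<Rightarrow> (nat \<Rightarrow> nat \<Rightarrow> nat \<Rightarrow> real) \<Rightarrow> real" where
  "tau d Q = Max {\<bar>Q a i i\<bar> | a i. a \<in> {0,1} \<and> i \<in> {1..d}}"

definition Punif :: "nat \<Rightarrow> (nat \<Rightarrow> nat \<Rightarrow> nat \<Rightarrow> real) \<Rightarrow> nat \<Rightarrow> nat \<Rightarrow> nat \<Rightarrow> real" where
  "Punif d Q a i j =
     (if i \<noteq> j then Q a i j / tau d Q
      else 1 - (\<Sum>k\<in>{1..d} - {i}. Q a i k / tau d Q))"

definition prob_simplex :: "nat \<Rightarrow> (nat \<Rightarrow> real) set" where
  "prob_simplex d = {m. (\<forall>i\<in>{1..d}. 0 \<le> m i \<and> m i \<le> 1) \<and> (\<Sum>i\<in>{1..d}. m i) = 1}"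

definition s_of :: "nat \<Rightarrow> real \<Rightarrow> (nat \<Rightarrow> real) \<Rightarrow> nat" where
  "s_of d \<alpha> m = (THE s. s \<in> {1..d} \<and> (\<Sum>i\<in>{1..<s}. m i) \<le> \<alpha> \<and> \<alpha> < (\<Sum>i\<in>{1..s}. m i))"

definition phi :: "nat \<Rightarrow> (nat \<Rightarrow> nat \<Rightarrow> nat \<Rightarrow> real) \<Rightarrow> real \<Rightarrow> (nat \<Rightarrow> real) \<Rightarrow> nat \<Rightarrow> real" where
  "phi d Q \<alpha> m j =
     (let s = s_of d \<alpha> m in
        (\<Sum>i\<in>{1..<s}. m i * Punif d Q 1 i j)
        + (\<alpha> - (\<Sum>i\<in>{1..<s}. m i)) * Punif d Q 1 s j
        + ((\<Sum>i\<in>{1..s}. m i) - \<alpha>) * Punif d Q 0 s j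
        + (\<Sum>i\<in>{s<..d}. m i * Punif d Q 0 i j))"

definition singular :: "nat \<Rightarrow> real \<Rightarrow> (nat \<Rightarrow> real) \<Rightarrow> bool" where
  "singular d \<alpha> m \<longleftrightarrow> (\<exists>i\<in>{1..d}. (\<Sum>j\<in>{1..i}. m j) = \<alpha>)"

definition supdist :: "nat \<Rightarrow> (nat \<Rightarrow> real) \<Rightarrow> (nat \<Rightarrow> real) \<Rightarrow> real" where
  "supdist d x y = Max ((\<lambda>i. \<bar>x i - y i\<bar>) ` {1..d})"

text \<open>x is a trajectory of  dm/dt = tau (phi(m) - m)  on [0,infinity) staying in the simplex,
  started at m.\<close>
definition ode_traj :: "nat \<Rightarrow> (nat \<Rightarrow> nat \<Rightarrow> nat \<Rightarrow> real) \<Rightarrow> real \<Rightarrow> (nat \<Rightarrow> real)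
                        \<Rightarrow> (real \<Rightarrow> nat \<Rightarrow> real) \<Rightarrow> bool" where
  "ode_traj d Q \<alpha> m x \<longleftrightarrow>
     (\<forall>i\<in>{1..d}. x 0 i = m i) \<and>
     (\<forall>t\<ge>0. x t \<in> prob_simplex d) \<and>
     (\<forall>t\<ge>0. \<forall>i\<in>{1..d}.
        ((\<lambda>u. x u i) has_real_derivative (tau d Q * (phi d Q \<alpha> (x t) i - x t i))) (at t within {0..}))"

definition uniform_global_attractor :: "nat \<Rightarrow> (nat \<Rightarrow> nat \<Rightarrow> nat \<Rightarrow> real) \<Rightarrow> real \<Rightarrow> (nat \<Rightarrow> real) \<Rightarrow> bool" where
  "uniform_global_attractor d Q \<alpha> mstar \<longleftrightarrow>
     (\<forall>\<epsilon>>0. \<exists>T. \<forall>m\<in>prob_simplex d. \<forall>x. ode_traj d Q \<alpha> m x \<longrightarrow>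
        (\<forall>t\<ge>T. supdist d (x t) mstar \<le> \<epsilon>))"

subsection \<open>The N-bandit continuous-time Markov chain\<close>

text \<open>Joint states: s n in {1..d} for bandits n < N, and s n = 0 otherwise.
  Action vectors are represented by the set of active bandits A (a subset of {..<N}).\<close>
definition joint_states :: "nat \<Rightarrow> nat \<Rightarrow> (nat \<Rightarrow> nat) set" where
  "joint_states N d = {s. (\<forall>n<N. s n \<in> {1..d}) \<and> (\<forall>n\<ge>N. s n = 0)}"

definition act :: "nat set \<Rightarrow> nat \<Rightarrow> nat" where
  "act A n = (if n \<in> A then 1 else 0)"

text \<open>Off-diagonal transition rates under the action vector A.\<close>
definition rate_off :: "nat \<Rightarrow> (nat \<Rightarrow> nat \<Rightarrow> nat \<Rightarrow> real) \<Rightarrow> nat set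
                        \<Rightarrow> (nat \<Rightarrow> nat) \<Rightarrow> (nat \<Rightarrow> nat) \<Rightarrow> real" where
  "rate_off N Q A s s' =
     (\<Sum>n<N. if s' = s(n := s' n) \<and> s' n \<noteq> s n then Q (act A n) (s n) (s' n) else 0)"

definition gen_act :: "nat \<Rightarrow> nat \<Rightarrow> (nat \<Rightarrow> nat \<Rightarrow> nat \<Rightarrow> real) \<Rightarrow> nat set
                        \<Rightarrow> (nat \<Rightarrow> nat) \<Rightarrow> (nat \<Rightarrow> nat) \<Rightarrow> real" where
  "gen_act N d Q A s s' =
     (if s' = s then - (\<Sum>s''\<in>joint_states N d - {s}. rate_off N Q A s s'')
      else rate_off N Q A s s')"

definition reward_act :: "nat \<Rightarrow> (nat \<Rightarrow> nat \<Rightarrow> real) \<Rightarrow> nat set \<Rightarrow> (nat \<Rightarrow> nat) \<Rightarrow> real" where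
  "reward_act N R A s = (\<Sum>n<N. R (act A n) (s n))"

text \<open>Stationary Markov (possibly randomized) policies: pi s A = probability of using the
  action vector A in joint state s; the induced generator/reward are the pi-mixtures.\<close>
definition stat_policy :: "nat \<Rightarrow> nat \<Rightarrow> ((nat \<Rightarrow> nat) \<Rightarrow> nat set \<Rightarrow> real) \<Rightarrow> bool" where
  "stat_policy N d \<pi> \<longleftrightarrow>
     (\<forall>s\<in>joint_states N d. (\<forall>A. 0 \<le> \<pi> s A) \<and> (\<Sum>A\<in>Pow {..<N}. \<pi> s A) = 1)"

definition gen_pol :: "nat \<Rightarrow> nat \<Rightarrow> (nat \<Rightarrow> nat \<Rightarrow> nat \<Rightarrow> real) \<Rightarrow> ((nat \<Rightarrow> nat) \<Rightarrow> nat set \<Rightarrow> real)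
                       \<Rightarrow> (nat \<Rightarrow> nat) \<Rightarrow> (nat \<Rightarrow> nat) \<Rightarrow> real" where
  "gen_pol N d Q \<pi> s s' = (\<Sum>A\<in>Pow {..<N}. \<pi> s A * gen_act N d Q A s s')"

definition reward_pol :: "nat \<Rightarrow> (nat \<Rightarrow> nat \<Rightarrow> real) \<Rightarrow> ((nat \<Rightarrow> nat) \<Rightarrow> nat set \<Rightarrow> real)
                          \<Rightarrow> (nat \<Rightarrow> nat) \<Rightarrow> real" where
  "reward_pol N R \<pi> s = (\<Sum>A\<in>Pow {..<N}. \<pi> s A * reward_act N R A s)"

definition activation_pol :: "nat \<Rightarrow> ((nat \<Rightarrow> nat) \<Rightarrow> nat set \<Rightarrow> real) \<Rightarrow> (nat \<Rightarrow> nat) \<Rightarrow> real" where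
  "activation_pol N \<pi> s = (\<Sum>A\<in>Pow {..<N}. \<pi> s A * real (card A))"

text \<open>Transition function of a CTMC with generator G on the finite state set S:
  P_t = exp(t G) (matrix exponential series).\<close>
fun mpow :: "'s set \<Rightarrow> ('s \<Rightarrow> 's \<Rightarrow> real) \<Rightarrow> nat \<Rightarrow> 's \<Rightarrow> 's \<Rightarrow> real" where
  "mpow S G 0 x y = (if x = y then 1 else 0)"
| "mpow S G (Suc k) x y = (\<Sum>z\<in>S. G x z * mpow S G k z y)"

definition trans_fun :: "'s set \<Rightarrow> ('s \<Rightarrow> 's \<Rightarrow> real) \<Rightarrow> real \<Rightarrow> 's \<Rightarrow> 's \<Rightarrow> real" where
  "trans_fun S G t x y = (\<Sum>k. t ^ k / fact k * mpow S G k x y)"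

text \<open>(1/T) E_x [ int_0^T f(S(t)) dt ] for the CTMC started in x.\<close>
definition time_avg :: "'s set \<Rightarrow> ('s \<Rightarrow> 's \<Rightarrow> real) \<Rightarrow> ('s \<Rightarrow> real) \<Rightarrow> 's \<Rightarrow> real \<Rightarrow> real" where
  "time_avg S G f x T = (1 / T) * integral {0..T} (\<lambda>t. \<Sum>y\<in>S. trans_fun S G t x y * f y)"

text \<open>Value of the relaxed N-bandit problem.\<close>
definition V_rel :: "nat \<Rightarrow> (nat \<Rightarrow> nat \<Rightarrow> nat \<Rightarrow> real) \<Rightarrow> (nat \<Rightarrow> nat \<Rightarrow> real) \<Rightarrow> real \<Rightarrow> nat \<Rightarrow> real" where
  "V_rel d Q R \<alpha> N = Sup {g. \<exists>\<pi> x. stat_policy N d \<pi> \<and> x \<in> joint_states N d \<and>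
        (time_avg (joint_states N d) (gen_pol N d Q \<pi>) (activation_pol N \<pi>) x \<longlongrightarrow> \<alpha> * real N) at_top \<and>
        (time_avg (joint_states N d) (gen_pol N d Q \<pi>) (reward_pol N R \<pi>) x \<longlongrightarrow> g) at_top}"

text \<open>WIP-async: deterministic stationary policy activating K = alpha N bandits with highest
  Whittle index (= smallest labels under the labeling convention), any tie-breaking.\<close>
definition wip_policy :: "nat \<Rightarrow> nat \<Rightarrow> nat \<Rightarrow> ((nat \<Rightarrow> nat) \<Rightarrow> nat set) \<Rightarrow> bool" where
  "wip_policy N d K Act \<longleftrightarrow>
     (\<forall>s\<in>joint_states N d. Act s \<subseteq> {..<N} \<and> card (Act s) = K \<and>
        (\<forall>n\<in>Act s. \<forall>k<N. k \<notin> Act s \<longrightarrow> s n \<le> s k))"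

definition det_gen :: "nat \<Rightarrow> nat \<Rightarrow> (nat \<Rightarrow> nat \<Rightarrow> nat \<Rightarrow> real) \<Rightarrow> ((nat \<Rightarrow> nat) \<Rightarrow> nat set)
                       \<Rightarrow> (nat \<Rightarrow> nat) \<Rightarrow> (nat \<Rightarrow> nat) \<Rightarrow> real" where
  "det_gen N d Q Act s s' = gen_act N d Q (Act s) s s'"

definition det_reward :: "nat \<Rightarrow> (nat \<Rightarrow> nat \<Rightarrow> real) \<Rightarrow> ((nat \<Rightarrow> nat) \<Rightarrow> nat set) \<Rightarrow> (nat \<Rightarrow> nat) \<Rightarrow> real" where
  "det_reward N R Act s = reward_act N R (Act s) s"

end

theory Submission
  imports Defs
begin

text \<open>Let \<open>s\<close> be the marginal state of \<open>mstar\<close> and take the subsidy \<open>\<nu>\<close> equal to the Whittle index of \<open>s\<close>.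
  Strict indexability gives a solution \<open>(g, h)\<close> of the optimality equation for which activity is optimal
  in the states up to \<open>s\<close> and passivity in the states from \<open>s\<close> on. Summing \<open>h\<close> over the bandits and applying
  the generator of the joint chain shows that the relaxed value is at most \<open>N (g - \<nu> (1 - \<alpha>))\<close>, and
  that the index policy loses at most a constant per bandit, and nothing at all while the empirical measure
  is so close to \<open>mstar\<close> that \<open>s\<close> is still marginal (this is where nonsingularity enters). So the gap is at
  most a constant times \<open>N\<close> times the long-run probability that the empirical measure is far from \<open>mstar\<close>.

  This probability is exponentially small: over a short time step an exponential moment of the
  empirical measure is controlled by an explicit supersolution of the backward equation, so the chain
  follows an Euler step of the mean-field ODE up to an error of exponentially small probability.
  Finitely many such steps lead up to the time \<open>T\<close> at which every ODE trajectory is near the attractor,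
  and the Markov property extends the bound from time \<open>T\<close> to all later times.\<close>

section \<open>Finite Markov semigroups\<close>

text \<open>The transition function is a power series with no process behind it, so every
  probabilistic fact must be extracted from that series. The recurring device is to differentiate
  \<open>P_{t-s} v(s)\<close> in \<open>s\<close>: positivity, mass one, the Markov property and the
  exponential moment bound all come from it. The attractor hypothesis speaks about solutions of the
  ODE only; it says nothing about the chain until a solution is known to start at every empirical
  measure, hence the Picard construction. The passive set is an existential over solutions of the
  optimality equation and the Whittle index is an infimum of reals, so the identity at
  \<open>s\<close> needs existence and uniqueness of solutions, closedness in \<nu>, and control of
  extreme subsidies. All this uses irreducibility through one estimate: an upper bound on the
  generator applied to a function bounds the span of the function. The obstacle to concentration is
  that the drift follows the current state. Freezing it over a step costs an error proportional to
  the number of bandits that moved; that number enters the exponent with a coefficient growing in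
  time, whose time derivative pays for the error.\<close>

definition generator_on :: "'s set \<Rightarrow> ('s \<Rightarrow> 's \<Rightarrow> real) \<Rightarrow> bool" where
  "generator_on S G \<longleftrightarrow> finite S \<and> (\<forall>x\<in>S. \<forall>y\<in>S. x \<noteq> y \<longrightarrow> 0 \<le> G x y) \<and> (\<forall>x\<in>S. (\<Sum>y\<in>S. G x y) = 0)"

text \<open>A matrix read as an operator on functions. For a transition function this is the
  conditional expectation of \<open>f\<close> given the initial state, for a generator it is the
  infinitesimal change of that expectation.\<close>

definition apply_on :: "'s set \<Rightarrow> ('s \<Rightarrow> 's \<Rightarrow> real) \<Rightarrow> ('s \<Rightarrow> real) \<Rightarrow> 's \<Rightarrow> real" where
  "apply_on S A f x = (\<Sum>y\<in>S. A x y * f y)"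

lemma generator_onD:
  assumes "generator_on S G"
  shows "finite S" "\<And>x y. x \<in> S \<Longrightarrow> y \<in> S \<Longrightarrow> x \<noteq> y \<Longrightarrow> 0 \<le> G x y" "\<And>x. x \<in> S \<Longrightarrow> (\<Sum>y\<in>S. G x y) = 0"
  using assms by (auto simp: generator_on_def)

lemma apply_on_const: "apply_on S A (\<lambda>_. c) x = c * (\<Sum>y\<in>S. A x y)"
  by (simp add: apply_on_def sum_distrib_left mult.commute)

lemma apply_on_add: "apply_on S A (\<lambda>y. f y + g y) x = apply_on S A f x + apply_on S A g x"
  by (simp add: apply_on_def algebra_simps sum.distrib)

lemma apply_on_diff: "apply_on S A (\<lambda>y. f y - g y) x = apply_on S A f x - apply_on S A g x"
  by (simp add: apply_on_def algebra_simps sum_subtractf)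

lemma apply_on_cmult: "apply_on S A (\<lambda>y. c * f y) x = c * apply_on S A f x"
  by (simp add: apply_on_def algebra_simps sum_distrib_left)

lemma apply_on_cong: "(\<And>y. y \<in> S \<Longrightarrow> f y = g y) \<Longrightarrow> apply_on S A f x = apply_on S A g x"
  by (simp add: apply_on_def)

lemma generator_apply_const: "generator_on S G \<Longrightarrow> x \<in> S \<Longrightarrow> apply_on S G (\<lambda>_. c) x = 0"
  by (simp add: apply_on_const generator_onD)

text \<open>Since rows sum to zero, subtracting the constant \<open>f x\<close> changes nothing and
  removes the diagonal. Only nonnegative coefficients remain, which is what every maximum principle
  below uses.\<close>

lemma apply_on_sub_point:
  assumes "generator_on S G" "x \<in> S"
  shows "apply_on S G f x = (\<Sum>y\<in>S - {x}. G x y * (f y - f x))"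
proof -
  have "apply_on S G f x = apply_on S G f x - apply_on S G (\<lambda>_. f x) x"
    using generator_apply_const[OF assms] by simp
  also have "\<dots> = (\<Sum>y\<in>S. G x y * (f y - f x))"
    by (simp add: apply_on_def sum_subtractf[symmetric] algebra_simps)
  also have "\<dots> = (\<Sum>y\<in>S - {x}. G x y * (f y - f x))"
    using assms generator_onD(1)[OF assms(1)] by (subst sum.remove[of S x]) auto
  finally show ?thesis .
qed

lemma if_zero_mult: "(if P then a else 0) * c = (if P then a * c else 0)" for c :: real
  by simp

section \<open>The matrix exponential series and the Kolmogorov equations\<close>

lemma mpow_bound:
  assumes "finite S" "0 \<le> c" "\<And>x. x \<in> S \<Longrightarrow> (\<Sum>z\<in>S. \<bar>G x z\<bar>) \<le> c" "x \<in> S"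
  shows "\<bar>mpow S G k x y\<bar> \<le> c ^ k"
  using assms(4)
proof (induction k arbitrary: x)
  case (Suc k)
  have "\<bar>mpow S G (Suc k) x y\<bar> \<le> (\<Sum>z\<in>S. \<bar>G x z\<bar> * \<bar>mpow S G k z y\<bar>)"
    by (simp add: abs_mult[symmetric])
  also have "\<dots> \<le> (\<Sum>z\<in>S. \<bar>G x z\<bar> * c ^ k)"
    by (intro sum_mono mult_left_mono Suc.IH) auto
  also have "\<dots> = (\<Sum>z\<in>S. \<bar>G x z\<bar>) * c ^ k" by (simp add: sum_distrib_right)
  also have "\<dots> \<le> c * c ^ k" using assms Suc.prems by (intro mult_right_mono) auto
  finally show ?case by simp
qed auto

text \<open>The recursion for \<open>mpow\<close> multiplies on the left, which fits the backward
  equation; the forward equation needs the last factor split off instead.\<close>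

lemma mpow_Suc_right:
  assumes "finite S" "x \<in> S" "y \<in> S"
  shows "mpow S G (Suc k) x y = (\<Sum>z\<in>S. mpow S G k x z * G z y)"
  using assms(2)
proof (induction k arbitrary: x)
  case 0
  have "(\<Sum>z\<in>S. G x z * (if z = y then 1 else 0)) = G x y"
    using assms by (simp add: if_distrib cong: if_cong)
  moreover have "(\<Sum>z\<in>S. (if x = z then 1 else 0) * G z y) = G x y"
    using assms 0 by (simp add: if_zero_mult)
  ultimately show ?case by simp
next
  case (Suc k)
  have "mpow S G (Suc (Suc k)) x y = (\<Sum>z\<in>S. G x z * (\<Sum>w\<in>S. mpow S G k z w * G w y))"
    unfolding mpow.simps(2)[of S G "Suc k"] using Suc.IH by (intro sum.cong) auto
  also have "\<dots> = (\<Sum>z\<in>S. \<Sum>w\<in>S. G x z * mpow S G k z w * G w y)"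
    by (simp add: sum_distrib_left mult.assoc)
  also have "\<dots> = (\<Sum>w\<in>S. \<Sum>z\<in>S. G x z * mpow S G k z w * G w y)"
    by (rule sum.swap)
  finally show ?case by (simp add: sum_distrib_right)
qed

lemma trans_fun_summable:
  assumes "finite S" "x \<in> S"
  shows "summable (\<lambda>k. t ^ k / fact k * mpow S G k x y)"
proof -
  define c where "c = (\<Sum>x\<in>S. \<Sum>z\<in>S. \<bar>G x z\<bar>)"
  have c: "(\<Sum>z\<in>S. \<bar>G x z\<bar>) \<le> c" if "x \<in> S" for x
    unfolding c_def using assms(1) that
    by (intro member_le_sum[where f = "\<lambda>x. \<Sum>z\<in>S. \<bar>G x z\<bar>"]) (auto intro: sum_nonneg)
  have c0: "0 \<le> c" unfolding c_def by (intro sum_nonneg) auto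
  have s: "summable (\<lambda>k. (\<bar>t\<bar> * c) ^ k / fact k)"
    using summable_exp_generic[of "\<bar>t\<bar> * c"] by (simp add: scaleR_conv_of_real divide_inverse mult.commute)
  show ?thesis
  proof (rule summable_comparison_test[OF _ s], intro exI[of _ 0] allI impI)
    fix n :: nat
    have "\<bar>mpow S G n x y\<bar> \<le> c ^ n" using mpow_bound[OF assms(1) c0 c assms(2)] .
    then show "norm (t ^ n / fact n * mpow S G n x y) \<le> (\<bar>t\<bar> * c) ^ n / fact n"
      by (simp add: abs_mult power_abs power_mult_distrib mult_left_mono divide_right_mono)
  qed
qed

lemma trans_fun_0: "trans_fun S G 0 x y = (if x = y then 1 else 0)"
proof -
  have "trans_fun S G 0 x y = (\<Sum>k. (mpow S G k x y / fact k) * 0 ^ k)"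
    unfolding trans_fun_def by (intro suminf_cong) auto
  then show ?thesis by (subst (asm) powser_zero) auto
qed

text \<open>Kolmogorov's backward equation, by termwise differentiation: the factorial absorbs the
  exponent and shifts the series by one power of \<open>G\<close>.\<close>

lemma trans_fun_deriv_left:
  assumes "finite S" "x \<in> S"
  shows "((\<lambda>t. trans_fun S G t x y) has_real_derivative (\<Sum>z\<in>S. G x z * trans_fun S G t z y)) (at t)"
proof -
  let ?c = "\<lambda>k. mpow S G k x y / fact k"
  have s: "summable (\<lambda>n. ?c n * u ^ n)" for u
    using trans_fun_summable[OF assms, of u G y] by (simp add: mult.commute)
  have d: "((\<lambda>u. \<Sum>n. ?c n * u ^ n) has_real_derivative (\<Sum>n. diffs ?c n * t ^ n)) (at t)"
    by (rule termdiffs_strong_converges_everywhere[OF s])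
  have "(\<Sum>n. diffs ?c n * t ^ n) = (\<Sum>n. \<Sum>z\<in>S. G x z * (t ^ n / fact n * mpow S G n z y))"
  proof (intro suminf_cong)
    fix n
    have "diffs ?c n * t ^ n = t ^ n / fact n * mpow S G (Suc n) x y"
      by (simp add: diffs_def divide_simps del: mpow.simps)
    also have "\<dots> = (\<Sum>z\<in>S. G x z * (t ^ n / fact n * mpow S G n z y))"
      by (simp add: sum_distrib_left mult_ac)
    finally show "diffs ?c n * t ^ n = \<dots>" .
  qed
  also have "\<dots> = (\<Sum>z\<in>S. \<Sum>n. G x z * (t ^ n / fact n * mpow S G n z y))"
    using assms by (intro suminf_sum summable_mult trans_fun_summable)
  also have "\<dots> = (\<Sum>z\<in>S. G x z * trans_fun S G t z y)"
    unfolding trans_fun_def using assms by (intro sum.cong refl suminf_mult trans_fun_summable)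
  finally show ?thesis using d unfolding trans_fun_def by (simp add: mult.commute)
qed

lemma trans_fun_deriv_right:
  assumes "finite S" "x \<in> S" "y \<in> S"
  shows "((\<lambda>t. trans_fun S G t x y) has_real_derivative (\<Sum>z\<in>S. trans_fun S G t x z * G z y)) (at t)"
proof -
  let ?c = "\<lambda>k. mpow S G k x y / fact k"
  have s: "summable (\<lambda>n. ?c n * u ^ n)" for u
    using trans_fun_summable[OF assms(1,2), of u G y] by (simp add: mult.commute)
  have d: "((\<lambda>u. \<Sum>n. ?c n * u ^ n) has_real_derivative (\<Sum>n. diffs ?c n * t ^ n)) (at t)"
    by (rule termdiffs_strong_converges_everywhere[OF s])
  have "(\<Sum>n. diffs ?c n * t ^ n) = (\<Sum>n. \<Sum>z\<in>S. (t ^ n / fact n * mpow S G n x z) * G z y)"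
  proof (intro suminf_cong)
    fix n
    have "diffs ?c n * t ^ n = t ^ n / fact n * mpow S G (Suc n) x y"
      by (simp add: diffs_def divide_simps del: mpow.simps)
    also have "\<dots> = (\<Sum>z\<in>S. (t ^ n / fact n * mpow S G n x z) * G z y)"
      unfolding mpow_Suc_right[OF assms] by (simp add: sum_distrib_left mult_ac)
    finally show "diffs ?c n * t ^ n = \<dots>" .
  qed
  also have "\<dots> = (\<Sum>z\<in>S. \<Sum>n. (t ^ n / fact n * mpow S G n x z) * G z y)"
    using assms by (intro suminf_sum summable_mult2 trans_fun_summable)
  also have "\<dots> = (\<Sum>z\<in>S. trans_fun S G t x z * G z y)"
    unfolding trans_fun_def using assms by (intro sum.cong refl suminf_mult2[symmetric] trans_fun_summable)
  finally show ?thesis using d unfolding trans_fun_def by (simp add: mult.commute)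
qed

text \<open>Comparison principle for the backward equation. \<open>B\<close> may be any matrix and
  positivity is a hypothesis, because the lemma is also used to prove positivity for generators,
  with a shifted matrix in the role of \<open>B\<close>.\<close>

lemma trans_fun_supersolution:
  assumes fin: "finite S" and t: "0 \<le> t" and x: "x \<in> S"
    and nonneg: "\<And>s z. 0 \<le> s \<Longrightarrow> s \<le> t \<Longrightarrow> z \<in> S \<Longrightarrow> 0 \<le> trans_fun S B s x z"
    and deriv: "\<And>s z. 0 \<le> s \<Longrightarrow> s \<le> t \<Longrightarrow> z \<in> S \<Longrightarrow> ((\<lambda>s. v s z) has_real_derivative v' s z) (at s)"
    and super: "\<And>s z. 0 \<le> s \<Longrightarrow> s \<le> t \<Longrightarrow> z \<in> S \<Longrightarrow> apply_on S B (v s) z \<le> v' s z"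
  shows "apply_on S (trans_fun S B t) (v 0) x \<le> v t x"
proof -
  \<comment> \<open>Interpolates between the two sides of the claim: \<open>s = 0\<close> gives the
    semigroup applied to \<open>v 0\<close>, and \<open>s = t\<close> gives \<open>v t x\<close>. By
    the forward equation its derivative is the semigroup applied to \<open>v' - B v\<close>, which
    is nonnegative.\<close>
  define \<phi> where "\<phi> s = (\<Sum>z\<in>S. trans_fun S B (t - s) x z * v s z)" for s
  have "\<phi> 0 \<le> \<phi> t"
  proof (rule DERIV_nonneg_imp_nondecreasing[OF t])
    fix s assume s: "0 \<le> s" "s \<le> t"
    let ?D = "\<Sum>z\<in>S. - (\<Sum>y\<in>S. trans_fun S B (t - s) x y * B y z) * v s z + trans_fun S B (t - s) x z * v' s z"
    have "(\<phi> has_real_derivative ?D) (at s)"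
      unfolding \<phi>_def
    proof (intro DERIV_sum)
      fix z assume z: "z \<in> S"
      have "((\<lambda>s. trans_fun S B (t - s) x z) has_real_derivative
              (\<Sum>y\<in>S. trans_fun S B (t - s) x y * B y z) * (-1)) (at s)"
        by (rule DERIV_chain2[OF trans_fun_deriv_right[OF fin x z]]) (auto intro!: derivative_eq_intros)
      from DERIV_mult[OF this deriv[OF s z]]
      show "((\<lambda>s. trans_fun S B (t - s) x z * v s z) has_real_derivative
          - (\<Sum>y\<in>S. trans_fun S B (t - s) x y * B y z) * v s z + trans_fun S B (t - s) x z * v' s z) (at s)"
        by (simp add: algebra_simps)
    qed
    moreover have "?D = (\<Sum>z\<in>S. trans_fun S B (t - s) x z * (v' s z - apply_on S B (v s) z))"
    proof -
      have "(\<Sum>z\<in>S. (\<Sum>y\<in>S. trans_fun S B (t - s) x y * B y z) * v s z)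
          = (\<Sum>z\<in>S. \<Sum>y\<in>S. trans_fun S B (t - s) x y * (B y z * v s z))"
        by (simp add: sum_distrib_right mult.assoc)
      also have "\<dots> = (\<Sum>y\<in>S. \<Sum>z\<in>S. trans_fun S B (t - s) x y * (B y z * v s z))"
        by (rule sum.swap)
      also have "\<dots> = (\<Sum>y\<in>S. trans_fun S B (t - s) x y * apply_on S B (v s) y)"
        by (simp add: apply_on_def sum_distrib_left)
      finally show ?thesis by (simp add: sum.distrib sum_negf right_diff_distrib sum_subtractf)
    qed
    moreover have "\<dots> \<ge> 0"
      using s super nonneg by (intro sum_nonneg mult_nonneg_nonneg) auto
    ultimately show "\<exists>y. (\<phi> has_real_derivative y) (at s) \<and> 0 \<le> y" by metis
  qed
  moreover have "\<phi> t = v t x"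
    unfolding \<phi>_def using fin x by (simp add: trans_fun_0 if_zero_mult)
  ultimately show ?thesis by (simp add: \<phi>_def apply_on_def)
qed

lemma trans_fun_nonneg_matrix:
  assumes "finite S" "x \<in> S" "0 \<le> t" "\<And>x y. x \<in> S \<Longrightarrow> y \<in> S \<Longrightarrow> 0 \<le> B x y" "y \<in> S"
  shows "0 \<le> trans_fun S B t x y"
proof -
  have "0 \<le> mpow S B k x y" if "x \<in> S" for k x
    using that
  proof (induction k arbitrary: x)
    case (Suc k)
    then show ?case using assms(4) by (auto intro!: sum_nonneg mult_nonneg_nonneg)
  qed auto
  then show ?thesis unfolding trans_fun_def using assms
    by (intro suminf_nonneg trans_fun_summable mult_nonneg_nonneg) auto
qed

text \<open>Uniformization: \<open>exp (t (G + l I)) = exp (t l) exp (t G)\<close>, and the left-hand side is a power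
  series with nonnegative coefficients for large \<open>l\<close>.\<close>

lemma trans_fun_nonneg:
  assumes G: "generator_on S G" and x: "x \<in> S" and y: "y \<in> S" and t: "0 \<le> t"
  shows "0 \<le> trans_fun S G t x y"
proof -
  note fin = generator_onD(1)[OF G]
  define l where "l = (\<Sum>z\<in>S. \<bar>G z z\<bar>)"
  have l: "\<bar>G z z\<bar> \<le> l" if "z \<in> S" for z
    unfolding l_def using that fin by (intro member_le_sum) auto
  define B where "B x y = G x y + (if x = y then 1 else 0) * l" for x y
  have B: "0 \<le> B x y" if "x \<in> S" "y \<in> S" for x y
    using that generator_onD(2)[OF G, of x y] l[of x] by (auto simp: B_def abs_le_iff)
  \<comment> \<open>This solves the backward equation for the shifted matrix \<open>B\<close> with
    equality, so comparison bounds it below by an expression in the nonnegative exponential of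
    \<open>B\<close>.\<close>
  define v where "v s z = exp (l * s) * trans_fun S G s z y" for s z
  have aB: "apply_on S B f z = apply_on S G f z + l * f z" if "z \<in> S" for f z
    using that fin by (simp add: apply_on_def B_def distrib_right sum.distrib mult.assoc if_zero_mult)
  have "apply_on S (trans_fun S B t) (v 0) x \<le> v t x"
  proof (rule trans_fun_supersolution[OF fin t x])
    fix s :: real and z assume s: "0 \<le> s" and z: "z \<in> S"
    show "0 \<le> trans_fun S B s x z" by (rule trans_fun_nonneg_matrix[OF fin x s B z])
    show "((\<lambda>s. v s z) has_real_derivative apply_on S B (v s) z) (at s)"
      unfolding v_def apply_on_def[of S "trans_fun _ _ _"]
      apply (rule derivative_eq_intros trans_fun_deriv_left fin z refl)+
      unfolding aB[OF z] apply_on_cmult by (simp add: apply_on_def algebra_simps)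
  qed auto
  moreover have "apply_on S (trans_fun S B t) (v 0) x \<ge> 0"
    unfolding apply_on_def v_def
    by (intro sum_nonneg mult_nonneg_nonneg trans_fun_nonneg_matrix[OF fin x t B]) (auto simp: trans_fun_0)
  ultimately have "0 \<le> v t x" by simp
  then show ?thesis by (simp add: v_def zero_le_mult_iff)
qed

text \<open>Uniqueness for the backward equation: compare with \<open>v\<close> and with
  \<open>-v\<close>. It reduces an identity for the semigroup to checking one derivative;
  invariance, unit row sums and the semigroup law below are three choices of
  \<open>v\<close>.\<close>

lemma trans_fun_representation:
  assumes G: "generator_on S G" and t: "0 \<le> t" and x: "x \<in> S"
    and deriv: "\<And>s z. z \<in> S \<Longrightarrow> ((\<lambda>s. v s z) has_real_derivative apply_on S G (v s) z) (at s)"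
  shows "apply_on S (trans_fun S G t) (v 0) x = v t x"
proof (rule antisym)
  show "apply_on S (trans_fun S G t) (v 0) x \<le> v t x"
    using deriv by (intro trans_fun_supersolution[OF generator_onD(1)[OF G] t x trans_fun_nonneg[OF G x]]) auto
  have "apply_on S (trans_fun S G t) (\<lambda>z. - v 0 z) x \<le> - v t x"
    using trans_fun_supersolution[OF generator_onD(1)[OF G] t x trans_fun_nonneg[OF G x], where v = "\<lambda>s z. - v s z"
      and v' = "\<lambda>s z. - apply_on S G (v s) z"]
    using apply_on_cmult[of S G "-1"] DERIV_minus[OF deriv] by auto
  then show "v t x \<le> apply_on S (trans_fun S G t) (v 0) x"
    using apply_on_cmult[of S _ "-1"] by simp
qed

lemma trans_fun_invariant:
  assumes G: "generator_on S G" and t: "0 \<le> t" and x: "x \<in> S" and f: "\<And>z. z \<in> S \<Longrightarrow> apply_on S G f z = 0"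
  shows "apply_on S (trans_fun S G t) f x = f x"
  using trans_fun_representation[OF G t x, of "\<lambda>_. f"] f by simp

lemma trans_fun_row_sum:
  assumes G: "generator_on S G" and t: "0 \<le> t" and x: "x \<in> S"
  shows "(\<Sum>y\<in>S. trans_fun S G t x y) = 1"
  using trans_fun_invariant[OF G t x, of "\<lambda>_. 1"] generator_apply_const[OF G, of _ 1] apply_on_const[of S _ 1] by simp

lemma trans_fun_semigroup:
  assumes G: "generator_on S G" and t: "0 \<le> t" and x: "x \<in> S"
  shows "trans_fun S G (t + r) x y = (\<Sum>z\<in>S. trans_fun S G t x z * trans_fun S G r z y)"
proof -
  have "((\<lambda>s. trans_fun S G (s + r) z y) has_real_derivative apply_on S G (\<lambda>z. trans_fun S G (s + r) z y) z) (at s)"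
    if "z \<in> S" for s z
    using trans_fun_deriv_left[OF generator_onD(1)[OF G] that, of G y "s + r"]
    unfolding apply_on_def DERIV_shift .
  from trans_fun_representation[OF G t x this] show ?thesis by (simp add: apply_on_def)
qed

lemma semigroup_apply:
  assumes "generator_on S G" "0 \<le> t" "x \<in> S"
  shows "apply_on S (trans_fun S G (t + r)) f x = apply_on S (trans_fun S G t) (apply_on S (trans_fun S G r) f) x"
proof -
  have "apply_on S (trans_fun S G (t + r)) f x = (\<Sum>y\<in>S. \<Sum>z\<in>S. trans_fun S G t x z * (trans_fun S G r z y * f y))"
    by (simp add: apply_on_def trans_fun_semigroup[OF assms] sum_distrib_right mult.assoc)
  also have "\<dots> = (\<Sum>z\<in>S. \<Sum>y\<in>S. trans_fun S G t x z * (trans_fun S G r z y * f y))"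
    by (rule sum.swap)
  finally show ?thesis by (simp add: apply_on_def sum_distrib_left)
qed

lemma semigroup_mono:
  assumes "generator_on S G" "0 \<le> t" "x \<in> S" "\<And>y. y \<in> S \<Longrightarrow> f y \<le> g y"
  shows "apply_on S (trans_fun S G t) f x \<le> apply_on S (trans_fun S G t) g x"
  unfolding apply_on_def using assms by (intro sum_mono mult_left_mono trans_fun_nonneg) auto

lemma semigroup_const:
  assumes "generator_on S G" "0 \<le> t" "x \<in> S"
  shows "apply_on S (trans_fun S G t) (\<lambda>_. c) x = c"
  using trans_fun_row_sum[OF assms] by (simp add: apply_on_const)

lemma semigroup_le_const:
  assumes "generator_on S G" "0 \<le> t" "x \<in> S" "\<And>y. y \<in> S \<Longrightarrow> f y \<le> c"
  shows "apply_on S (trans_fun S G t) f x \<le> c"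
  using semigroup_mono[OF assms(1-3), of f "\<lambda>_. c"] assms(4) semigroup_const[OF assms(1-3)] by simp

lemma semigroup_ge_const:
  assumes "generator_on S G" "0 \<le> t" "x \<in> S" "\<And>y. y \<in> S \<Longrightarrow> c \<le> f y"
  shows "c \<le> apply_on S (trans_fun S G t) f x"
  using semigroup_mono[OF assms(1-3), of "\<lambda>_. c" f] assms(4) semigroup_const[OF assms(1-3)] by simp

lemma semigroup_continuous:
  assumes "finite S" "x \<in> S"
  shows "continuous_on A (\<lambda>t. apply_on S (trans_fun S G t) f x)"
  unfolding apply_on_def
proof (intro continuous_intros)
  fix y assume "y \<in> S"
  show "continuous_on A (\<lambda>t. trans_fun S G t x y)"
    using trans_fun_deriv_left[OF assms, of G y] by (intro DERIV_continuous_on) (auto intro: has_field_derivative_at_within)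
qed

section \<open>Time averages\<close>

lemma time_avg_eq: "time_avg S G f x T = integral {0..T} (\<lambda>t. apply_on S (trans_fun S G t) f x) / T"
  by (simp add: time_avg_def apply_on_def)

lemma semigroup_integrable:
  assumes "finite S" "x \<in> S"
  shows "(\<lambda>t. apply_on S (trans_fun S G t) f x) integrable_on {a..b}"
  by (intro integrable_continuous_real semigroup_continuous assms)

lemma time_avg_add:
  assumes "finite S" "x \<in> S"
  shows "time_avg S G (\<lambda>y. f y + g y) x T = time_avg S G f x T + time_avg S G g x T"
  unfolding time_avg_eq apply_on_add
  by (subst integral_add[OF semigroup_integrable semigroup_integrable, OF assms assms]) (simp add: add_divide_distrib)

lemma time_avg_cmult: "time_avg S G (\<lambda>y. c * f y) x T = c * time_avg S G f x T"
  unfolding time_avg_eq apply_on_cmult by simp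

lemma time_avg_le:
  assumes G: "generator_on S G" "x \<in> S" "0 < T" "\<And>y. y \<in> S \<Longrightarrow> f y \<le> g y"
  shows "time_avg S G f x T \<le> time_avg S G g x T"
  unfolding time_avg_eq using assms generator_onD(1)[OF G(1)]
  by (intro divide_right_mono integral_le semigroup_integrable semigroup_mono[OF G(1)]) auto

lemma time_avg_const:
  assumes G: "generator_on S G" "x \<in> S" "0 < T"
  shows "time_avg S G (\<lambda>_. c) x T = c"
proof -
  have "integral {0..T} (\<lambda>t. apply_on S (trans_fun S G t) (\<lambda>_. c) x) = integral {0..T} (\<lambda>t. c)"
    using semigroup_const[OF G(1) _ G(2)] by (intro integral_cong) auto
  then show ?thesis using G(3) by (simp add: time_avg_eq)
qed

lemma time_avg_cong:
  assumes "\<And>y. y \<in> S \<Longrightarrow> f y = g y"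
  shows "time_avg S G f x T = time_avg S G g x T"
  unfolding time_avg_eq using apply_on_cong[of S f g] assms by simp

text \<open>Dynkin's formula: by the forward equation the integrand is a derivative, so only the two
  endpoints survive.\<close>

lemma time_avg_generator:
  assumes G: "generator_on S G" and x: "x \<in> S" and T: "0 < T"
  shows "time_avg S G (apply_on S G f) x T = (apply_on S (trans_fun S G T) f x - f x) / T"
proof -
  note fin = generator_onD(1)[OF G]
  let ?u = "\<lambda>t. apply_on S (trans_fun S G t) f x"
  have d: "(?u has_real_derivative apply_on S (trans_fun S G t) (apply_on S G f) x) (at t)" for t
  proof -
    have "(?u has_real_derivative (\<Sum>y\<in>S. (\<Sum>z\<in>S. trans_fun S G t x z * G z y) * f y)) (at t)"
      unfolding apply_on_def by (intro DERIV_sum DERIV_cmult_right trans_fun_deriv_right fin x)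
    also have "(\<Sum>y\<in>S. (\<Sum>z\<in>S. trans_fun S G t x z * G z y) * f y)
        = (\<Sum>y\<in>S. \<Sum>z\<in>S. trans_fun S G t x z * (G z y * f y))"
      by (simp add: sum_distrib_right mult.assoc)
    also have "\<dots> = (\<Sum>z\<in>S. \<Sum>y\<in>S. trans_fun S G t x z * (G z y * f y))"
      by (rule sum.swap)
    also have "\<dots> = apply_on S (trans_fun S G t) (apply_on S G f) x"
      by (simp add: apply_on_def sum_distrib_left)
    finally show ?thesis .
  qed
  have "((\<lambda>t. apply_on S (trans_fun S G t) (apply_on S G f) x) has_integral (?u T - ?u 0)) {0..T}"
    using T d by (intro fundamental_theorem_of_calculus)
      (auto simp: has_real_derivative_iff_has_vector_derivative[symmetric] intro: has_field_derivative_at_within)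
  moreover have "?u 0 = f x"
    using fin x by (simp add: apply_on_def trans_fun_0 if_zero_mult)
  ultimately show ?thesis by (simp add: time_avg_eq integral_unique)
qed

text \<open>The endpoints in Dynkin's formula stay bounded while \<open>T\<close> grows. Hence terms
  \<open>G f\<close> may be added to a reward without changing its long-run average, which is how
  bias functions disappear later.\<close>

lemma time_avg_generator_tendsto_0:
  assumes G: "generator_on S G" and x: "x \<in> S"
  shows "(time_avg S G (apply_on S G f) x \<longlongrightarrow> 0) at_top"
proof -
  define C where "C = (\<Sum>y\<in>S. \<bar>f y\<bar>)"
  have C: "\<bar>f y\<bar> \<le> C" if "y \<in> S" for y
    unfolding C_def using generator_onD(1)[OF G] that by (intro member_le_sum) auto
  have lim: "((\<lambda>T::real. 2 * C / T) \<longlongrightarrow> 0) at_top"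
    by (intro tendsto_divide_0[OF tendsto_const] filterlim_at_top_imp_at_infinity filterlim_ident)
  show ?thesis
  proof (rule Lim_null_comparison[OF _ lim], rule eventually_at_top_linorderI[of 1])
    fix T :: real assume T: "1 \<le> T"
    have "\<bar>apply_on S (trans_fun S G T) f x\<bar> \<le> C"
      using semigroup_le_const[OF G _ x, of T f C] semigroup_ge_const[OF G _ x, of T "-C" f] C T
      by (force simp: abs_le_iff)
    then have "\<bar>apply_on S (trans_fun S G T) f x - f x\<bar> \<le> 2 * C" using C[OF x] by linarith
    then show "norm (time_avg S G (apply_on S G f) x T) \<le> 2 * C / T"
      using T by (simp add: time_avg_generator[OF G x] divide_right_mono)
  qed
qed

section \<open>Compactness, the discounted equation and existence of long-run averages\<close>

lemma finite_bounded_subseq: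
  fixes f :: "nat \<Rightarrow> 's \<Rightarrow> real"
  assumes "finite S" "\<And>x. x \<in> S \<Longrightarrow> \<exists>c. \<forall>n. \<bar>f n x\<bar> \<le> c"
  shows "\<exists>r g. strict_mono r \<and> (\<forall>x\<in>S. (\<lambda>n. f (r n) x) \<longlonglongrightarrow> g x)"
  using assms
proof (induction S rule: finite_induct)
  case empty
  show ?case using strict_mono_id by auto
next
  case (insert x S)
  then obtain r g where r: "strict_mono r" and g: "\<forall>x\<in>S. (\<lambda>n. f (r n) x) \<longlonglongrightarrow> g x" by blast
  obtain c where "\<forall>n. \<bar>f n x\<bar> \<le> c" using insert.prems by blast
  then have "bounded (range (\<lambda>n. f (r n) x))" by (auto simp: bounded_iff)
  then obtain l r' where r': "strict_mono r'" and l: "((\<lambda>n. f (r n) x) \<circ> r') \<longlonglongrightarrow> l"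
    using bounded_imp_convergent_subsequence by blast
  have "\<forall>y\<in>insert x S. (\<lambda>n. f ((r \<circ> r') n) y) \<longlonglongrightarrow> (g(x := l)) y"
  proof
    fix y assume y: "y \<in> insert x S"
    show "(\<lambda>n. f ((r \<circ> r') n) y) \<longlonglongrightarrow> (g(x := l)) y"
    proof (cases "y = x")
      case True then show ?thesis using l by (simp add: comp_def)
    next
      case False
      then have "(\<lambda>n. f (r n) y) \<longlonglongrightarrow> g y" using g y by auto
      from LIMSEQ_subseq_LIMSEQ[OF this r'] show ?thesis using False by (simp add: comp_def)
    qed
  qed
  then show ?case using strict_mono_o[OF r r'] by blast
qed

lemma apply_on_tendsto:
  assumes "finite S" "\<And>y. y \<in> S \<Longrightarrow> ((\<lambda>n. f n y) \<longlongrightarrow> g y) F"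
  shows "((\<lambda>n. apply_on S A (f n) x) \<longlongrightarrow> apply_on S A g x) F"
  unfolding apply_on_def by (intro tendsto_intros assms)

text \<open>Value iteration from a constant subsolution increases to a solution.\<close>

lemma discounted_equation:
  assumes G: "generator_on S G0" "generator_on S G1" and l: "0 < l"
    and C: "\<And>i. i \<in> S \<Longrightarrow> \<bar>r0 i\<bar> \<le> C" "\<And>i. i \<in> S \<Longrightarrow> \<bar>r1 i\<bar> \<le> C"
  shows "\<exists>v. \<forall>i\<in>S. l * v i = max (r0 i + apply_on S G0 v i) (r1 i + apply_on S G1 v i) \<and> \<bar>l * v i\<bar> \<le> C"
proof -
  note fin = generator_onD(1)[OF G(1)]
  define q where "q = (\<Sum>x\<in>S. \<bar>G0 x x\<bar> + \<bar>G1 x x\<bar>)"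
  have q: "\<bar>G0 x x\<bar> + \<bar>G1 x x\<bar> \<le> q" if "x \<in> S" for x
    unfolding q_def using that fin by (intro member_le_sum[where f = "\<lambda>x. \<bar>G0 x x\<bar> + \<bar>G1 x x\<bar>"]) auto
  have q0: "0 \<le> q" unfolding q_def by (intro sum_nonneg) auto
  \<comment> \<open>Adding \<open>q * v i\<close> to both sides of the equation makes the diagonal
    coefficients nonnegative, so \<open>T\<close> is monotone, and its fixed points are the
    solutions. The constants \<open>-C / l\<close> and \<open>C / l\<close> enclose the
    iteration.\<close>
  define T where "T v i = (max (r0 i + apply_on S G0 v i) (r1 i + apply_on S G1 v i) + q * v i) / (l + q)" for v i
  have mono1: "apply_on S G v i + q * v i \<le> apply_on S G w i + q * w i"
    if G: "generator_on S G" and Gq: "\<bar>G i i\<bar> \<le> q" and i: "i \<in> S" and vw: "\<And>j. j \<in> S \<Longrightarrow> v j \<le> w j" for G v w i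
  proof -
    have eq: "apply_on S G f i + q * f i = (\<Sum>j\<in>S - {i}. G i j * f j) + (G i i + q) * f i" for f
      unfolding apply_on_def by (subst sum.remove[OF fin i]) (simp add: algebra_simps)
    show ?thesis unfolding eq
      using generator_onD(2)[OF G i] Gq vw i by (intro add_mono sum_mono mult_left_mono) auto
  qed
  have T_mono: "T v i \<le> T w i" if "i \<in> S" "\<And>j. j \<in> S \<Longrightarrow> v j \<le> w j" for v w i
  proof -
    have q': "\<bar>G0 i i\<bar> \<le> q" "\<bar>G1 i i\<bar> \<le> q" using q[OF that(1)] by auto
    have "apply_on S G0 v i + q * v i \<le> apply_on S G0 w i + q * w i"
      "apply_on S G1 v i + q * v i \<le> apply_on S G1 w i + q * w i"
      by (auto intro!: mono1 G q' that)
    then show ?thesis unfolding T_def using l q0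
      by (intro divide_right_mono) (linarith, simp)
  qed
  have T_const: "T (\<lambda>_. c) i = (max (r0 i) (r1 i) + q * c) / (l + q)" if "i \<in> S" for c i
    using that G by (simp add: T_def generator_apply_const)
  define V where "V n = (T ^^ n) (\<lambda>_. - C / l)" for n
  have V_Suc: "V (Suc n) = T (V n)" and V0: "V 0 = (\<lambda>_. - C / l)" for n by (auto simp: V_def)
  have low: "- C / l \<le> T (\<lambda>_. - C / l) i" if "i \<in> S" for i
  proof -
    have "(l + q) * (- C / l) = - C + q * (- C / l)" using l by (simp add: field_simps)
    also have "\<dots> \<le> max (r0 i) (r1 i) + q * (- C / l)" using C[OF that] by auto
    finally show ?thesis unfolding T_const[OF that] using l q0 by (simp add: pos_le_divide_eq mult.commute)
  qed
  have high: "T (\<lambda>_. C / l) i \<le> C / l" if "i \<in> S" for i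
  proof -
    have "max (r0 i) (r1 i) + q * (C / l) \<le> C + q * (C / l)" using C[OF that] by auto
    also have "\<dots> = (l + q) * (C / l)" using l by (simp add: field_simps)
    finally show ?thesis unfolding T_const[OF that] using l q0 by (simp add: pos_divide_le_eq mult.commute)
  qed
  have V_inc: "i \<in> S \<Longrightarrow> V n i \<le> V (Suc n) i" for n i
  proof (induction n arbitrary: i)
    case 0 then show ?case using low by (simp add: V_Suc V0)
  next
    case (Suc n) then show ?case using T_mono[of i "V n" "V (Suc n)"] by (simp add: V_Suc)
  qed
  have V_le: "i \<in> S \<Longrightarrow> V n i \<le> C / l" for n i
  proof (induction n arbitrary: i)
    case 0
    have "- C \<le> C" using C[OF 0] by linarith
    then show ?case using l by (simp add: V0 divide_right_mono)
  next
    case (Suc n) then show ?case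
      using T_mono[of i "V n" "\<lambda>_. C / l"] high[of i] by (force simp add: V_Suc)
  qed
  have V_ge: "i \<in> S \<Longrightarrow> - C / l \<le> V n i" for n i
  proof (induction n)
    case (Suc n) then show ?case using V_inc[of i n] by linarith
  qed (simp add: V0)
  have "\<exists>L. (\<lambda>n. V n i) \<longlonglongrightarrow> L" if "i \<in> S" for i
  proof -
    have "incseq (\<lambda>n. V n i)" using V_inc[OF that] by (rule incseq_SucI)
    from incseq_convergent[OF this] V_le[OF that] show ?thesis by blast
  qed
  then obtain v where v: "\<And>i. i \<in> S \<Longrightarrow> (\<lambda>n. V n i) \<longlonglongrightarrow> v i" by metis
  show ?thesis
  proof (intro exI ballI conjI)
    fix i assume i: "i \<in> S"
    have "(\<lambda>n. T (V n) i) \<longlonglongrightarrow> T v i"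
      unfolding T_def using i l q0 by (intro tendsto_intros apply_on_tendsto fin v) auto
    moreover have "(\<lambda>n. T (V n) i) \<longlonglongrightarrow> v i"
      using LIMSEQ_Suc[OF v[OF i]] by (simp add: V_Suc)
    ultimately have "T v i = v i" by (rule LIMSEQ_unique)
    then have "(l + q) * v i = max (r0 i + apply_on S G0 v i) (r1 i + apply_on S G1 v i) + q * v i"
      unfolding T_def using l q0 by (simp add: divide_eq_eq mult.commute)
    then show "l * v i = max (r0 i + apply_on S G0 v i) (r1 i + apply_on S G1 v i)"
      by (simp add: algebra_simps)
    have "v i \<le> C / l" using v[OF i] V_le[OF i] by (meson LIMSEQ_le_const2)
    moreover have "- C / l \<le> v i" using v[OF i] V_ge[OF i] by (meson LIMSEQ_le_const)
    ultimately show "\<bar>l * v i\<bar> \<le> C" using l by (auto simp: field_simps abs_le_iff)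
  qed
qed

text \<open>The resolvents \<open>l (l - G)\<inverse> f\<close> accumulate at an invariant function, and \<open>f\<close> differs from it by
  a limit of elements of the range of \<open>G\<close>.\<close>

lemma time_avg_converges:
  assumes G: "generator_on S G" and x: "x \<in> S"
  shows "\<exists>L. (time_avg S G f x \<longlongrightarrow> L) at_top"
proof -
  note fin = generator_onD(1)[OF G]
  define C where "C = (\<Sum>y\<in>S. \<bar>f y\<bar>)"
  have C: "\<bar>f y\<bar> \<le> C" if "y \<in> S" for y
    unfolding C_def using fin that by (intro member_le_sum) auto
  define lam where "lam n = inverse (real (Suc n))" for n
  have lam: "0 < lam n" for n by (simp add: lam_def)
  have lam0: "lam \<longlonglongrightarrow> 0" unfolding lam_def by (rule LIMSEQ_inverse_real_of_nat)
  \<comment> \<open>With the same generator and reward for both actions the maximum collapses and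
    the equation becomes the linear resolvent equation.\<close>
  have "\<exists>v. \<forall>i\<in>S. lam n * v i = f i + apply_on S G v i \<and> \<bar>lam n * v i\<bar> \<le> C" for n
    using discounted_equation[OF G G lam, of f C f n] C by simp
  then obtain v where v: "\<And>n i. i \<in> S \<Longrightarrow> lam n * v n i = f i + apply_on S G (v n) i"
      "\<And>n i. i \<in> S \<Longrightarrow> \<bar>lam n * v n i\<bar> \<le> C"
    by metis
  obtain r g where r: "strict_mono r" and g: "\<And>i. i \<in> S \<Longrightarrow> (\<lambda>n. lam (r n) * v (r n) i) \<longlonglongrightarrow> g i"
    using finite_bounded_subseq[OF fin, of "\<lambda>n i. lam n * v n i"] v(2) by blast
  have lamr: "(\<lambda>n. lam (r n)) \<longlonglongrightarrow> 0" using LIMSEQ_subseq_LIMSEQ[OF lam0 r] by (simp add: comp_def)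
  have "apply_on S G g i = 0" if i: "i \<in> S" for i
  proof -
    have "(\<lambda>n. apply_on S G (\<lambda>i. lam (r n) * v (r n) i) i) \<longlonglongrightarrow> apply_on S G g i"
      by (intro apply_on_tendsto fin g)
    moreover have "apply_on S G (\<lambda>i. lam (r n) * v (r n) i) i = lam (r n) * (lam (r n) * v (r n) i - f i)" for n
      using v(1)[OF i, of "r n"] by (simp add: apply_on_cmult)
    ultimately have "(\<lambda>n. lam (r n) * (lam (r n) * v (r n) i - f i)) \<longlonglongrightarrow> apply_on S G g i" by simp
    moreover have "(\<lambda>n. lam (r n) * (lam (r n) * v (r n) i - f i)) \<longlonglongrightarrow> 0 * (g i - f i)"
      using i by (intro tendsto_intros lamr g)
    ultimately have "apply_on S G g i = 0 * (g i - f i)" by (rule LIMSEQ_unique)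
    then show ?thesis by simp
  qed
  note inv = trans_fun_invariant[OF G _ x this]
  have TAg: "time_avg S G g x T = g x" if "0 < T" for T
  proof -
    have "integral {0..T} (\<lambda>t. apply_on S (trans_fun S G t) g x) = integral {0..T} (\<lambda>t. g x)"
      using inv by (intro integral_cong) auto
    then show ?thesis using that by (simp add: time_avg_eq)
  qed
  have "(time_avg S G f x \<longlongrightarrow> g x) at_top"
  proof (rule tendstoI)
    fix e :: real assume e: "0 < e"
    have "\<forall>i\<in>S. eventually (\<lambda>n. \<bar>lam (r n) * v (r n) i - g i\<bar> < e / 2) sequentially"
      using tendstoD[OF g, of _ "e / 2"] e by (simp add: dist_real_def)
    then have "eventually (\<lambda>n. \<forall>i\<in>S. \<bar>lam (r n) * v (r n) i - g i\<bar> < e / 2) sequentially"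
      using fin by (simp add: eventually_ball_finite)
    then obtain n where n: "\<And>i. i \<in> S \<Longrightarrow> \<bar>lam (r n) * v (r n) i - g i\<bar> < e / 2"
      unfolding eventually_sequentially by blast
    \<comment> \<open>From here \<open>n\<close> is fixed: \<open>f + ?w\<close> is uniformly within
      \<open>e / 2\<close> of the invariant function \<open>g\<close>, and the average of
      \<open>?w\<close> vanishes as \<open>T\<close> grows. The order of the two limits
      matters.\<close>
    let ?w = "apply_on S G (v (r n))"
    have lo: "f i + ?w i \<le> g i + e / 2" and hi: "g i - e / 2 \<le> f i + ?w i" if "i \<in> S" for i
      using n[OF that] v(1)[OF that, of "r n"] by (simp_all only: abs_less_iff, linarith+)
    have ev: "eventually (\<lambda>T. \<bar>time_avg S G ?w x T\<bar> < e / 2) at_top"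
      using tendstoD[OF time_avg_generator_tendsto_0[OF G x, of "v (r n)"], of "e / 2"] e by (simp add: dist_real_def)
    show "eventually (\<lambda>T. dist (time_avg S G f x T) (g x) < e) at_top"
      using ev eventually_gt_at_top[of 0]
    proof eventually_elim
      case (elim T)
      have 1: "time_avg S G (\<lambda>i. f i + ?w i) x T = time_avg S G f x T + time_avg S G ?w x T"
        by (rule time_avg_add[OF fin x])
      have "time_avg S G (\<lambda>i. f i + ?w i) x T \<le> time_avg S G (\<lambda>i. g i + e / 2) x T"
        using lo elim by (intro time_avg_le[OF G x]) auto
      moreover have "time_avg S G (\<lambda>i. g i - e / 2) x T \<le> time_avg S G (\<lambda>i. f i + ?w i) x T"
        using hi elim by (intro time_avg_le[OF G x]) auto
      moreover have "time_avg S G (\<lambda>i. g i + c) x T = g x + c" for c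
        using elim by (simp add: time_avg_add[OF fin x] time_avg_const[OF G x] TAg)
      from this[of "e/2"] this[of "- (e/2)"]
      have "time_avg S G (\<lambda>i. g i + e / 2) x T = g x + e / 2" "time_avg S G (\<lambda>i. g i - e / 2) x T = g x - e / 2"
        by auto
      ultimately show ?case using 1 elim by (auto simp: dist_real_def abs_less_iff)
    qed
  qed
  then show ?thesis by blast
qed

section \<open>The subsidy problem\<close>

definition irreducible_on :: "'s set \<Rightarrow> ('s \<Rightarrow> 's \<Rightarrow> real) \<Rightarrow> bool" where
  "irreducible_on S G \<longleftrightarrow> (\<forall>i\<in>S. \<forall>j\<in>S. (i, j) \<in> {(k, l). k \<in> S \<and> l \<in> S \<and> k \<noteq> l \<and> 0 < G k l}\<^sup>*)"

lemma apply_on_argmin: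
  assumes "generator_on S G" "x \<in> S" "\<And>y. y \<in> S \<Longrightarrow> f x \<le> f y"
  shows "0 \<le> apply_on S G f x"
  unfolding apply_on_sub_point[OF assms(1,2)]
  using assms generator_onD(2)[OF assms(1,2)] by (intro sum_nonneg mult_nonneg_nonneg) auto

lemma apply_on_argmax:
  assumes "generator_on S G" "x \<in> S" "\<And>y. y \<in> S \<Longrightarrow> f y \<le> f x"
  shows "apply_on S G f x \<le> 0"
  using apply_on_argmin[OF assms(1,2), of "\<lambda>y. - f y"] apply_on_cmult[of S G "-1" f x] assms(3) by simp

lemma finite_argmin:
  assumes "finite S" "S \<noteq> {}"
  shows "\<exists>x\<in>S. \<forall>y\<in>S. (f x :: real) \<le> f y"
  using arg_min_if_finite[OF assms, of f] by (intro bexI[of _ "arg_min_on f S"]) (auto simp: not_less)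

lemma finite_argmax:
  assumes "finite S" "S \<noteq> {}"
  shows "\<exists>x\<in>S. \<forall>y\<in>S. f y \<le> (f x :: real)"
  using finite_argmin[OF assms, of "\<lambda>x. - f x"] by simp

text \<open>Start at a minimizer \<open>x\<close> of \<open>v\<close> and follow edges of positive
  rate. At each vertex the other increments cannot be very negative, since \<open>v x\<close> is
  minimal, so the upper bound on \<open>G v\<close> limits how much larger \<open>v\<close> is at
  the next vertex. The resulting constant depends on the path but not on \<open>v\<close>.\<close>

lemma irreducible_span_bound:
  assumes G: "generator_on S G" and irr: "irreducible_on S G"
  shows "\<exists>K\<ge>0. \<forall>v. (\<forall>i\<in>S. apply_on S G v i \<le> C) \<longrightarrow> (\<forall>i\<in>S. \<forall>j\<in>S. v i - v j \<le> K)"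
proof -
  note fin = generator_onD(1)[OF G]
  have path: "\<exists>K\<ge>0. \<forall>v. (\<forall>i\<in>S. apply_on S G v i \<le> C) \<longrightarrow> (\<forall>i\<in>S. v x \<le> v i) \<longrightarrow> v y - v x \<le> K"
    if "(x, y) \<in> {(k, l). k \<in> S \<and> l \<in> S \<and> k \<noteq> l \<and> 0 < G k l}\<^sup>*" for x y
    using that
  proof (induction rule: rtrancl_induct)
    case base show ?case by (intro exI[of _ 0]) auto
  next
    case (step y z)
    then obtain K where K: "0 \<le> K"
      "\<And>v. (\<forall>i\<in>S. apply_on S G v i \<le> C) \<Longrightarrow> (\<forall>i\<in>S. v x \<le> v i) \<Longrightarrow> v y - v x \<le> K" by blast
    have yz: "y \<in> S" "z \<in> S" "y \<noteq> z" "0 < G y z" using step by auto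
    define g where "g = (\<Sum>j\<in>S - {y} - {z}. G y j)"
    have g: "0 \<le> g" unfolding g_def using generator_onD(2)[OF G yz(1)] by (intro sum_nonneg) auto
    \<comment> \<open>The new bound solves
      \<open>G y z * (v z - v y) - g * K <= \<bar>C\<bar>\<close> for the increment along the edge;
      the absolute value keeps the constant nonnegative.\<close>
    show ?case
    proof (intro exI[of _ "K + (\<bar>C\<bar> + g * K) / G y z"] conjI allI impI)
      show "0 \<le> K + (\<bar>C\<bar> + g * K) / G y z" using K yz g by auto
      fix v assume v: "\<forall>i\<in>S. apply_on S G v i \<le> C" "\<forall>i\<in>S. v x \<le> v i"
      have yx: "v y - v x \<le> K" by (rule K(2)[OF v])
      have "apply_on S G v y = G y z * (v z - v y) + (\<Sum>j\<in>S - {y} - {z}. G y j * (v j - v y))"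
        unfolding apply_on_sub_point[OF G yz(1)] using yz fin by (subst sum.remove[of _ z]) auto
      moreover have "(\<Sum>j\<in>S - {y} - {z}. G y j * (v j - v y)) \<ge> (\<Sum>j\<in>S - {y} - {z}. G y j * (- K))"
      proof (intro sum_mono mult_left_mono)
        fix j assume "j \<in> S - {y} - {z}"
        then show "- K \<le> v j - v y" "0 \<le> G y j" using v(2) yx generator_onD(2)[OF G yz(1)] by force+
      qed
      moreover have "(\<Sum>j\<in>S - {y} - {z}. G y j * (- K)) = - (g * K)"
        by (simp add: g_def sum_distrib_right sum_negf)
      ultimately have "G y z * (v z - v y) \<le> \<bar>C\<bar> + g * K" using v(1) yz(1) by force
      then have "v z - v y \<le> (\<bar>C\<bar> + g * K) / G y z" using yz by (simp add: pos_le_divide_eq mult.commute)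
      then show "v z - v x \<le> K + (\<bar>C\<bar> + g * K) / G y z" using yx by linarith
    qed
  qed
  have "\<forall>x\<in>S. \<forall>y\<in>S. \<exists>K\<ge>0. \<forall>v. (\<forall>i\<in>S. apply_on S G v i \<le> C) \<longrightarrow> (\<forall>i\<in>S. v x \<le> v i) \<longrightarrow> v y - v x \<le> K"
    using path irr unfolding irreducible_on_def by blast
  then obtain K where K: "\<And>x y. x \<in> S \<Longrightarrow> y \<in> S \<Longrightarrow> 0 \<le> K x y"
    "\<And>x y v. x \<in> S \<Longrightarrow> y \<in> S \<Longrightarrow> (\<forall>i\<in>S. apply_on S G v i \<le> C) \<Longrightarrow> (\<forall>i\<in>S. v x \<le> v i) \<Longrightarrow> v y - v x \<le> K x y"
    by metis
  define L where "L = (\<Sum>x\<in>S. \<Sum>y\<in>S. K x y)"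
  have L: "K x y \<le> L" if "x \<in> S" "y \<in> S" for x y
  proof -
    have "K x y \<le> (\<Sum>y\<in>S. K x y)" using that K fin by (intro member_le_sum) auto
    also have "\<dots> \<le> L" unfolding L_def using that K fin
      by (intro member_le_sum[where f = "\<lambda>x. \<Sum>y\<in>S. K x y"]) (auto intro: sum_nonneg)
    finally show ?thesis .
  qed
  show ?thesis
  proof (intro exI[of _ L] conjI allI impI ballI)
    show "0 \<le> L" unfolding L_def using K by (intro sum_nonneg) auto
    fix v i j assume v: "\<forall>i\<in>S. apply_on S G v i \<le> C" and ij: "i \<in> S" "j \<in> S"
    obtain x where x: "x \<in> S" "\<forall>y\<in>S. v x \<le> v y" using finite_argmin[OF fin] ij by blast
    have "v i - v x \<le> L" using K(2)[OF x(1) ij(1) v x(2)] L[OF x(1) ij(1)] by linarith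
    then show "v i - v j \<le> L" using x(2) ij(2) by force
  qed
qed

text \<open>The span bound applies to every positive multiple of a superharmonic function.\<close>

lemma irreducible_superharmonic_const:
  assumes G: "generator_on S G" and irr: "irreducible_on S G"
    and w: "\<And>i. i \<in> S \<Longrightarrow> apply_on S G w i \<le> 0" and ij: "i \<in> S" "j \<in> S"
  shows "w i = w j"
proof -
  obtain K where K: "\<And>v i j. (\<forall>i\<in>S. apply_on S G v i \<le> 0) \<Longrightarrow> i \<in> S \<Longrightarrow> j \<in> S \<Longrightarrow> v i - v j \<le> K"
    using irreducible_span_bound[OF G irr, of 0] by blast
  have le: "w i \<le> w j" if ij: "i \<in> S" "j \<in> S" for i j
  proof (rule ccontr)
    assume "\<not> w i \<le> w j"
    then obtain n :: nat where n: "K < real n * (w i - w j)" using reals_Archimedean3[of "w i - w j"] by auto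
    have "\<forall>i\<in>S. apply_on S G (\<lambda>i. real n * w i) i \<le> 0"
      using w by (simp add: apply_on_cmult mult_nonneg_nonpos)
    from K[OF this ij] n show False by (simp add: algebra_simps)
  qed
  show ?thesis using le ij by (simp add: antisym)
qed

section \<open>The optimality equation of one bandit: existence, gain and uniqueness\<close>

lemma is_generator_iff: "is_generator d M \<longleftrightarrow> generator_on {1..d} M"
  by (auto simp: is_generator_def generator_on_def)

lemma generator_on_policy:
  assumes "generator_on S (Q 0)" "generator_on S (Q 1)" "\<And>i. i \<in> S \<Longrightarrow> u i \<in> {0, 1 :: nat}"
  shows "generator_on S (\<lambda>k l. Q (u k) k l)"
proof -
  have "generator_on S (Q (u i))" if "i \<in> S" for i
    using assms(1,2) assms(3)[OF that] by auto
  then show ?thesis using generator_onD(1)[OF assms(1)] by (simp add: generator_on_def)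
qed

lemma unichain_irreducible:
  assumes "unichain d Q" "\<And>i. i \<in> {1..d} \<Longrightarrow> u i \<in> {0, 1 :: nat}"
  shows "irreducible_on {1..d} (\<lambda>k l. Q (u k) k l)"
  using assms unfolding unichain_def irreducible_on_def by blast

lemma qval_eq: "qval d Q R \<nu> h a i = R a i + (if a = 0 then \<nu> else 0) + apply_on {1..d} (Q a) h i"
  by (simp add: qval_def apply_on_def)

lemma apply_on_shift:
  "generator_on S G \<Longrightarrow> x \<in> S \<Longrightarrow> apply_on S G (\<lambda>y. f y - c) x = apply_on S G f x"
  by (simp add: apply_on_diff generator_apply_const)

locale bandit =
  fixes d :: nat and Q :: "nat \<Rightarrow> nat \<Rightarrow> nat \<Rightarrow> real" and R :: "nat \<Rightarrow> nat \<Rightarrow> real"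
  assumes d: "1 \<le> d"
    and gen: "a \<in> {0, 1} \<Longrightarrow> generator_on {1..d} (Q a)"
    and uni: "unichain d Q"
begin

abbreviation "SS \<equiv> {1..d}"

definition rmax :: real where "rmax = (\<Sum>i\<in>SS. \<bar>R 0 i\<bar> + \<bar>R 1 i\<bar>)"

lemma R_le_rmax: "i \<in> SS \<Longrightarrow> a \<in> {0, 1} \<Longrightarrow> \<bar>R a i\<bar> \<le> rmax"
proof -
  assume i: "i \<in> SS" and a: "a \<in> {0, 1}"
  have "\<bar>R 0 i\<bar> + \<bar>R 1 i\<bar> \<le> rmax"
    unfolding rmax_def using i by (intro member_le_sum[where f = "\<lambda>i. \<bar>R 0 i\<bar> + \<bar>R 1 i\<bar>"]) auto
  then show ?thesis using a by auto
qed

lemma irreducible: "a \<in> {0, 1} \<Longrightarrow> irreducible_on SS (Q a)"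
  using unichain_irreducible[OF uni, of "\<lambda>_. a"] by simp

text \<open>Meant for bias functions: the optimality equation bounds \<open>Q a h\<close> from above
  by the gain minus the reward of \<open>a\<close>, so control of that difference for a single
  action bounds the span of \<open>h\<close>.\<close>

lemma span_bound:
  "\<exists>K\<ge>0. \<forall>a\<in>{0,1}. \<forall>v. (\<forall>i\<in>SS. apply_on SS (Q a) v i \<le> C) \<longrightarrow> (\<forall>i\<in>SS. \<forall>j\<in>SS. \<bar>v i - v j\<bar> \<le> K)"
proof -
  have "\<exists>K\<ge>0. \<forall>v. (\<forall>i\<in>SS. apply_on SS (Q a) v i \<le> C) \<longrightarrow> (\<forall>i\<in>SS. \<forall>j\<in>SS. v i - v j \<le> K)"
    if "a \<in> {0, 1}" for a
    using irreducible_span_bound[OF gen irreducible, OF that that] .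
  then obtain K where K: "\<And>a. a \<in> {0,1} \<Longrightarrow> K a \<ge> (0::real)"
    "\<And>a v i j. a \<in> {0,1} \<Longrightarrow> \<forall>i\<in>SS. apply_on SS (Q a) v i \<le> C \<Longrightarrow> i \<in> SS \<Longrightarrow> j \<in> SS \<Longrightarrow> v i - v j \<le> K a"
    by metis
  show ?thesis
  proof (intro exI[of _ "K 0 + K 1"] conjI ballI allI impI)
    show "0 \<le> K 0 + K 1" using K(1)[of 0] K(1)[of 1] by simp
    fix a v i j assume *: "a \<in> {0, 1::nat}" "\<forall>i\<in>SS. apply_on SS (Q a) v i \<le> C" "i \<in> SS" "j \<in> SS"
    have "K a \<le> K 0 + K 1" using K(1)[of 0] K(1)[of 1] *(1) by auto
    then show "\<bar>v i - v j\<bar> \<le> K 0 + K 1" using K(2)[OF *] K(2)[OF *(1,2,4,3)] by (auto simp: abs_le_iff)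
  qed
qed

text \<open>Common compactness argument: it covers the vanishing discount limit (\<open>k n i\<close> the discounted
  value times the discount rate) and limits of solutions in \<open>\<nu>\<close> (\<open>k n i\<close> the gain).\<close>

lemma bellman_limit:
  assumes \<nu>: "\<nu> \<longlonglongrightarrow> \<nu>'"
    and eq: "\<And>n i. i \<in> SS \<Longrightarrow> k n i = max (qval d Q R (\<nu> n) (h n) 0 i) (qval d Q R (\<nu> n) (h n) 1 i)"
    and k: "\<And>n i. i \<in> SS \<Longrightarrow> \<bar>k n i\<bar> \<le> C"
    and span: "\<And>n i. i \<in> SS \<Longrightarrow> \<bar>h n i - h n 1\<bar> \<le> C"
    and flat: "\<And>i. i \<in> SS \<Longrightarrow> (\<lambda>n. k n i - k n 1) \<longlonglongrightarrow> 0"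
  shows "\<exists>r g h'. strict_mono r \<and> subsidy_opt_eq d Q R \<nu>' g h' \<and>
    (\<forall>i\<in>SS. \<forall>a\<in>{0,1}. (\<lambda>n. qval d Q R (\<nu> (r n)) (h (r n)) a i) \<longlonglongrightarrow> qval d Q R \<nu>' h' a i)"
proof -
  \<comment> \<open>Index 0 is not a state; it stores the gain, so that one extraction of a
    subsequence serves gain and bias together.\<close>
  define f where "f n i = (if i = 0 then k n 1 else h n i - h n 1)" for n i
  have "\<exists>c. \<forall>n. \<bar>f n i\<bar> \<le> c" if "i \<in> {0..d}" for i
    using k[of 1] span[of i] that d by (intro exI[of _ C]) (auto simp: f_def)
  then obtain r h' where r: "strict_mono r" and h': "\<And>i. i \<in> {0..d} \<Longrightarrow> (\<lambda>n. f (r n) i) \<longlonglongrightarrow> h' i"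
    using finite_bounded_subseq[of "{0..d}" f] by blast
  have h: "(\<lambda>n. h (r n) i - h (r n) 1) \<longlonglongrightarrow> h' i" if "i \<in> SS" for i
    using h'[of i] that by (simp add: f_def)
  have g: "(\<lambda>n. k (r n) 1) \<longlonglongrightarrow> h' 0"
    using h'[of 0] by (simp add: f_def)
  have nu: "(\<lambda>n. \<nu> (r n)) \<longlonglongrightarrow> \<nu>'" using LIMSEQ_subseq_LIMSEQ[OF \<nu> r] by (simp add: comp_def)
  have q: "(\<lambda>n. qval d Q R (\<nu> (r n)) (h (r n)) a i) \<longlonglongrightarrow> qval d Q R \<nu>' h' a i" if i: "i \<in> SS" and a: "a \<in> {0,1}" for a i
  proof -
    have "(\<lambda>n. R a i + (if a = 0 then \<nu> (r n) else 0) + apply_on SS (Q a) (\<lambda>i. h (r n) i - h (r n) 1) i)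
       \<longlonglongrightarrow> qval d Q R \<nu>' h' a i"
      unfolding qval_eq using nu h by (cases "a = 0") (auto intro!: tendsto_intros apply_on_tendsto)
    then show ?thesis unfolding qval_eq apply_on_shift[OF gen[OF a] i] .
  qed
  have "h' 0 = max (qval d Q R \<nu>' h' 0 i) (qval d Q R \<nu>' h' 1 i)" if i: "i \<in> SS" for i
  proof -
    have "(\<lambda>n. max (qval d Q R (\<nu> (r n)) (h (r n)) 0 i) (qval d Q R (\<nu> (r n)) (h (r n)) 1 i))
       \<longlonglongrightarrow> max (qval d Q R \<nu>' h' 0 i) (qval d Q R \<nu>' h' 1 i)"
      using q[OF i] by (intro tendsto_max) auto
    then have "(\<lambda>n. k (r n) i) \<longlonglongrightarrow> max (qval d Q R \<nu>' h' 0 i) (qval d Q R \<nu>' h' 1 i)"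
      by (simp add: eq[OF i])
    moreover have "(\<lambda>n. (k (r n) i - k (r n) 1) + k (r n) 1) \<longlonglongrightarrow> 0 + h' 0"
      using LIMSEQ_subseq_LIMSEQ[OF flat[OF i] r] g by (intro tendsto_add) (auto simp: comp_def)
    ultimately show ?thesis using LIMSEQ_unique by fastforce
  qed
  then have "subsidy_opt_eq d Q R \<nu>' (h' 0) h'" by (simp add: subsidy_opt_eq_def)
  then show ?thesis using r q by blast
qed

text \<open>Vanishing discount. The spans of the discounted values \<open>v n\<close> are uniformly
  bounded, so \<open>lam n * v n\<close> becomes constant in the limit; that constant is the gain,
  and the centred values converge to a bias.\<close>

lemma bellman_exists: "\<exists>g h. subsidy_opt_eq d Q R \<nu> g h"
proof -
  define C where "C = rmax + \<bar>\<nu>\<bar>"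
  have C: "\<bar>R 0 i + \<nu>\<bar> \<le> C" "\<bar>R 1 i\<bar> \<le> C" if "i \<in> SS" for i
    using R_le_rmax[OF that, of 0] R_le_rmax[OF that, of 1] by (auto simp: C_def)
  define lam where "lam n = inverse (real (Suc n))" for n
  have lam: "0 < lam n" for n by (simp add: lam_def)
  have lam0: "lam \<longlonglongrightarrow> 0" unfolding lam_def by (rule LIMSEQ_inverse_real_of_nat)
  have "\<exists>v. \<forall>i\<in>SS. lam n * v i = max (R 0 i + \<nu> + apply_on SS (Q 0) v i) (R 1 i + apply_on SS (Q 1) v i) \<and> \<bar>lam n * v i\<bar> \<le> C" for n
    using discounted_equation[OF gen gen lam C] by simp
  then obtain v where v: "\<And>n i. i \<in> SS \<Longrightarrow> lam n * v n i = max (R 0 i + \<nu> + apply_on SS (Q 0) (v n) i) (R 1 i + apply_on SS (Q 1) (v n) i)"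
      "\<And>n i. i \<in> SS \<Longrightarrow> \<bar>lam n * v n i\<bar> \<le> C"
    by metis
  obtain K where K: "0 \<le> K" "\<And>v i j. \<forall>i\<in>SS. apply_on SS (Q 1) v i \<le> 2 * C \<Longrightarrow> i \<in> SS \<Longrightarrow> j \<in> SS \<Longrightarrow> \<bar>v i - v j\<bar> \<le> K"
    using span_bound[of "2 * C"] by auto
  \<comment> \<open>The active branch of the maximum bounds \<open>Q 1\<close> applied to
    \<open>v n\<close> by \<open>lam n * v n i - R 1 i\<close>, and each of these two terms is at
    most \<open>C\<close> in absolute value, uniformly in the discount.\<close>
  have "apply_on SS (Q 1) (v n) i \<le> 2 * C" if i: "i \<in> SS" for n i
    using v(1)[OF i, of n] v(2)[OF i, of n] C(2)[OF i] by (auto simp: abs_le_iff max_def split: if_splits)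
  then have span: "\<bar>v n i - v n j\<bar> \<le> K" if "i \<in> SS" "j \<in> SS" for n i j
    using K(2)[of "v n" i j] that by blast
  have "\<exists>r g h'. strict_mono (r :: nat \<Rightarrow> nat) \<and> subsidy_opt_eq d Q R \<nu> g h' \<and>
    (\<forall>i\<in>SS. \<forall>a\<in>{0,1}. (\<lambda>n. qval d Q R \<nu> (v (r n)) a i) \<longlonglongrightarrow> qval d Q R \<nu> h' a i)"
  proof (rule bellman_limit[where k = "\<lambda>n i. lam n * v n i" and C = "max C K"])
    fix i assume i: "i \<in> SS"
    have "(\<lambda>n. K * lam n) \<longlonglongrightarrow> K * 0" by (intro tendsto_intros lam0)
    then have lim: "(\<lambda>n. K * lam n) \<longlonglongrightarrow> 0" by simp
    have b: "\<forall>n. norm (lam n * v n i - lam n * v n 1) \<le> K * lam n"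
    proof
      fix n
      have "norm (lam n * v n i - lam n * v n 1) = lam n * \<bar>v n i - v n 1\<bar>"
        using lam[of n] by (simp add: right_diff_distrib[symmetric] abs_mult)
      also have "\<dots> \<le> lam n * K" using span[of i 1 n] i d lam[of n] by (intro mult_left_mono) auto
      finally show "norm (lam n * v n i - lam n * v n 1) \<le> K * lam n" by (simp add: mult.commute)
    qed
    show "(\<lambda>n. lam n * v n i - lam n * v n 1) \<longlonglongrightarrow> 0"
      by (rule Lim_null_comparison[OF always_eventually[OF b] lim])
  next
    fix n i assume i: "i \<in> SS"
    show "\<bar>lam n * v n i\<bar> \<le> max C K" using v(2)[OF i, of n] by simp
    show "\<bar>v n i - v n 1\<bar> \<le> max C K" using span[of i 1 n] i d by simp
    show "lam n * v n i = max (qval d Q R \<nu> (v n) 0 i) (qval d Q R \<nu> (v n) 1 i)"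
      using v(1)[OF i, of n] by (simp add: qval_eq)
  qed auto
  then show ?thesis by blast
qed

lemma subsidy_opt_eqD:
  assumes "subsidy_opt_eq d Q R \<nu> g h" "i \<in> SS"
  shows "g = max (qval d Q R \<nu> h 0 i) (qval d Q R \<nu> h 1 i)"
    "R 0 i + \<nu> + apply_on SS (Q 0) h i \<le> g" "R 1 i + apply_on SS (Q 1) h i \<le> g"
proof -
  show 1: "g = max (qval d Q R \<nu> h 0 i) (qval d Q R \<nu> h 1 i)"
    using assms by (simp add: subsidy_opt_eq_def)
  show "R 0 i + \<nu> + apply_on SS (Q 0) h i \<le> g" "R 1 i + apply_on SS (Q 1) h i \<le> g"
    unfolding 1 by (simp_all add: qval_eq)
qed

text \<open>Evaluate the equation at a minimizer and at a maximizer of \<open>h\<close>, where the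
  generator terms have a sign. For \<nu> at most 0 the upper bound is free of \<nu>, and for \<nu>
  at least 0 its distance to the second lower bound is; both matter for extreme subsidies.\<close>

lemma gain_bounds:
  assumes "subsidy_opt_eq d Q R \<nu> g h"
  shows "- rmax \<le> g" "\<nu> - rmax \<le> g" "g \<le> rmax + max \<nu> 0"
proof -
  obtain i where i: "i \<in> SS" "\<And>j. j \<in> SS \<Longrightarrow> h i \<le> h j" using finite_argmin[of SS h] d by auto
  have 0: "0 \<le> apply_on SS (Q a) h i" if "a \<in> {0,1}" for a
    by (rule apply_on_argmin[OF gen[OF that] i(1)]) (rule i(2))
  show "- rmax \<le> g" "\<nu> - rmax \<le> g"
    using subsidy_opt_eqD(2,3)[OF assms i(1)] 0[of 0] 0[of 1] R_le_rmax[OF i(1), of 0] R_le_rmax[OF i(1), of 1]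
    by auto
  obtain j where j: "j \<in> SS" "\<And>i. i \<in> SS \<Longrightarrow> h i \<le> h j" using finite_argmax[of SS h] d by auto
  have 1: "apply_on SS (Q a) h j \<le> 0" if "a \<in> {0,1}" for a
    by (rule apply_on_argmax[OF gen[OF that] j(1)]) (rule j(2))
  show "g \<le> rmax + max \<nu> 0"
    using subsidy_opt_eqD(1)[OF assms j(1)] 1[of 0] 1[of 1] R_le_rmax[OF j(1), of 0] R_le_rmax[OF j(1), of 1]
    by (auto simp: qval_eq max_def split: if_splits)
qed

text \<open>At a minimizer of \<open>h' - h\<close> the generator of either action gives a
  nonnegative value on this difference, so each branch of the maximum is larger for
  \<open>h'\<close>.\<close>

lemma gain_le:
  assumes "subsidy_opt_eq d Q R \<nu> g h" "subsidy_opt_eq d Q R \<nu> g' h'"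
  shows "g \<le> g'"
proof -
  obtain i where i: "i \<in> SS" "\<And>j. j \<in> SS \<Longrightarrow> h' i - h i \<le> h' j - h j"
    using finite_argmin[of SS "\<lambda>i. h' i - h i"] d by auto
  have 0: "0 \<le> apply_on SS (Q a) h' i - apply_on SS (Q a) h i" if "a \<in> {0,1}" for a
    unfolding apply_on_diff[symmetric] by (rule apply_on_argmin[OF gen[OF that] i(1)]) (rule i(2))
  show ?thesis
    unfolding subsidy_opt_eqD(1)[OF assms(1) i(1)] subsidy_opt_eqD(1)[OF assms(2) i(1)]
    using 0[of 0] 0[of 1] by (intro max.mono) (auto simp: qval_eq)
qed

text \<open>The difference of two solutions is superharmonic for a policy that is greedy for the first one.\<close>

lemma bellman_unique:
  assumes s: "subsidy_opt_eq d Q R \<nu> g h" "subsidy_opt_eq d Q R \<nu> g' h'"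
    and i: "i \<in> SS" and a: "a \<in> {0, 1}"
  shows "qval d Q R \<nu> h' a i = qval d Q R \<nu> h a i"
proof -
  have g: "g = g'" using gain_le[OF s] gain_le[OF s(2,1)] by simp
  define u where "u i = (if qval d Q R \<nu> h 1 i \<le> qval d Q R \<nu> h 0 i then 0 else 1 :: nat)" for i
  have u: "u i \<in> {0, 1}" for i by (simp add: u_def)
  have qu: "qval d Q R \<nu> h (u i) i = g" if "i \<in> SS" for i
    unfolding subsidy_opt_eqD(1)[OF s(1) that] by (auto simp: u_def max_def)
  let ?G = "\<lambda>k l. Q (u k) k l"
  have G: "generator_on SS ?G" by (rule generator_on_policy[OF gen gen u]) auto
  have irr: "irreducible_on SS ?G" using u by (intro unichain_irreducible[OF uni])
  have aG: "apply_on SS ?G f i = apply_on SS (Q (u i)) f i" for f i by (simp add: apply_on_def)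
  have "apply_on SS ?G (\<lambda>i. h' i - h i) i \<le> 0" if i: "i \<in> SS" for i
  proof -
    have "qval d Q R \<nu> h' (u i) i \<le> g'"
      unfolding subsidy_opt_eqD(1)[OF s(2) i] using u[of i] by auto
    then show ?thesis using qu[OF i] g unfolding aG apply_on_diff qval_eq by linarith
  qed
  note superharmonic = this
  have c: "h' j - h j = h' 1 - h 1" if "j \<in> SS" for j
    by (rule irreducible_superharmonic_const[OF G irr superharmonic that]) (use d in auto)
  have "apply_on SS (Q a) (\<lambda>j. h' j - h j) i = apply_on SS (Q a) (\<lambda>j. h' 1 - h 1) i"
    by (rule apply_on_cong, rule c)
  then show ?thesis using generator_apply_const[OF gen[OF a] i] by (simp add: qval_eq apply_on_diff)
qed

section \<open>Passive sets, extreme subsidies and the Whittle index\<close>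

lemma passive_set_iff:
  assumes "subsidy_opt_eq d Q R \<nu> g h" "i \<in> SS"
  shows "i \<in> passive_set d Q R \<nu> \<longleftrightarrow> qval d Q R \<nu> h 1 i \<le> qval d Q R \<nu> h 0 i"
proof
  assume "i \<in> passive_set d Q R \<nu>"
  then obtain g' h' where s: "subsidy_opt_eq d Q R \<nu> g' h'" and le: "qval d Q R \<nu> h' 1 i \<le> qval d Q R \<nu> h' 0 i"
    by (auto simp: passive_set_def)
  \<comment> \<open>The solution witnessing membership may differ from the given one; uniqueness of
    the action values transfers the comparison.\<close>
  show "qval d Q R \<nu> h 1 i \<le> qval d Q R \<nu> h 0 i"
    using le bellman_unique[OF assms(1) s assms(2), of 0] bellman_unique[OF assms(1) s assms(2), of 1] by simp
next
  assume "qval d Q R \<nu> h 1 i \<le> qval d Q R \<nu> h 0 i"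
  then show "i \<in> passive_set d Q R \<nu>" using assms by (auto simp: passive_set_def)
qed

text \<open>A convergent sequence of subsidies is bounded, which bounds the gains and then, through
  the active action, the spans. So solutions have limit points, and the optimality equation is
  closed in \<nu>.\<close>

lemma bellman_seq_limit:
  assumes "\<nu> \<longlonglongrightarrow> \<nu>'"
  shows "\<exists>r g h'. strict_mono r \<and> subsidy_opt_eq d Q R \<nu>' g h' \<and>
    (\<exists>h g'. (\<forall>n. subsidy_opt_eq d Q R (\<nu> n) (g' n) (h n)) \<and>
    (\<forall>i\<in>SS. \<forall>a\<in>{0,1}. (\<lambda>n. qval d Q R (\<nu> (r n)) (h (r n)) a i) \<longlonglongrightarrow> qval d Q R \<nu>' h' a i))"
proof -
  obtain g h where s: "\<And>n. subsidy_opt_eq d Q R (\<nu> n) (g n) (h n)"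
  proof -
    have "\<forall>n. \<exists>g h. subsidy_opt_eq d Q R (\<nu> n) g h" using bellman_exists by blast
    then show ?thesis using that by metis
  qed
  have "Bseq \<nu>" using assms convergent_imp_Bseq convergentI by blast
  then obtain B where B: "\<And>n. \<bar>\<nu> n\<bar> \<le> B" using BseqE by (metis real_norm_def)
  have g: "\<bar>g n\<bar> \<le> rmax + B" for n using gain_bounds[OF s, of n] B[of n] by (auto simp: abs_le_iff)
  obtain K where K: "0 \<le> K" "\<And>v i j. \<forall>i\<in>SS. apply_on SS (Q 1) v i \<le> 2 * rmax + B \<Longrightarrow> i \<in> SS \<Longrightarrow> j \<in> SS \<Longrightarrow> \<bar>v i - v j\<bar> \<le> K"
    using span_bound[of "2 * rmax + B"] by auto
  have "apply_on SS (Q 1) (h n) i \<le> 2 * rmax + B" if i: "i \<in> SS" for n i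
    using subsidy_opt_eqD(3)[OF s i, of n] g[of n] R_le_rmax[OF i, of 1] by (auto simp: abs_le_iff)
  then have span: "\<bar>h n i - h n j\<bar> \<le> K" if "i \<in> SS" "j \<in> SS" for n i j
    using K(2)[of "h n" i j] that by blast
  have "\<exists>r g h'. strict_mono r \<and> subsidy_opt_eq d Q R \<nu>' g h' \<and>
    (\<forall>i\<in>SS. \<forall>a\<in>{0,1}. (\<lambda>n. qval d Q R (\<nu> (r n)) (h (r n)) a i) \<longlonglongrightarrow> qval d Q R \<nu>' h' a i)"
  proof (rule bellman_limit[where k = "\<lambda>n i. g n" and C = "max (rmax + B) K", OF assms])
    fix n i assume i: "i \<in> SS"
    show "g n = max (qval d Q R (\<nu> n) (h n) 0 i) (qval d Q R (\<nu> n) (h n) 1 i)"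
      by (rule subsidy_opt_eqD(1)[OF s i])
    show "\<bar>g n\<bar> \<le> max (rmax + B) K" using g[of n] by simp
    show "\<bar>h n i - h n 1\<bar> \<le> max (rmax + B) K" using span[of i 1 n] i d by simp
  qed auto
  then show ?thesis using s by blast
qed

text \<open>For \<nu> at most 0 the gain is at most \<open>rmax\<close>, so the active action, which
  carries no subsidy, bounds the span of \<open>h\<close> independently of \<nu>. Optimal passivity
  at \<open>i\<close> would give a gain of at most \<open>rmax + \<nu> + q * K\<close>, below the
  lower bound \<open>-rmax\<close>; the threshold makes the conflict strict by 1. This bounds the
  set defining a Whittle index from below.\<close>

lemma passive_set_empty: "\<exists>A. \<forall>\<nu>\<le>A. passive_set d Q R \<nu> = {}"
proof -
  obtain K where K: "0 \<le> K" "\<And>v i j. \<forall>i\<in>SS. apply_on SS (Q 1) v i \<le> 2 * rmax \<Longrightarrow> i \<in> SS \<Longrightarrow> j \<in> SS \<Longrightarrow> \<bar>v i - v j\<bar> \<le> K"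
    using span_bound[of "2 * rmax"] by auto
  define q where "q = (\<Sum>i\<in>SS. \<Sum>j\<in>SS. \<bar>Q 0 i j\<bar>)"
  show ?thesis
  proof (intro exI[of _ "- (2 * rmax + q * K + 1)"] allI impI, rule ccontr)
    fix \<nu> assume \<nu>: "\<nu> \<le> - (2 * rmax + q * K + 1)" and ne: "passive_set d Q R \<nu> \<noteq> {}"
    have q0: "0 \<le> q" unfolding q_def by (intro sum_nonneg) auto
    have r0: "0 \<le> rmax" unfolding rmax_def by (intro sum_nonneg) auto
    have neg: "\<nu> \<le> 0" using \<nu> mult_nonneg_nonneg[OF q0 K(1)] r0 by linarith
    obtain i where "i \<in> passive_set d Q R \<nu>" using ne by blast
    then obtain g h where s: "subsidy_opt_eq d Q R \<nu> g h" and le: "qval d Q R \<nu> h 1 i \<le> qval d Q R \<nu> h 0 i" and i: "i \<in> SS"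
      by (auto simp: passive_set_def)
    have "\<forall>i\<in>SS. apply_on SS (Q 1) h i \<le> 2 * rmax"
      using subsidy_opt_eqD(3)[OF s] gain_bounds(3)[OF s] neg R_le_rmax[of _ 1] by (force simp: abs_le_iff)
    note span = K(2)[OF this _ i]
    have "apply_on SS (Q 0) h i = apply_on SS (Q 0) (\<lambda>j. h j - h i) i"
      using apply_on_shift[OF gen i] by simp
    also have "\<dots> \<le> (\<Sum>j\<in>SS. \<bar>Q 0 i j\<bar> * K)"
      unfolding apply_on_def
    proof (intro sum_mono)
      fix j assume "j \<in> SS"
      then show "Q 0 i j * (h j - h i) \<le> \<bar>Q 0 i j\<bar> * K"
        using span[of j] by (metis abs_ge_self abs_ge_zero abs_mult mult_left_mono order_trans)
    qed
    also have "\<dots> = (\<Sum>j\<in>SS. \<bar>Q 0 i j\<bar>) * K" by (simp add: sum_distrib_right)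
    also have "\<dots> \<le> q * K" unfolding q_def using i K(1)
      by (intro mult_right_mono member_le_sum[where f = "\<lambda>i. \<Sum>j\<in>SS. \<bar>Q 0 i j\<bar>"]) (auto intro: sum_nonneg)
    finally have "apply_on SS (Q 0) h i \<le> q * K" .
    moreover have "g = R 0 i + \<nu> + apply_on SS (Q 0) h i"
      using subsidy_opt_eqD(1)[OF s i] le by (simp add: qval_eq max_def)
    moreover note gain_bounds(1)[OF s] R_le_rmax[OF i, of 0]
    ultimately show False using \<nu> by (simp add: abs_le_iff)
  qed
qed

text \<open>For a large subsidy the passive action supplies the span bound: \<nu> occurs in its
  value and in the upper bound for the gain, and cancels. If activity were strictly better in some
  state, the gain would be at most \<open>rmax + q * K\<close>, which is less than
  \<open>\<nu> - rmax\<close>. This makes the sets defining the indices nonempty.\<close>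

lemma passive_set_full: "\<exists>A. passive_set d Q R A = SS"
proof -
  obtain K where K: "0 \<le> K" "\<And>v i j. \<forall>i\<in>SS. apply_on SS (Q 0) v i \<le> 2 * rmax \<Longrightarrow> i \<in> SS \<Longrightarrow> j \<in> SS \<Longrightarrow> \<bar>v i - v j\<bar> \<le> K"
    using span_bound[of "2 * rmax"] by auto
  define q where "q = (\<Sum>i\<in>SS. \<Sum>j\<in>SS. \<bar>Q 1 i j\<bar>)"
  define \<nu> where "\<nu> = 2 * rmax + q * K + 1"
  have q0: "0 \<le> q" unfolding q_def by (intro sum_nonneg) auto
  have r0: "0 \<le> rmax" unfolding rmax_def by (intro sum_nonneg) auto
  have pos: "0 \<le> \<nu>" using mult_nonneg_nonneg[OF q0 K(1)] r0 unfolding \<nu>_def by linarith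
  obtain g h where s: "subsidy_opt_eq d Q R \<nu> g h" using bellman_exists by blast
  have a: "\<forall>i\<in>SS. apply_on SS (Q 0) h i \<le> 2 * rmax"
    using subsidy_opt_eqD(2)[OF s] gain_bounds(3)[OF s] pos R_le_rmax[of _ 0] by (force simp: abs_le_iff)
  have "qval d Q R \<nu> h 1 i \<le> qval d Q R \<nu> h 0 i" if i: "i \<in> SS" for i
  proof (rule ccontr)
    assume ne: "\<not> ?thesis"
    note span = K(2)[OF a _ i]
    have "apply_on SS (Q 1) h i = apply_on SS (Q 1) (\<lambda>j. h j - h i) i"
      using apply_on_shift[OF gen i] by simp
    also have "\<dots> \<le> (\<Sum>j\<in>SS. \<bar>Q 1 i j\<bar> * K)"
      unfolding apply_on_def
    proof (intro sum_mono)
      fix j assume "j \<in> SS"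
      then show "Q 1 i j * (h j - h i) \<le> \<bar>Q 1 i j\<bar> * K"
        using span[of j] by (metis abs_ge_self abs_ge_zero abs_mult mult_left_mono order_trans)
    qed
    also have "\<dots> = (\<Sum>j\<in>SS. \<bar>Q 1 i j\<bar>) * K" by (simp add: sum_distrib_right)
    also have "\<dots> \<le> q * K" unfolding q_def using i K(1)
      by (intro mult_right_mono member_le_sum[where f = "\<lambda>i. \<Sum>j\<in>SS. \<bar>Q 1 i j\<bar>"]) (auto intro: sum_nonneg)
    finally have "apply_on SS (Q 1) h i \<le> q * K" .
    moreover have "g = R 1 i + apply_on SS (Q 1) h i"
      using subsidy_opt_eqD(1)[OF s i] ne by (simp add: qval_eq max_def)
    moreover note gain_bounds(2)[OF s] R_le_rmax[OF i, of 1]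
    ultimately show False by (simp add: abs_le_iff \<nu>_def)
  qed
  then have "passive_set d Q R \<nu> = SS" using passive_set_iff[OF s] by (auto simp: passive_set_def)
  then show ?thesis by blast
qed

lemma passive_set_limit:
  assumes "\<nu> \<longlonglongrightarrow> \<nu>'" "\<And>n. i \<in> passive_set d Q R (\<nu> n)"
  shows "i \<in> passive_set d Q R \<nu>'"
proof -
  have i: "i \<in> SS" using assms(2)[of 0] by (simp add: passive_set_def)
  obtain r g h' h g' where s: "subsidy_opt_eq d Q R \<nu>' g h'" "\<And>n. subsidy_opt_eq d Q R (\<nu> n) (g' n) (h n)"
    and lim: "\<forall>i\<in>SS. \<forall>a\<in>{0,1}. (\<lambda>n. qval d Q R (\<nu> (r n)) (h (r n)) a i) \<longlonglongrightarrow> qval d Q R \<nu>' h' a i"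
    using bellman_seq_limit[OF assms(1)] by blast
  have "qval d Q R \<nu>' h' 1 i \<le> qval d Q R \<nu>' h' 0 i"
  proof (rule LIMSEQ_le)
    show "(\<lambda>n. qval d Q R (\<nu> (r n)) (h (r n)) 1 i) \<longlonglongrightarrow> qval d Q R \<nu>' h' 1 i"
      "(\<lambda>n. qval d Q R (\<nu> (r n)) (h (r n)) 0 i) \<longlonglongrightarrow> qval d Q R \<nu>' h' 0 i" using lim i by auto
    show "\<exists>N. \<forall>n\<ge>N. qval d Q R (\<nu> (r n)) (h (r n)) 1 i \<le> qval d Q R (\<nu> (r n)) (h (r n)) 0 i"
      using passive_set_iff[OF s(2) i] assms(2) by auto
  qed
  then show ?thesis using passive_set_iff[OF s(1) i] by simp
qed

text \<open>Failure of passivity is a strict inequality and does not survive a limit; weak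
  optimality of activity does, and this is what is needed at the index itself.\<close>

lemma active_limit:
  assumes "\<nu> \<longlonglongrightarrow> \<nu>'" "\<And>n. i \<notin> passive_set d Q R (\<nu> n)" and i: "i \<in> SS"
  shows "\<exists>g h. subsidy_opt_eq d Q R \<nu>' g h \<and> qval d Q R \<nu>' h 0 i \<le> qval d Q R \<nu>' h 1 i"
proof -
  obtain r g h' h g' where s: "subsidy_opt_eq d Q R \<nu>' g h'" "\<And>n. subsidy_opt_eq d Q R (\<nu> n) (g' n) (h n)"
    and lim: "\<forall>i\<in>SS. \<forall>a\<in>{0,1}. (\<lambda>n. qval d Q R (\<nu> (r n)) (h (r n)) a i) \<longlonglongrightarrow> qval d Q R \<nu>' h' a i"
    using bellman_seq_limit[OF assms(1)] by blast
  have "qval d Q R \<nu>' h' 0 i \<le> qval d Q R \<nu>' h' 1 i"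
  proof (rule LIMSEQ_le)
    show "(\<lambda>n. qval d Q R (\<nu> (r n)) (h (r n)) 1 i) \<longlonglongrightarrow> qval d Q R \<nu>' h' 1 i"
      "(\<lambda>n. qval d Q R (\<nu> (r n)) (h (r n)) 0 i) \<longlonglongrightarrow> qval d Q R \<nu>' h' 0 i" using lim i by auto
    show "\<exists>N. \<forall>n\<ge>N. qval d Q R (\<nu> (r n)) (h (r n)) 0 i \<le> qval d Q R (\<nu> (r n)) (h (r n)) 1 i"
      using passive_set_iff[OF s(2) i] assms(2) by (metis linorder_linear)
  qed
  then show ?thesis using s(1) by blast
qed

text \<open>Take \<nu> equal to the index of \<open>s\<close>. Subsidies decreasing to it show that
  passivity is optimal in \<open>s\<close>, subsidies increasing to it that activity is, and
  uniqueness puts both into one solution. For a state labelled before (after) \<open>s\<close> the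
  subsidy lies strictly below (above) its index, so activity (passivity) is optimal there.\<close>

lemma bellman_at_index:
  assumes idx: "indexable d Q R" and lab: "index_decreasing_labels d Q R" and s: "s \<in> SS"
  shows "\<exists>\<nu> g h. \<forall>i\<in>SS. qval d Q R \<nu> h 0 i \<le> g \<and> qval d Q R \<nu> h 1 i \<le> g \<and>
      (i \<le> s \<longrightarrow> qval d Q R \<nu> h 1 i = g) \<and> (s \<le> i \<longrightarrow> qval d Q R \<nu> h 0 i = g)"
proof -
  let ?W = "whittle_index d Q R" let ?P = "passive_set d Q R"
  obtain A where A: "\<And>\<nu>. \<nu> \<le> A \<Longrightarrow> ?P \<nu> = {}" using passive_set_empty by blast
  obtain B where B: "?P B = SS" using passive_set_full by blast
  \<comment> \<open>An infimum of reals is informative only for a nonempty set that is bounded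
    below; the two extreme-subsidy lemmas provide this.\<close>
  have bdd: "bdd_below {\<nu>. i \<in> ?P \<nu>}" for i
  proof (rule bdd_belowI[of _ A], rule ccontr)
    fix \<nu> assume "\<nu> \<in> {\<nu>. i \<in> ?P \<nu>}" "\<not> A \<le> \<nu>"
    then show False using A[of \<nu>] by auto
  qed
  have above: "i \<in> ?P \<nu>" if "?W i < \<nu>" "i \<in> SS" for i \<nu>
  proof -
    have "{\<nu>. i \<in> ?P \<nu>} \<noteq> {}" using B that(2) by blast
    then have "\<exists>\<nu>'\<in>{\<nu>. i \<in> ?P \<nu>}. \<nu>' < \<nu>"
      using that(1) cInf_less_iff[OF _ bdd] unfolding whittle_index_def by blast
    then obtain \<nu>' where "i \<in> ?P \<nu>'" "\<nu>' < \<nu>" by blast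
    then show ?thesis using idx unfolding indexable_def by (meson less_imp_le subsetD)
  qed
  have below: "i \<notin> ?P \<nu>" if "\<nu> < ?W i" for i \<nu>
    using that cInf_lower[OF _ bdd, of \<nu> i] unfolding whittle_index_def by auto
  let ?\<nu> = "?W s"
  have lim: "(\<lambda>n. ?\<nu> + inverse (real (Suc n))) \<longlonglongrightarrow> ?\<nu>"
    by (rule LIMSEQ_inverse_real_of_nat_add)
  have lim': "(\<lambda>n. ?\<nu> + - inverse (real (Suc n))) \<longlonglongrightarrow> ?\<nu>"
    by (rule LIMSEQ_inverse_real_of_nat_add_minus)
  have sp: "s \<in> ?P ?\<nu>"
    by (rule passive_set_limit[OF lim]) (rule above[OF _ s], simp)
  obtain g h where o: "subsidy_opt_eq d Q R ?\<nu> g h" and act: "qval d Q R ?\<nu> h 0 s \<le> qval d Q R ?\<nu> h 1 s"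
    using active_limit[OF lim' _ s] below[of _ s] by force
  have "(i \<le> s \<longrightarrow> qval d Q R ?\<nu> h 1 i = g) \<and> (s \<le> i \<longrightarrow> qval d Q R ?\<nu> h 0 i = g)" if i: "i \<in> SS" for i
  proof -
    note g = subsidy_opt_eqD(1)[OF o i]
    have 1: "qval d Q R ?\<nu> h 1 i = g" if "i < s"
    proof -
      have "?\<nu> < ?W i" using lab that i s unfolding index_decreasing_labels_def by blast
      then have "i \<notin> ?P ?\<nu>" by (rule below)
      then show ?thesis using passive_set_iff[OF o i] g by (simp add: max_def)
    qed
    have 2: "qval d Q R ?\<nu> h 0 i = g" if "s < i"
    proof -
      have "?W i < ?\<nu>" using lab that i s unfolding index_decreasing_labels_def by blast
      then have "i \<in> ?P ?\<nu>" using above i by blast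
      then show ?thesis using passive_set_iff[OF o i] g by (simp add: max_def)
    qed
    have 3: "qval d Q R ?\<nu> h 1 i = g" "qval d Q R ?\<nu> h 0 i = g" if "i = s"
      using passive_set_iff[OF o s] sp act g that by (auto simp: max_def)
    show ?thesis using 1 2 3 by (metis linorder_neqE_nat not_le)
  qed
  moreover have "qval d Q R ?\<nu> h 0 i \<le> g \<and> qval d Q R ?\<nu> h 1 i \<le> g" if "i \<in> SS" for i
    using subsidy_opt_eqD(1)[OF o that] by simp
  ultimately show ?thesis by blast
qed

end

section \<open>The mean-field drift\<close>

definition cum :: "(nat \<Rightarrow> real) \<Rightarrow> nat \<Rightarrow> real" where
  "cum m i = (\<Sum>j\<in>{1..i}. m j)"

text \<open>Mass of active bandits in state \<open>i\<close>: all of \<open>m i\<close> for \<open>i < s(m)\<close>, the rest of \<open>\<alpha>\<close> for \<open>i = s(m)\<close>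
  and \<open>0\<close> beyond. Unlike \<open>s(m)\<close> this is visibly Lipschitz in \<open>m\<close>.\<close>

definition active_mass :: "real \<Rightarrow> (nat \<Rightarrow> real) \<Rightarrow> nat \<Rightarrow> real" where
  "active_mass \<alpha> m i = min \<alpha> (cum m i) - min \<alpha> (cum m (i - 1))"

lemma cum_step: "1 \<le> i \<Longrightarrow> cum m i = cum m (i - 1) + m i"
  by (cases i) (auto simp: cum_def)

lemma cum_mono:
  assumes "\<And>i. i \<in> {1..d} \<Longrightarrow> 0 \<le> m i" "i \<le> j" "j \<le> d"
  shows "cum m i \<le> cum m j"
  unfolding cum_def using assms by (intro sum_mono2) auto

lemma active_mass_bounds:
  assumes "\<And>i. i \<in> {1..d} \<Longrightarrow> 0 \<le> m i" "i \<in> {1..d}"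
  shows "0 \<le> active_mass \<alpha> m i" "active_mass \<alpha> m i \<le> m i"
  using cum_step[of i m] assms(1)[OF assms(2)] assms(2) by (auto simp: active_mass_def min_def)

lemma simplexD:
  assumes "m \<in> prob_simplex d"
  shows "\<And>i. i \<in> {1..d} \<Longrightarrow> 0 \<le> m i" "\<And>i. i \<in> {1..d} \<Longrightarrow> m i \<le> 1" "(\<Sum>i\<in>{1..d}. m i) = 1"
  using assms by (auto simp: prob_simplex_def)

lemma simplexI:
  assumes "\<And>i. i \<in> {1..d} \<Longrightarrow> 0 \<le> m i" "(\<Sum>i\<in>{1..d}. m i) = 1"
  shows "m \<in> prob_simplex d"
proof -
  have "m i \<le> 1" if "i \<in> {1..d}" for i
    unfolding assms(2)[symmetric] using that assms(1) by (intro member_le_sum) auto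
  then show ?thesis using assms by (auto simp: prob_simplex_def)
qed

lemma cum_less: "(\<Sum>i\<in>{1..<s}. m i) = cum m (s - 1)"
  unfolding cum_def by (cases s) (auto simp: atLeastLessThanSuc_atLeastAtMost)

lemma s_of_exists:
  assumes m: "m \<in> prob_simplex d" and \<alpha>: "0 < \<alpha>" "\<alpha> < 1"
  shows "\<exists>s\<in>{1..d}. cum m (s - 1) \<le> \<alpha> \<and> \<alpha> < cum m s"
proof -
  have d1: "\<alpha> < cum m d" using simplexD(3)[OF m] \<alpha> by (simp add: cum_def)
  define s where "s = (LEAST s. \<alpha> < cum m s)"
  have s: "\<alpha> < cum m s" unfolding s_def by (rule LeastI[of "\<lambda>s. \<alpha> < cum m s", OF d1])
  have "s \<le> d" unfolding s_def by (rule Least_le[of "\<lambda>s. \<alpha> < cum m s", OF d1])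
  moreover have "s \<noteq> 0"
  proof
    assume "s = 0"
    then show False using s \<alpha> by (simp add: cum_def)
  qed
  moreover have "\<not> \<alpha> < cum m (s - 1)"
    using not_less_Least[of "s - 1" "\<lambda>s. \<alpha> < cum m s"] \<open>s \<noteq> 0\<close> unfolding s_def[symmetric] by simp
  ultimately show ?thesis using s by (intro bexI[of _ s]) auto
qed

lemma s_of_eqI:
  assumes m: "m \<in> prob_simplex d" and s: "s \<in> {1..d}" "cum m (s - 1) \<le> \<alpha>" "\<alpha> < cum m s"
  shows "s_of d \<alpha> m = s"
proof -
  have *: False if "t \<in> {1..d}" "cum m (t - 1) \<le> \<alpha>" "\<alpha> < cum m t" "t' \<in> {1..d}" "cum m (t' - 1) \<le> \<alpha>" "\<alpha> < cum m t'" "t < t'" for t t'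
  proof -
    have "t \<le> t' - 1" "t' - 1 \<le> d" using that by auto
    from cum_mono[of d m, OF simplexD(1)[OF m] this] show False using that by simp
  qed
  show ?thesis
    unfolding s_of_def cum_less cum_def[symmetric]
  proof (rule the_equality)
    fix t assume t: "t \<in> {1..d} \<and> cum m (t - 1) \<le> \<alpha> \<and> \<alpha> < cum m t"
    show "t = s"
      using *[of t s] *[of s t] t s by (metis linorder_neqE_nat)
  qed (use s in auto)
qed

lemma phi_eq_active_mass:
  assumes m: "m \<in> prob_simplex d" and \<alpha>: "0 < \<alpha>" "\<alpha> < 1"
  shows "phi d Q \<alpha> m j = (\<Sum>i\<in>{1..d}. active_mass \<alpha> m i * Punif d Q 1 i j + (m i - active_mass \<alpha> m i) * Punif d Q 0 i j)"
proof -
  obtain s where s: "s \<in> {1..d}" "cum m (s - 1) \<le> \<alpha>" "\<alpha> < cum m s" using s_of_exists[OF assms] by blast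
  note so = s_of_eqI[OF m s]
  note mono = cum_mono[of d m, OF simplexD(1)[OF m]]
  have lo: "active_mass \<alpha> m i = m i" if "i \<in> {1..<s}" for i
  proof -
    have "i \<le> s - 1" "i - 1 \<le> s - 1" "s - 1 \<le> d" using that s by auto
    then have "cum m i \<le> \<alpha>" "cum m (i - 1) \<le> \<alpha>"
      using mono[of i "s - 1"] mono[of "i - 1" "s - 1"] s by auto
    then show ?thesis using that cum_step[of i m] by (simp add: active_mass_def)
  qed
  have mid: "active_mass \<alpha> m s = \<alpha> - cum m (s - 1)"
    using s by (simp add: active_mass_def)
  have hi: "active_mass \<alpha> m i = 0" if "i \<in> {s<..d}" for i
  proof -
    have "s \<le> i" "s \<le> i - 1" "i \<le> d" "i - 1 \<le> d" using that by auto
    then have "\<alpha> \<le> cum m i" "\<alpha> \<le> cum m (i - 1)" using mono[of s i] mono[of s "i - 1"] s by auto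
    then show ?thesis by (simp add: active_mass_def)
  qed
  have ds: "{1..d} = {1..<s} \<union> insert s {s<..d}" using s by auto
  let ?f = "\<lambda>i. active_mass \<alpha> m i * Punif d Q 1 i j + (m i - active_mass \<alpha> m i) * Punif d Q 0 i j"
  have "(\<Sum>i\<in>{1..d}. ?f i) = (\<Sum>i\<in>{1..<s}. ?f i) + (?f s + (\<Sum>i\<in>{s<..d}. ?f i))"
    unfolding ds by (subst sum.union_disjoint) auto
  also have "(\<Sum>i\<in>{1..<s}. ?f i) = (\<Sum>i\<in>{1..<s}. m i * Punif d Q 1 i j)"
    by (intro sum.cong) (simp_all add: lo)
  also have "(\<Sum>i\<in>{s<..d}. ?f i) = (\<Sum>i\<in>{s<..d}. m i * Punif d Q 0 i j)"
    by (intro sum.cong) (simp_all add: hi)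
  also have "?f s = (\<alpha> - cum m (s - 1)) * Punif d Q 1 s j + (cum m s - \<alpha>) * Punif d Q 0 s j"
    using cum_step[of s m] s by (simp add: mid algebra_simps)
  finally show ?thesis unfolding phi_def Let_def so cum_less cum_def[symmetric] by simp
qed

locale mean_field = bandit +
  fixes \<alpha> :: real
  assumes \<alpha>: "0 < \<alpha>" "\<alpha> < 1"
begin

text \<open>The vector field of the ODE with the uniformization undone: it is written with the rates
  themselves, avoids \<open>s_of\<close>, and is defined for every \<open>m\<close>. In this form it
  also describes the mean motion of the finite system.\<close>

definition drift :: "(nat \<Rightarrow> real) \<Rightarrow> nat \<Rightarrow> real" where
  "drift m j = (\<Sum>i\<in>SS. active_mass \<alpha> m i * Q 1 i j + (m i - active_mass \<alpha> m i) * Q 0 i j)"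

text \<open>Bounds all entries and absolute row sums of both generators. The summand 1 keeps it
  positive when all rates vanish, as for \<open>d = 1\<close>.\<close>

definition rate :: real where "rate = (\<Sum>i\<in>SS. \<Sum>j\<in>SS. \<bar>Q 0 i j\<bar> + \<bar>Q 1 i j\<bar>) + 1"

text \<open>There are \<open>d\<close> source states; the active mass in each is
  \<open>2 * d\<close>-Lipschitz as a difference of two cumulative sums, hence the passive mass is
  \<open>(2 * d + 1)\<close>-Lipschitz.\<close>

definition lip :: real where "lip = real d * (4 * real d + 1) * rate"

lemma rate_pos: "0 < rate"
  unfolding rate_def by (intro add_nonneg_pos sum_nonneg) auto

lemma lip_nonneg: "0 \<le> lip"
  unfolding lip_def using rate_pos by simp

lemma row_le_rate: "i \<in> SS \<Longrightarrow> a \<in> {0,1} \<Longrightarrow> (\<Sum>j\<in>SS. \<bar>Q a i j\<bar>) \<le> rate"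
proof -
  assume i: "i \<in> SS" and a: "a \<in> {0,1}"
  have "(\<Sum>j\<in>SS. \<bar>Q a i j\<bar>) \<le> (\<Sum>j\<in>SS. \<bar>Q 0 i j\<bar> + \<bar>Q 1 i j\<bar>)"
    using a by (intro sum_mono) auto
  also have "\<dots> \<le> (\<Sum>i\<in>SS. \<Sum>j\<in>SS. \<bar>Q 0 i j\<bar> + \<bar>Q 1 i j\<bar>)"
    using i by (intro member_le_sum[where f = "\<lambda>i. \<Sum>j\<in>SS. \<bar>Q 0 i j\<bar> + \<bar>Q 1 i j\<bar>"]) (auto intro: sum_nonneg)
  finally show ?thesis unfolding rate_def by simp
qed

lemma Q_le_rate: "i \<in> SS \<Longrightarrow> j \<in> SS \<Longrightarrow> a \<in> {0,1} \<Longrightarrow> \<bar>Q a i j\<bar> \<le> rate"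
  using row_le_rate[of i a] member_le_sum[of j SS "\<lambda>j. \<bar>Q a i j\<bar>"] by force

text \<open>Multiplying by \<open>tau\<close> undoes the normalization. The case
  \<open>tau d Q = 0\<close>, where \<open>Punif\<close> divides by zero, survives because then all
  rates vanish.\<close>

lemma tau_Punif:
  assumes i: "i \<in> SS" and j: "j \<in> SS" and a: "a \<in> {0, 1}"
  shows "tau d Q * Punif d Q a i j = Q a i j + (if i = j then tau d Q else 0)"
proof -
  note G = gen[OF a]
  have exit: "(\<Sum>k\<in>SS - {i}. Q a i k) = - Q a i i"
    using generator_onD(3)[OF G i] sum.remove[OF _ i, of "Q a i"] by simp
  have set: "{\<bar>Q a i i\<bar> | a i. a \<in> {0,1} \<and> i \<in> SS} = (\<lambda>(a, i). \<bar>Q a i i\<bar>) ` ({0,1} \<times> SS)"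
    by (rule set_eqI) (simp only: image_iff Bex_def mem_Collect_eq split_paired_Ex mem_Times_iff fst_conv snd_conv prod.case, blast)
  have "\<bar>Q a i i\<bar> \<le> tau d Q" unfolding tau_def set
  proof (rule Max_ge)
    show "\<bar>Q a i i\<bar> \<in> (\<lambda>(a, i). \<bar>Q a i i\<bar>) ` ({0,1} \<times> SS)" using a i by force
  qed simp
  then have 0: "Q a i k = 0" if "tau d Q = 0" "k \<in> SS" for k
  proof -
    have "Q a i i = 0" using \<open>\<bar>Q a i i\<bar> \<le> tau d Q\<close> that by simp
    moreover have "\<forall>k\<in>SS - {i}. Q a i k = 0"
      using exit calculation generator_onD(2)[OF G i] by (subst sum_nonneg_eq_0_iff[symmetric]) auto
    ultimately show ?thesis using that by (cases "k = i") auto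
  qed
  show ?thesis
  proof (cases "tau d Q = 0")
    case True then show ?thesis using 0 j by simp
  next
    case False
    have "(\<Sum>k\<in>SS - {i}. Q a i k / tau d Q) = - Q a i i / tau d Q"
      unfolding sum_divide_distrib[symmetric] exit ..
    then show ?thesis using False by (cases "i = j") (auto simp: Punif_def field_simps)
  qed
qed

lemma phi_drift:
  assumes m: "m \<in> prob_simplex d" and j: "j \<in> SS"
  shows "tau d Q * (phi d Q \<alpha> m j - m j) = drift m j"
proof -
  let ?a = "active_mass \<alpha> m"
  have "tau d Q * phi d Q \<alpha> m j = (\<Sum>i\<in>SS. ?a i * (tau d Q * Punif d Q 1 i j) + (m i - ?a i) * (tau d Q * Punif d Q 0 i j))"
    unfolding phi_eq_active_mass[OF m \<alpha>] by (simp add: sum_distrib_left algebra_simps)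
  also have "\<dots> = (\<Sum>i\<in>SS. (?a i * Q 1 i j + (m i - ?a i) * Q 0 i j) + (if i = j then tau d Q * m i else 0))"
    using j by (intro sum.cong refl) (simp add: tau_Punif algebra_simps)
  also have "\<dots> = drift m j + tau d Q * m j"
    using j by (simp add: sum.distrib drift_def)
  finally show ?thesis by (simp add: algebra_simps)
qed

lemma cum_lipschitz:
  assumes "\<And>i. i \<in> SS \<Longrightarrow> \<bar>m i - m' i\<bar> \<le> e" "k \<le> d" "0 \<le> e"
  shows "\<bar>cum m k - cum m' k\<bar> \<le> real d * e"
proof -
  have "\<bar>cum m k - cum m' k\<bar> \<le> (\<Sum>i\<in>{1..k}. \<bar>m i - m' i\<bar>)"
    unfolding cum_def sum_subtractf[symmetric] by (rule sum_abs)
  also have "\<dots> \<le> (\<Sum>i\<in>{1..k}. e)" using assms by (intro sum_mono) auto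
  also have "\<dots> = real k * e" by simp
  also have "\<dots> \<le> real d * e" using assms by (intro mult_right_mono) auto
  finally show ?thesis .
qed

lemma drift_lipschitz:
  assumes e: "\<And>i. i \<in> SS \<Longrightarrow> \<bar>m i - m' i\<bar> \<le> e" and j: "j \<in> SS"
  shows "\<bar>drift m j - drift m' j\<bar> \<le> lip * e"
proof -
  have e0: "0 \<le> e" using e[OF j] by linarith
  let ?a = "active_mass \<alpha> m" let ?b = "active_mass \<alpha> m'"
  have ab: "\<bar>?a i - ?b i\<bar> \<le> 2 * real d * e" if i: "i \<in> SS" for i
  proof -
    have "i \<le> d" "i - 1 \<le> d" using i by auto
    then have "\<bar>cum m i - cum m' i\<bar> \<le> real d * e" "\<bar>cum m (i - 1) - cum m' (i - 1)\<bar> \<le> real d * e"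
      by (auto intro!: cum_lipschitz[OF e _ e0])
    then show ?thesis using mult_nonneg_nonneg[of "real d" e] e0
      by (auto simp: active_mass_def min_def abs_le_iff)
  qed
  have term_le: "\<bar>(?a i - ?b i) * Q 1 i j + ((m i - m' i) - (?a i - ?b i)) * Q 0 i j\<bar> \<le> (4 * real d + 1) * e * rate"
    if i: "i \<in> SS" for i
  proof -
    have "\<bar>(?a i - ?b i) * Q 1 i j + ((m i - m' i) - (?a i - ?b i)) * Q 0 i j\<bar>
      \<le> \<bar>?a i - ?b i\<bar> * \<bar>Q 1 i j\<bar> + \<bar>(m i - m' i) - (?a i - ?b i)\<bar> * \<bar>Q 0 i j\<bar>"
      unfolding abs_mult[symmetric] by (rule abs_triangle_ineq)
    also have "\<dots> \<le> (2 * real d * e) * rate + (2 * real d * e + e) * rate"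
      using ab[OF i] e[OF i] Q_le_rate[OF i j] e0 by (intro add_mono mult_mono) auto
    finally show ?thesis by (simp add: algebra_simps)
  qed
  have "drift m j - drift m' j = (\<Sum>i\<in>SS. (?a i - ?b i) * Q 1 i j + ((m i - m' i) - (?a i - ?b i)) * Q 0 i j)"
    unfolding drift_def sum_subtractf[symmetric] by (intro sum.cong refl) (simp add: algebra_simps)
  also have "\<bar>\<dots>\<bar> \<le> (\<Sum>i\<in>SS. (4 * real d + 1) * e * rate)"
    by (rule order_trans[OF sum_abs]) (intro sum_mono term_le)
  also have "\<dots> = lip * e" by (simp add: lip_def algebra_simps)
  finally show ?thesis .
qed

lemma drift_sum: "(\<Sum>j\<in>SS. drift m j) = 0"
proof -
  have "(\<Sum>j\<in>SS. drift m j) = (\<Sum>i\<in>SS. \<Sum>j\<in>SS. active_mass \<alpha> m i * Q 1 i j + (m i - active_mass \<alpha> m i) * Q 0 i j)"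
    unfolding drift_def by (rule sum.swap)
  also have "\<dots> = (\<Sum>i\<in>SS. active_mass \<alpha> m i * (\<Sum>j\<in>SS. Q 1 i j) + (m i - active_mass \<alpha> m i) * (\<Sum>j\<in>SS. Q 0 i j))"
    by (simp add: sum.distrib sum_distrib_left)
  also have "\<dots> = 0" using generator_onD(3)[OF gen] by (intro sum.neutral) auto
  finally show ?thesis .
qed

text \<open>An Euler step of length \<open>1 / rate\<close> is one step of a uniformized chain:
  adding \<open>rate\<close> to the diagonal makes the rate matrices nonnegative, and the drift
  conserves mass.\<close>

lemma drift_step_simplex:
  assumes m: "m \<in> prob_simplex d"
  shows "(\<lambda>i. m i + drift m i / rate) \<in> prob_simplex d"
proof (rule simplexI)
  show "(\<Sum>i\<in>SS. m i + drift m i / rate) = 1"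
    using simplexD(3)[OF m] drift_sum[of m] by (simp add: sum.distrib sum_divide_distrib[symmetric])
  fix j assume j: "j \<in> SS"
  let ?a = "active_mass \<alpha> m"
  have nn: "0 \<le> (if i = j then rate else 0) + Q a i j" if "i \<in> SS" "a \<in> {0,1}" for i a
    using generator_onD(2)[OF gen[OF that(2)] that(1) j] Q_le_rate[OF that(1) j that(2)] by (auto simp: abs_le_iff)
  have "0 \<le> (\<Sum>i\<in>SS. ?a i * ((if i = j then rate else 0) + Q 1 i j) + (m i - ?a i) * ((if i = j then rate else 0) + Q 0 i j))"
  proof (rule sum_nonneg)
    fix i assume i: "i \<in> SS"
    have "0 \<le> ?a i" "0 \<le> m i - ?a i" using active_mass_bounds[of d m i, OF simplexD(1)[OF m] i] by auto
    then show "0 \<le> ?a i * ((if i = j then rate else 0) + Q 1 i j) + (m i - ?a i) * ((if i = j then rate else 0) + Q 0 i j)"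
      using nn[OF i, of 0] nn[OF i, of 1] by (simp only: mult_nonneg_nonneg add_nonneg_nonneg insert_iff simp_thms)
  qed
  also have "\<dots> = (\<Sum>i\<in>SS. (if i = j then rate * m i else 0) + (?a i * Q 1 i j + (m i - ?a i) * Q 0 i j))"
    by (intro sum.cong refl) (simp add: algebra_simps)
  also have "\<dots> = rate * m j + drift m j" using j by (simp add: sum.distrib drift_def)
  finally have "0 \<le> (rate * m j + drift m j) / rate" using rate_pos by simp
  then show "0 \<le> m j + drift m j / rate" using rate_pos by (simp add: field_simps)
qed

section \<open>Existence of trajectories\<close>

text \<open>Variation of constants for \<open>x' + rate * x = rate * x + drift x\<close>. The
  right-hand side is \<open>rate\<close> times a point of the simplex, so this form, unlike the
  plain integral equation, keeps iterates in the simplex for all times.\<close>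

definition picard :: "(nat \<Rightarrow> real) \<Rightarrow> (real \<Rightarrow> nat \<Rightarrow> real) \<Rightarrow> real \<Rightarrow> nat \<Rightarrow> real" where
  "picard m x t i = exp (- (rate * t)) * (m i + integral {0..t} (\<lambda>u. exp (rate * u) * (rate * x u i + drift (x u) i)))"

text \<open>The common Lipschitz constant makes integrands continuous, is reproduced by
  \<open>picard\<close>, and passes to pointwise limits.\<close>

definition admissible :: "(real \<Rightarrow> nat \<Rightarrow> real) \<Rightarrow> bool" where
  "admissible x \<longleftrightarrow> (\<forall>t\<ge>0. x t \<in> prob_simplex d) \<and>
     (\<forall>i\<in>SS. \<forall>s\<ge>0. \<forall>t\<ge>0. \<bar>x t i - x s i\<bar> \<le> rate * \<bar>t - s\<bar>)"

lemma admissible_lipschitz: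
  assumes "admissible x" "i \<in> SS" "0 \<le> s" "0 \<le> t"
  shows "\<bar>x t i - x s i\<bar> \<le> rate * \<bar>t - s\<bar>"
  using assms by (simp add: admissible_def)

lemma admissible_continuous:
  assumes "admissible x" "i \<in> SS"
  shows "continuous_on {0..} (\<lambda>t. x t i)"
proof (rule continuous_onI)
  fix t e :: real assume t: "t \<in> {0..}" and e: "0 < e"
  show "\<exists>d>0. \<forall>s\<in>{0..}. dist s t < d \<longrightarrow> dist (x s i) (x t i) \<le> e"
  proof (intro exI[of _ "e / rate"] conjI ballI impI)
    show "0 < e / rate" using e rate_pos by simp
    fix s assume s: "s \<in> {0..}" "dist s t < e / rate"
    have "\<bar>x s i - x t i\<bar> \<le> rate * \<bar>s - t\<bar>" using assms s t by (auto simp: admissible_def)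
    also have "\<dots> \<le> e" using s(2) rate_pos by (simp add: dist_real_def field_simps)
    finally show "dist (x s i) (x t i) \<le> e" by (simp add: dist_real_def)
  qed
qed

lemma drift_continuous:
  assumes "admissible x"
  shows "continuous_on {0..} (\<lambda>t. drift (x t) i)"
proof -
  have "continuous_on {0..} (\<lambda>t. cum (x t) k)" if "k \<le> d" for k
    unfolding cum_def using that by (intro continuous_intros admissible_continuous[OF assms]) auto
  then show ?thesis
    unfolding drift_def active_mass_def
    by (intro continuous_intros admissible_continuous[OF assms]) auto
qed

lemma integrand_continuous:
  assumes "admissible x" "i \<in> SS"
  shows "continuous_on {0..t} (\<lambda>u. exp (rate * u) * (rate * x u i + drift (x u) i))"
proof (rule continuous_on_subset[of "{0..}"])
  show "continuous_on {0..} (\<lambda>u. exp (rate * u) * (rate * x u i + drift (x u) i))"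
    using admissible_continuous[OF assms] drift_continuous[OF assms(1), of i] by (intro continuous_intros)
qed auto

lemma picard_deriv:
  assumes x: "admissible x" and i: "i \<in> SS" and t: "0 \<le> t"
  shows "((\<lambda>t. picard m x t i) has_real_derivative (rate * x t i + drift (x t) i - rate * picard m x t i)) (at t within {0..})"
proof -
  let ?g = "\<lambda>u. exp (rate * u) * (rate * x u i + drift (x u) i)"
  have "((\<lambda>t. integral {0..t} ?g) has_real_derivative ?g t) (at t within {0..t + 1})"
    using t by (intro integral_has_real_derivative integrand_continuous[OF x i]) auto
  moreover have "at t within {0..t + 1} = at t within {0..}"
    by (rule at_within_nhd[of t "{..<t+1}"]) auto
  ultimately have d: "((\<lambda>t. integral {0..t} ?g) has_real_derivative ?g t) (at t within {0..})" by simp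
  have ee: "exp (- (rate * t)) * exp (rate * t) = 1" by (simp add: exp_add[symmetric])
  have "((\<lambda>t. exp (- (rate * t)) * (m i + integral {0..t} ?g)) has_real_derivative
      exp (- (rate * t)) * ?g t - rate * (exp (- (rate * t)) * (m i + integral {0..t} ?g))) (at t within {0..})"
    by (rule derivative_eq_intros d refl)+ (simp add: algebra_simps)
  moreover have "exp (- (rate * t)) * ?g t = rate * x t i + drift (x t) i"
    using ee by (simp add: mult.assoc[symmetric])
  ultimately show ?thesis unfolding picard_def by simp
qed

lemma integral_exp:
  fixes a t :: real
  assumes "0 < a" "0 \<le> t"
  shows "((\<lambda>u. a * exp (a * u)) has_integral (exp (a * t) - 1)) {0..t}"
proof -
  have "((\<lambda>u. a * exp (a * u)) has_integral (exp (a * t) - exp (a * 0))) {0..t}"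
    using assms by (intro fundamental_theorem_of_calculus[where f = "\<lambda>u. exp (a * u)"])
      (auto simp: has_real_derivative_iff_has_vector_derivative[symmetric] intro!: derivative_eq_intros)
  then show ?thesis by simp
qed

text \<open>The value at \<open>t\<close> is a convex combination: \<open>m\<close> has weight
  \<open>exp (- rate * t)\<close>, and the Euler points along \<open>x\<close> share the remaining
  mass with density \<open>rate * exp (- rate * (t - u))\<close>.\<close>

lemma picard_simplex:
  assumes x: "admissible x" and m: "m \<in> prob_simplex d" and t: "0 \<le> t"
  shows "picard m x t \<in> prob_simplex d"
proof (rule simplexI)
  let ?g = "\<lambda>i u. exp (rate * u) * (rate * x u i + drift (x u) i)"
  have int: "?g i integrable_on {0..t}" if "i \<in> SS" for i
    by (intro integrable_continuous_real integrand_continuous x that)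
  have step: "0 \<le> rate * x u i + drift (x u) i" if "u \<in> {0..t}" "i \<in> SS" for u i
  proof -
    have "0 \<le> x u i + drift (x u) i / rate"
      using simplexD(1)[OF drift_step_simplex, of "x u" i] x that by (auto simp: admissible_def)
    then show ?thesis using rate_pos by (simp add: field_simps)
  qed
  show "0 \<le> picard m x t i" if i: "i \<in> SS" for i
  proof -
    have "0 \<le> integral {0..t} (?g i)"
      by (rule integral_nonneg[OF int[OF i]]) (use step[OF _ i] in simp)
    then show ?thesis unfolding picard_def using simplexD(1)[OF m i] by simp
  qed
  have sum_g: "(\<Sum>i\<in>SS. ?g i u) = rate * exp (rate * u)" if "u \<in> {0..t}" for u
  proof -
    have "(\<Sum>i\<in>SS. ?g i u) = exp (rate * u) * (rate * (\<Sum>i\<in>SS. x u i) + (\<Sum>i\<in>SS. drift (x u) i))"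
      by (simp add: sum_distrib_left sum.distrib distrib_left)
    moreover have "(\<Sum>i\<in>SS. x u i) = 1" using x that by (intro simplexD(3)) (auto simp: admissible_def)
    ultimately show ?thesis unfolding drift_sum by simp
  qed
  have "(\<Sum>i\<in>SS. picard m x t i) = exp (- (rate * t)) * ((\<Sum>i\<in>SS. m i) + (\<Sum>i\<in>SS. integral {0..t} (?g i)))"
    by (simp add: picard_def sum_distrib_left[symmetric] sum.distrib)
  also have "(\<Sum>i\<in>SS. integral {0..t} (?g i)) = integral {0..t} (\<lambda>u. \<Sum>i\<in>SS. ?g i u)"
    using int by (intro integral_sum[symmetric]) auto
  also have "\<dots> = integral {0..t} (\<lambda>u. rate * exp (rate * u))"
    by (intro integral_cong sum_g)
  also have "\<dots> = exp (rate * t) - 1"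
    by (rule integral_unique[OF integral_exp[OF rate_pos t]])
  finally show "(\<Sum>i\<in>SS. picard m x t i) = 1"
    using simplexD(3)[OF m] by (simp add: exp_minus)
qed

lemma picard_admissible:
  assumes x: "admissible x" and m: "m \<in> prob_simplex d"
  shows "admissible (picard m x)"
  unfolding admissible_def
proof (intro conjI allI impI ballI)
  show "picard m x t \<in> prob_simplex d" if "0 \<le> t" for t by (rule picard_simplex[OF x m that])
  fix i and s t :: real assume i: "i \<in> SS" and st: "0 \<le> s" "0 \<le> t"
  have "norm (picard m x t i - picard m x s i) \<le> rate * norm (t - s)"
  proof (rule field_differentiable_bound[where S = "{0..}" and f' = "\<lambda>t. rate * x t i + drift (x t) i - rate * picard m x t i"])
    fix u :: real assume u: "u \<in> {0..}"
    show "((\<lambda>u. picard m x u i) has_field_derivative rate * x u i + drift (x u) i - rate * picard m x u i) (at u within {0..})"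
      using picard_deriv[OF x i] u by simp
    have xs: "x u \<in> prob_simplex d" using x u by (simp add: admissible_def)
    have p: "0 \<le> picard m x u i" "picard m x u i \<le> 1" using picard_simplex[OF x m, of u] u i by (auto simp: prob_simplex_def)
    have r: "0 \<le> x u i + drift (x u) i / rate" "x u i + drift (x u) i / rate \<le> 1"
      using simplexD(1,2)[OF drift_step_simplex[OF xs] i] by auto
    have eq: "rate * x u i + drift (x u) i - rate * picard m x u i = rate * ((x u i + drift (x u) i / rate) - picard m x u i)"
      using rate_pos by (simp add: field_simps)
    have "\<bar>(x u i + drift (x u) i / rate) - picard m x u i\<bar> \<le> 1" using p r by linarith
    then show "norm (rate * x u i + drift (x u) i - rate * picard m x u i) \<le> rate"
      unfolding eq using rate_pos by (simp add: abs_mult)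
  qed (use st in auto)
  then show "\<bar>picard m x t i - picard m x s i\<bar> \<le> rate * \<bar>t - s\<bar>" by simp
qed

text \<open>The exponential weight makes the Picard operator a contraction on the whole half-line.\<close>

definition wt :: "real \<Rightarrow> real" where "wt t = exp (2 * (rate + lip) * t)"

lemma picard_contraction:
  assumes x: "admissible x" and y: "admissible y"
    and c: "\<And>t i. 0 \<le> t \<Longrightarrow> i \<in> SS \<Longrightarrow> \<bar>x t i - y t i\<bar> \<le> c * wt t"
    and i: "i \<in> SS" and t: "0 \<le> t"
  shows "\<bar>picard m x t i - picard m y t i\<bar> \<le> c / 2 * wt t"
proof -
  define L where "L = rate + lip"
  have L: "0 < L" using rate_pos lip_nonneg by (simp add: L_def)
  \<comment> \<open>The exponent of integrating factor times weight. Integration divides by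
    \<open>a\<close>, and \<open>L / a <= 1 / 2\<close> is the contraction factor.\<close>
  define a where "a = rate + 2 * L"
  have a: "0 < a" using L rate_pos by (simp add: a_def)
  have c0: "0 \<le> c" using c[of 0 i] i by (simp add: wt_def)
  let ?g = "\<lambda>x u. exp (rate * u) * (rate * x u i + drift (x u) i)"
  have int: "?g x integrable_on {0..t}" "?g y integrable_on {0..t}"
    by (intro integrable_continuous_real integrand_continuous x y i)+
  have hi: "((\<lambda>u. (c * L / a) * (a * exp (a * u))) has_integral (c * L / a) * (exp (a * t) - 1)) {0..t}"
    by (intro has_integral_mult_right integral_exp a t)
  have "norm (integral {0..t} (\<lambda>u. ?g x u - ?g y u)) \<le> integral {0..t} (\<lambda>u. (c * L / a) * (a * exp (a * u)))"
  proof (rule integral_norm_bound_integral)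
    show "(\<lambda>u. ?g x u - ?g y u) integrable_on {0..t}" by (intro integrable_diff int)
    show "(\<lambda>u. (c * L / a) * (a * exp (a * u))) integrable_on {0..t}" using hi by blast
    fix u assume u: "u \<in> {0..t}"
    have cu: "\<bar>x u i - y u i\<bar> \<le> c * wt u" if "i \<in> SS" for i using c that u by simp
    have "\<bar>(rate * x u i + drift (x u) i) - (rate * y u i + drift (y u) i)\<bar>
        \<le> rate * \<bar>x u i - y u i\<bar> + \<bar>drift (x u) i - drift (y u) i\<bar>"
    proof -
      have "(rate * x u i + drift (x u) i) - (rate * y u i + drift (y u) i)
          = rate * (x u i - y u i) + (drift (x u) i - drift (y u) i)" by (simp add: algebra_simps)
      moreover have "\<bar>rate * (x u i - y u i)\<bar> = rate * \<bar>x u i - y u i\<bar>" using rate_pos by (simp add: abs_mult)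
      ultimately show ?thesis
        using abs_triangle_ineq[of "rate * (x u i - y u i)" "drift (x u) i - drift (y u) i"] by linarith
    qed
    also have "\<dots> \<le> rate * (c * wt u) + lip * (c * wt u)"
      using cu[OF i] drift_lipschitz[OF cu i] rate_pos by (intro add_mono mult_left_mono) auto
    also have "\<dots> = c * L * wt u" by (simp add: L_def algebra_simps)
    finally have "norm (?g x u - ?g y u) \<le> exp (rate * u) * (c * L * wt u)"
      by (simp add: right_diff_distrib[symmetric] abs_mult)
    also have "\<dots> = c * L * (exp (rate * u) * wt u)" by simp
    also have "exp (rate * u) * wt u = exp (a * u)"
      by (simp add: wt_def a_def L_def exp_add[symmetric] algebra_simps)
    also have "c * L * exp (a * u) = (c * L / a) * (a * exp (a * u))" using a by simp
    finally show "norm (?g x u - ?g y u) \<le> (c * L / a) * (a * exp (a * u))" .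
  qed
  also have "\<dots> = (c * L / a) * (exp (a * t) - 1)" using hi by (rule integral_unique)
  also have "\<dots> \<le> (c * L / a) * exp (a * t)" using c0 L a by (intro mult_left_mono) auto
  also have "\<dots> \<le> (c / 2) * exp (a * t)"
  proof (rule mult_right_mono)
    have "c * L \<le> c * (a / 2)" using c0 rate_pos by (intro mult_left_mono) (simp_all add: a_def)
    then show "c * L / a \<le> c / 2" using a by (simp add: pos_divide_le_eq)
  qed simp
  finally have *: "\<bar>integral {0..t} (\<lambda>u. ?g x u - ?g y u)\<bar> \<le> (c / 2) * exp (a * t)" by simp
  have "picard m x t i - picard m y t i = exp (- (rate * t)) * integral {0..t} (\<lambda>u. ?g x u - ?g y u)"
    unfolding picard_def integral_diff[OF int] by (simp add: algebra_simps)
  then have "\<bar>picard m x t i - picard m y t i\<bar> \<le> exp (- (rate * t)) * ((c / 2) * exp (a * t))"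
    using * by (simp add: abs_mult)
  also have "\<dots> = c / 2 * wt t" by (simp add: wt_def a_def L_def exp_add[symmetric] algebra_simps)
  finally show ?thesis .
qed

lemma trajectory_exists:
  assumes m: "m \<in> prob_simplex d"
  shows "\<exists>x. ode_traj d Q \<alpha> m x \<and> admissible x"
proof -
  define X where "X n = (picard m ^^ n) (\<lambda>_. m)" for n
  have X0: "X 0 = (\<lambda>_. m)" and X_Suc: "X (Suc n) = picard m (X n)" for n by (auto simp: X_def)
  have adm: "admissible (X n)" for n
  proof (induction n)
    case 0 show ?case using m rate_pos by (simp add: X0 admissible_def)
  next
    case (Suc n) then show ?case using m by (simp add: X_Suc picard_admissible)
  qed
  have wt1: "1 \<le> wt t" if "0 \<le> t" for t using that rate_pos lip_nonneg by (simp add: wt_def)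
  have step: "\<bar>X (Suc n) t i - X n t i\<bar> \<le> (1/2)^n * wt t" if "0 \<le> t" "i \<in> SS" for n t i
    using that
  proof (induction n arbitrary: t i)
    case 0
    have "X 1 t \<in> prob_simplex d" "X 0 t \<in> prob_simplex d" using adm[of 1] adm[of 0] 0 by (auto simp: admissible_def)
    then have "\<bar>X 1 t i - X 0 t i\<bar> \<le> 1" using 0 by (auto simp: prob_simplex_def abs_le_iff) force+
    then show ?case using wt1[OF 0(1)] by simp
  next
    case (Suc n)
    show ?case
      using picard_contraction[OF adm[of "Suc n"] adm[of n] Suc.IH Suc.prems(2,1)] by (simp add: X_Suc)
  qed
  \<comment> \<open>The factor with \<open>k\<close> is the exact partial geometric sum; it lets the
    induction close and is dropped in the next fact.\<close>
  have tail: "\<bar>X (n + k) t i - X n t i\<bar> \<le> 2 * (1/2)^n * wt t * (1 - (1/2)^k)" if "0 \<le> t" "i \<in> SS" for n k t i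
  proof (induction k)
    case (Suc k)
    then show ?case using step[OF that, of "n + k"] by (simp add: power_add algebra_simps)
  qed simp
  have tail: "\<bar>X k t i - X n t i\<bar> \<le> 2 * (1/2)^n * wt t" if "0 \<le> t" "i \<in> SS" "n \<le> k" for n k t i
  proof -
    have "\<bar>X k t i - X n t i\<bar> \<le> 2 * (1/2)^n * wt t * (1 - (1/2)^(k - n))"
      using tail[OF that(1,2), of n "k - n"] that(3) by (simp only: le_add_diff_inverse)
    also have "\<dots> \<le> 2 * (1/2)^n * wt t * 1"
      using wt1[OF that(1)] by (intro mult_left_mono) auto
    finally show ?thesis by simp
  qed
  have lim0: "(\<lambda>n. c * (1/2)^n) \<longlonglongrightarrow> 0" for c :: real
    by (intro tendsto_mult_right_zero LIMSEQ_power_zero) simp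
  have "\<exists>l. (\<lambda>n. X n t i) \<longlonglongrightarrow> l" if ti: "0 \<le> t" "i \<in> SS" for t i
  proof -
    have "Cauchy (\<lambda>n. X n t i)"
    proof (rule metric_CauchyI)
      fix e :: real assume "0 < e"
      then have "eventually (\<lambda>n. (4 * wt t) * (1/2)^n < e) sequentially"
        using lim0 by (rule order_tendstoD(2)[rotated])
      then obtain n where n: "(4 * wt t) * (1/2)^n < e" by (auto simp: eventually_sequentially)
      have "dist (X k t i) (X l t i) < e" if kl: "n \<le> k" "n \<le> l" for k l
      proof -
        have "\<bar>X k t i - X l t i\<bar> \<le> \<bar>X k t i - X n t i\<bar> + \<bar>X l t i - X n t i\<bar>" by linarith
        also have "\<dots> \<le> (4 * wt t) * (1/2)^n"
          using tail[OF ti kl(1)] tail[OF ti kl(2)] by (simp add: mult_ac)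
        finally show ?thesis using n by (simp add: dist_real_def)
      qed
      then show "\<exists>M. \<forall>k\<ge>M. \<forall>l\<ge>M. dist (X k t i) (X l t i) < e" by blast
    qed
    then show ?thesis by (simp add: Cauchy_convergent_iff convergent_def)
  qed
  then obtain x where x: "\<And>t i. 0 \<le> t \<Longrightarrow> i \<in> SS \<Longrightarrow> (\<lambda>n. X n t i) \<longlonglongrightarrow> x t i" by metis
  have admx: "admissible x"
    unfolding admissible_def
  proof (intro conjI allI impI ballI)
    fix t :: real assume t: "0 \<le> t"
    have Xs: "X n t \<in> prob_simplex d" for n using adm[of n] t by (simp add: admissible_def)
    show "x t \<in> prob_simplex d"
    proof (rule simplexI)
      show "0 \<le> x t i" if "i \<in> SS" for i
        using simplexD(1)[OF Xs that] by (intro LIMSEQ_le_const[OF x[OF t that]]) auto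
      have "(\<lambda>n. \<Sum>i\<in>SS. X n t i) \<longlonglongrightarrow> (\<Sum>i\<in>SS. x t i)" using x[OF t] by (intro tendsto_sum)
      then show "(\<Sum>i\<in>SS. x t i) = 1" using simplexD(3)[OF Xs] by (simp add: LIMSEQ_const_iff)
    qed
  next
    fix i and s t :: real assume i: "i \<in> SS" and st: "0 \<le> s" "0 \<le> t"
    have "(\<lambda>n. \<bar>X n t i - X n s i\<bar>) \<longlonglongrightarrow> \<bar>x t i - x s i\<bar>"
      by (intro tendsto_intros x i st)
    then show "\<bar>x t i - x s i\<bar> \<le> rate * \<bar>t - s\<bar>"
      using adm i st by (intro LIMSEQ_le_const2) (auto simp: admissible_def)
  qed
  have near: "\<bar>x t i - X n t i\<bar> \<le> 2 * (1/2)^n * wt t" if "0 \<le> t" "i \<in> SS" for n t i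
  proof (rule LIMSEQ_le_const2)
    show "(\<lambda>k. \<bar>X k t i - X n t i\<bar>) \<longlonglongrightarrow> \<bar>x t i - X n t i\<bar>" by (intro tendsto_intros x that)
    show "\<exists>N. \<forall>k\<ge>N. \<bar>X k t i - X n t i\<bar> \<le> 2 * (1/2)^n * wt t" using tail[OF that] by blast
  qed
  have fixed: "x t i = picard m x t i" if ti: "0 \<le> t" "i \<in> SS" for t i
  proof -
    have "\<bar>x t i - picard m x t i\<bar> \<le> (2 * wt t) * (1/2)^n" for n
    proof -
      have "\<bar>picard m x t i - picard m (X n) t i\<bar> \<le> 2 * (1/2)^n / 2 * wt t"
        by (rule picard_contraction[OF admx adm near ti(2,1)])
      moreover have "\<bar>x t i - picard m (X n) t i\<bar> \<le> 2 * (1/2)^n / 2 * wt t"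
        using near[OF ti, of "Suc n"] by (simp add: X_Suc)
      ultimately have "\<bar>x t i - picard m x t i\<bar> \<le> 2 * (2 * (1/2)^n / 2 * wt t)" by linarith
      then show ?thesis by (simp add: mult_ac)
    qed
    then have "\<bar>x t i - picard m x t i\<bar> \<le> 0"
      by (intro LIMSEQ_le_const[OF lim0]) auto
    then show ?thesis by simp
  qed
  have "ode_traj d Q \<alpha> m x"
    unfolding ode_traj_def
  proof (intro conjI ballI allI impI)
    show "x 0 i = m i" if "i \<in> SS" for i using fixed[of 0 i] that by (simp add: picard_def)
    show xs: "x t \<in> prob_simplex d" if "0 \<le> t" for t using admx that by (simp add: admissible_def)
    fix t i assume t: "0 \<le> (t::real)" and i: "i \<in> SS"
    have "((\<lambda>t. picard m x t i) has_real_derivative drift (x t) i) (at t within {0..})"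
      using picard_deriv[OF admx i t, of m] unfolding fixed[OF t i, symmetric] by simp
    then have "((\<lambda>t. x t i) has_real_derivative drift (x t) i) (at t within {0..})"
    proof (rule has_field_derivative_transform_within[OF _ zero_less_one])
      show "t \<in> {0..}" using t by simp
      show "picard m x u i = x u i" if "u \<in> {0..}" for u using fixed[of u i] that i by simp
    qed
    then show "((\<lambda>u. x u i) has_real_derivative tau d Q * (phi d Q \<alpha> (x t) i - x t i)) (at t within {0..})"
      using phi_drift[OF xs[OF t] i] by simp
  qed
  then show ?thesis using admx by blast
qed

text \<open>Local error of the Euler scheme: within time \<open>h\<close> the trajectory moves by at
  most \<open>rate * h\<close>, so the drift changes by at most
  \<open>lip * rate * h\<close>.\<close>

lemma trajectory_step:
  assumes x: "ode_traj d Q \<alpha> m x" "admissible x" and i: "i \<in> SS" and t: "0 \<le> t" and h: "0 \<le> h"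
  shows "\<bar>x (t + h) i - x t i - h * drift (x t) i\<bar> \<le> lip * rate * h * h"
proof -
  let ?f = "\<lambda>u. x u i - u * drift (x t) i"
  have "norm (?f (t + h) - ?f t) \<le> (lip * rate * h) * norm ((t + h) - t)"
  proof (rule field_differentiable_bound[where S = "{t..t+h}" and f' = "\<lambda>u. drift (x u) i - drift (x t) i"])
    fix u assume u: "u \<in> {t..t+h}"
    have xs: "x u \<in> prob_simplex d" using x(2) u t by (simp add: admissible_def)
    have "((\<lambda>u. x u i) has_real_derivative tau d Q * (phi d Q \<alpha> (x u) i - x u i)) (at u within {0..})"
      using x(1) u t i by (simp add: ode_traj_def)
    then have "((\<lambda>u. x u i) has_real_derivative drift (x u) i) (at u within {t..t+h})"
      unfolding phi_drift[OF xs i] by (rule DERIV_subset) (use t in auto)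
    then show "(?f has_field_derivative drift (x u) i - drift (x t) i) (at u within {t..t + h})"
      by (auto intro!: derivative_eq_intros)
    have "\<bar>x u i - x t i\<bar> \<le> rate * h" if "i \<in> SS" for i
    proof -
      have "\<bar>x u i - x t i\<bar> \<le> rate * \<bar>u - t\<bar>" using u t by (intro admissible_lipschitz[OF x(2) that]) auto
      also have "\<dots> \<le> rate * h" using u rate_pos by (intro mult_left_mono) auto
      finally show ?thesis .
    qed
    from drift_lipschitz[OF this i] show "norm (drift (x u) i - drift (x t) i) \<le> lip * rate * h"
      by (simp add: mult.assoc)
  qed (use h in auto)
  then show ?thesis using h by (simp add: algebra_simps)
qed

end

section \<open>The joint chain\<close>

lemma joint_statesD: "s \<in> joint_states N d \<Longrightarrow> n < N \<Longrightarrow> s n \<in> {1..d}"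
  by (simp add: joint_states_def)

lemma finite_joint_states: "finite (joint_states N d)"
proof -
  have "joint_states N d = {f. \<forall>n. (n \<in> {..<N} \<longrightarrow> f n \<in> {1..d}) \<and> (n \<notin> {..<N} \<longrightarrow> f n = 0)}"
    unfolding joint_states_def by (intro set_eqI) (simp, metis not_le)
  then show ?thesis using finite_set_of_finite_funs[of "{..<N}" "{1..d}" 0] by simp
qed

lemma joint_states_upd: "s \<in> joint_states N d \<Longrightarrow> n < N \<Longrightarrow> i \<in> {1..d} \<Longrightarrow> s(n := i) \<in> joint_states N d"
  by (auto simp: joint_states_def)

lemma act_cases: "act A n \<in> {0, 1}"
  by (simp add: act_def)

text \<open>Bandits jump one at a time, so the joint generator is a sum over single coordinate
  changes. The term with \<open>i = s n\<close> is zero, which hides the diagonal convention of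
  \<open>gen_act\<close>.\<close>

lemma gen_act_apply:
  assumes s: "s \<in> joint_states N d"
  shows "apply_on (joint_states N d) (gen_act N d Q A) f s =
    (\<Sum>n<N. \<Sum>i\<in>{1..d}. Q (act A n) (s n) i * (f (s(n := i)) - f s))"
proof -
  let ?S = "joint_states N d"
  let ?r = "\<lambda>n s'. if s' = s(n := s' n) \<and> s' n \<noteq> s n then Q (act A n) (s n) (s' n) else 0"
  have "apply_on ?S (gen_act N d Q A) f s
      = gen_act N d Q A s s * f s + (\<Sum>s'\<in>?S - {s}. gen_act N d Q A s s' * f s')"
    unfolding apply_on_def by (rule sum.remove[OF finite_joint_states s])
  also have "(\<Sum>s'\<in>?S - {s}. gen_act N d Q A s s' * f s') = (\<Sum>s'\<in>?S - {s}. rate_off N Q A s s' * f s')"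
    by (intro sum.cong) (auto simp: gen_act_def)
  also have "gen_act N d Q A s s * f s + \<dots> = (\<Sum>s'\<in>?S - {s}. rate_off N Q A s s' * (f s' - f s))"
    by (simp add: gen_act_def right_diff_distrib sum_subtractf sum_distrib_right)
  also have "\<dots> = (\<Sum>s'\<in>?S - {s}. \<Sum>n<N. ?r n s' * (f s' - f s))"
    by (simp add: rate_off_def sum_distrib_right)
  also have "\<dots> = (\<Sum>n<N. \<Sum>s'\<in>?S - {s}. ?r n s' * (f s' - f s))"
    by (rule sum.swap)
  also have "\<dots> = (\<Sum>n<N. \<Sum>i\<in>{1..d}. Q (act A n) (s n) i * (f (s(n := i)) - f s))"
  proof (intro sum.cong refl)
    fix n assume "n \<in> {..<N}"
    then have n: "n < N" by simp
    let ?g = "\<lambda>i. s(n := i)"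
    have "(\<Sum>i\<in>{1..d}. Q (act A n) (s n) i * (f (?g i) - f s)) = (\<Sum>i\<in>{1..d} - {s n}. ?r n (?g i) * (f (?g i) - f s))"
      by (rule sum.mono_neutral_cong_right) auto
    also have "\<dots> = (\<Sum>s'\<in>?g ` ({1..d} - {s n}). ?r n s' * (f s' - f s))"
      by (subst sum.reindex) (auto simp: inj_on_def fun_upd_eqD)
    also have "\<dots> = (\<Sum>s'\<in>?S - {s}. ?r n s' * (f s' - f s))"
    proof (rule sum.mono_neutral_left)
      show "finite (?S - {s})" using finite_joint_states by simp
      show "?g ` ({1..d} - {s n}) \<subseteq> ?S - {s}"
        using joint_states_upd[OF s n] by (auto simp: fun_upd_idem_iff)
      show "\<forall>s'\<in>?S - {s} - ?g ` ({1..d} - {s n}). ?r n s' * (f s' - f s) = 0"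
      proof
        fix s' assume s': "s' \<in> ?S - {s} - ?g ` ({1..d} - {s n})"
        have "\<not> (s' = s(n := s' n) \<and> s' n \<noteq> s n)"
        proof
          assume *: "s' = s(n := s' n) \<and> s' n \<noteq> s n"
          then have "s' \<in> ?g ` ({1..d} - {s n})"
            using joint_statesD[of s' N d n] s' n by (intro image_eqI[of _ _ "s' n"]) auto
          then show False using s' by simp
        qed
        then show "?r n s' * (f s' - f s) = 0" by auto
      qed
    qed
    finally show "(\<Sum>s'\<in>?S - {s}. ?r n s' * (f s' - f s)) = (\<Sum>i\<in>{1..d}. Q (act A n) (s n) i * (f (?g i) - f s))" ..
  qed
  finally show ?thesis .
qed

lemma gen_act_row:
  assumes "s \<in> joint_states N d"
  shows "(\<Sum>s'\<in>joint_states N d. gen_act N d Q A s s') = 0"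
  using gen_act_apply[OF assms, of Q A "\<lambda>_. 1"] by (simp add: apply_on_def)

lemma gen_act_nonneg:
  assumes gen: "\<And>a. a \<in> {0,1} \<Longrightarrow> generator_on {1..d} (Q a)"
    and s: "s \<in> joint_states N d" "s' \<in> joint_states N d" "s \<noteq> s'"
  shows "0 \<le> gen_act N d Q A s s'"
  unfolding gen_act_def rate_off_def using s joint_statesD[OF s(1)] joint_statesD[OF s(2)]
  by (auto intro!: sum_nonneg generator_onD(2)[OF gen[OF act_cases]])

lemma gen_pol_generator:
  assumes gen: "\<And>a. a \<in> {0,1} \<Longrightarrow> generator_on {1..d} (Q a)" and \<pi>: "stat_policy N d \<pi>"
  shows "generator_on (joint_states N d) (gen_pol N d Q \<pi>)"
  unfolding generator_on_def
proof (intro conjI ballI impI finite_joint_states)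
  fix s s' assume "s \<in> joint_states N d" "s' \<in> joint_states N d" "s \<noteq> s'"
  then show "0 \<le> gen_pol N d Q \<pi> s s'"
    unfolding gen_pol_def
  proof (intro sum_nonneg mult_nonneg_nonneg)
    fix A
    show "0 \<le> \<pi> s A" using \<pi> \<open>s \<in> joint_states N d\<close> by (simp add: stat_policy_def)
    show "0 \<le> gen_act N d Q A s s'"
      by (rule gen_act_nonneg[OF gen \<open>s \<in> joint_states N d\<close> \<open>s' \<in> joint_states N d\<close> \<open>s \<noteq> s'\<close>])
  qed
next
  fix s assume s: "s \<in> joint_states N d"
  have "(\<Sum>s'\<in>joint_states N d. gen_pol N d Q \<pi> s s') = (\<Sum>A\<in>Pow {..<N}. \<Sum>s'\<in>joint_states N d. \<pi> s A * gen_act N d Q A s s')"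
    unfolding gen_pol_def by (rule sum.swap)
  also have "\<dots> = 0" using gen_act_row[OF s] by (simp add: sum_distrib_left[symmetric])
  finally show "(\<Sum>s'\<in>joint_states N d. gen_pol N d Q \<pi> s s') = 0" .
qed

lemma det_gen_generator:
  assumes gen: "\<And>a. a \<in> {0,1} \<Longrightarrow> generator_on {1..d} (Q a)"
  shows "generator_on (joint_states N d) (det_gen N d Q Act)"
  unfolding generator_on_def det_gen_def
proof (intro conjI ballI impI finite_joint_states gen_act_row)
  show "0 \<le> gen_act N d Q (Act s) s s'" if "s \<in> joint_states N d" "s' \<in> joint_states N d" "s \<noteq> s'" for s s'
    by (rule gen_act_nonneg[OF gen that])
qed

lemma apply_on_gen_pol:
  "apply_on S (gen_pol N d Q \<pi>) f s = (\<Sum>A\<in>Pow {..<N}. \<pi> s A * apply_on S (gen_act N d Q A) f s)"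
proof -
  have "apply_on S (gen_pol N d Q \<pi>) f s = (\<Sum>y\<in>S. \<Sum>A\<in>Pow {..<N}. \<pi> s A * (gen_act N d Q A s y * f y))"
    by (simp add: apply_on_def gen_pol_def sum_distrib_right mult.assoc)
  also have "\<dots> = (\<Sum>A\<in>Pow {..<N}. \<Sum>y\<in>S. \<pi> s A * (gen_act N d Q A s y * f y))"
    by (rule sum.swap)
  finally show ?thesis by (simp add: apply_on_def sum_distrib_left)
qed

section \<open>The empirical measure under the priority rule\<close>

definition count_state :: "nat \<Rightarrow> (nat \<Rightarrow> nat) \<Rightarrow> nat \<Rightarrow> real" where
  "count_state N s i = real (card {n. n < N \<and> s n = i})"

definition emp :: "nat \<Rightarrow> (nat \<Rightarrow> nat) \<Rightarrow> nat \<Rightarrow> real" where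
  "emp N s i = count_state N s i / real N"

lemma count_state_sum: "count_state N s i = (\<Sum>n<N. if s n = i then 1 else 0)"
proof -
  have "{..<N} \<inter> {n. s n = i} = {n. n < N \<and> s n = i}" by auto
  then show ?thesis unfolding count_state_def by (simp add: sum.If_cases)
qed

lemma card_cum:
  assumes s: "s \<in> joint_states N d"
  shows "real (card {n. n < N \<and> s n \<le> k}) = (\<Sum>i\<in>{1..k}. count_state N s i)"
proof -
  have "{n. n < N \<and> s n \<le> k} = (\<Union>i\<in>{1..k}. {n. n < N \<and> s n = i})"
    using joint_statesD[OF s] by force
  also have "card \<dots> = (\<Sum>i\<in>{1..k}. card {n. n < N \<and> s n = i})"
    by (rule card_UN_disjoint) auto
  finally show ?thesis by (simp add: count_state_def)
qed

lemma cum_emp: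
  assumes s: "s \<in> joint_states N d" and N: "0 < N"
  shows "real N * cum (emp N s) k = real (card {n. n < N \<and> s n \<le> k})"
  unfolding card_cum[OF s] cum_def emp_def using N by (simp add: sum_divide_distrib[symmetric])

lemma emp_simplex:
  assumes s: "s \<in> joint_states N d" and N: "0 < N"
  shows "emp N s \<in> prob_simplex d"
proof (rule simplexI)
  have "{n. n < N \<and> s n \<le> d} = {..<N}" using joint_statesD[OF s] by auto
  then have "real N * cum (emp N s) d = real N" using cum_emp[OF s N, of d] by simp
  then show "(\<Sum>i\<in>{1..d}. emp N s i) = 1" using N by (simp add: cum_def)
qed (simp add: emp_def count_state_def)

text \<open>Under a priority rule either all bandits with state at most \<open>k\<close> are active, or only those are.\<close>

lemma wip_active_count:
  fixes N :: nat and s :: "nat \<Rightarrow> nat"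
  assumes A: "A \<subseteq> {..<N}" "card A = K" and pr: "\<forall>n\<in>A. \<forall>k<N. k \<notin> A \<longrightarrow> s n \<le> s k"
  shows "card {n \<in> A. s n \<le> k} = min K (card {n. n < N \<and> s n \<le> k})"
proof -
  have finA: "finite A" by (rule finite_subset[OF A(1) finite_lessThan])
  let ?B = "{n. n < N \<and> s n \<le> k}"
  have sub: "{n \<in> A. s n \<le> k} \<subseteq> ?B" using A by auto
  show ?thesis
  proof (cases "?B \<subseteq> A")
    case True
    then have "{n \<in> A. s n \<le> k} = ?B" using A by auto
    moreover have "card ?B \<le> K" using True A(2) finA by (metis card_mono)
    ultimately show ?thesis by simp
  next
    case False
    then obtain j where j: "j < N" "s j \<le> k" "j \<notin> A" by auto
    then have "{n \<in> A. s n \<le> k} = A" using pr by force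
    moreover have "card {n \<in> A. s n \<le> k} \<le> card ?B" by (intro card_mono sub) simp
    ultimately show ?thesis using A(2) by (simp only: min_absorb1)
  qed
qed

text \<open>The difference of the active counts up to \<open>i\<close> and up to
  \<open>i - 1\<close>, each being \<open>N\<close> times the minimum of \<alpha> and a cumulative
  mass. This is the origin of the formula for \<open>active_mass\<close>.\<close>

lemma wip_active_in_state:
  assumes s: "s \<in> joint_states N d" and N: "0 < N" and K: "real K = \<alpha> * real N"
    and A: "A \<subseteq> {..<N}" "card A = K" and pr: "\<forall>n\<in>A. \<forall>k<N. k \<notin> A \<longrightarrow> s n \<le> s k" and i: "1 \<le> i"
  shows "real (card {n \<in> A. s n = i}) = real N * active_mass \<alpha> (emp N s) i"
proof -
  have finA: "finite A" by (rule finite_subset[OF A(1) finite_lessThan])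
  have c: "real (card {n \<in> A. s n \<le> k}) = real N * min \<alpha> (cum (emp N s) k)" for k
  proof -
    have "real (card {n \<in> A. s n \<le> k}) = min (real K) (real (card {n. n < N \<and> s n \<le> k}))"
      unfolding wip_active_count[OF A pr] by simp
    also have "\<dots> = min (real N * \<alpha>) (real N * cum (emp N s) k)"
      by (simp only: cum_emp[OF s N] K mult.commute)
    also have "\<dots> = real N * min \<alpha> (cum (emp N s) k)" using N by (simp add: min_def)
    finally show ?thesis .
  qed
  have "{n \<in> A. s n \<le> i} = {n \<in> A. s n \<le> i - 1} \<union> {n \<in> A. s n = i}" using i by auto
  moreover have "{n \<in> A. s n \<le> i - 1} \<inter> {n \<in> A. s n = i} = {}" using i by auto
  ultimately have "card {n \<in> A. s n \<le> i} = card {n \<in> A. s n \<le> i - 1} + card {n \<in> A. s n = i}"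
    using card_Un_disjoint[of "{n \<in> A. s n \<le> i - 1}" "{n \<in> A. s n = i}"] finA by simp
  then have "real (card {n \<in> A. s n = i}) = real (card {n \<in> A. s n \<le> i}) - real (card {n \<in> A. s n \<le> i - 1})"
    by simp
  then show ?thesis unfolding c active_mass_def by (simp add: right_diff_distrib)
qed

lemma sum_by_state:
  assumes s: "s \<in> joint_states N d" and A: "A \<subseteq> {..<N}"
  shows "(\<Sum>n<N. g (act A n) (s n)) = (\<Sum>i\<in>{1..d}. real (card {n \<in> A. s n = i}) * g 1 i
     + (count_state N s i - real (card {n \<in> A. s n = i})) * g 0 i)"
proof -
  have "(\<Sum>n<N. g (act A n) (s n)) = (\<Sum>i\<in>{1..d}. \<Sum>n\<in>{n \<in> {..<N}. s n = i}. g (act A n) (s n))"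
    using joint_statesD[OF s] by (intro sum.group[symmetric]) auto
  also have "\<dots> = (\<Sum>i\<in>{1..d}. real (card {n \<in> A. s n = i}) * g 1 i
     + (count_state N s i - real (card {n \<in> A. s n = i})) * g 0 i)"
  proof (intro sum.cong refl)
    fix i
    have fin: "finite {n \<in> A. s n = i}" using A finite_subset[of "{n \<in> A. s n = i}" "{..<N}"] by auto
    have split: "{n \<in> {..<N}. s n = i} = {n \<in> A. s n = i} \<union> ({n. n < N \<and> s n = i} - {n \<in> A. s n = i})" using A by auto
    have "(\<Sum>n\<in>{n \<in> {..<N}. s n = i}. g (act A n) (s n))
       = (\<Sum>n\<in>{n \<in> A. s n = i}. g (act A n) (s n)) + (\<Sum>n\<in>{n. n < N \<and> s n = i} - {n \<in> A. s n = i}. g (act A n) (s n))"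
      unfolding split using fin by (intro sum.union_disjoint) auto
    also have "(\<Sum>n\<in>{n \<in> A. s n = i}. g (act A n) (s n)) = (\<Sum>n\<in>{n \<in> A. s n = i}. g 1 i)"
      by (intro sum.cong) (auto simp: act_def)
    also have "(\<Sum>n\<in>{n. n < N \<and> s n = i} - {n \<in> A. s n = i}. g (act A n) (s n)) = (\<Sum>n\<in>{n. n < N \<and> s n = i} - {n \<in> A. s n = i}. g 0 i)"
      by (intro sum.cong) (auto simp: act_def)
    finally show "(\<Sum>n\<in>{n \<in> {..<N}. s n = i}. g (act A n) (s n)) = real (card {n \<in> A. s n = i}) * g 1 i
     + (count_state N s i - real (card {n \<in> A. s n = i})) * g 0 i"
      using card_Diff_subset[OF fin, of "{n. n < N \<and> s n = i}"] card_mono[of "{n. n < N \<and> s n = i}" "{n \<in> A. s n = i}"] A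
      by (auto simp: count_state_def of_nat_diff subset_iff)
  qed
  finally show ?thesis .
qed

text \<open>The mean motion of the finite system agrees with the mean-field drift exactly, with no
  error of order \<open>1 / N\<close>, because exactly \<alpha>\<open>N\<close> bandits are
  active.\<close>

lemma (in mean_field) wip_drift:
  assumes s: "s \<in> joint_states N d" and N: "0 < N" and K: "real K = \<alpha> * real N"
    and A: "A \<subseteq> {..<N}" "card A = K" and pr: "\<forall>n\<in>A. \<forall>k<N. k \<notin> A \<longrightarrow> s n \<le> s k"
  shows "(\<Sum>n<N. Q (act A n) (s n) j) = real N * drift (emp N s) j"
proof -
  have "(\<Sum>n<N. Q (act A n) (s n) j) = (\<Sum>i\<in>SS. real (card {n \<in> A. s n = i}) * Q 1 i j
     + (count_state N s i - real (card {n \<in> A. s n = i})) * Q 0 i j)"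
    by (rule sum_by_state[OF s A(1), where g = "\<lambda>a i. Q a i j"])
  also have "\<dots> = (\<Sum>i\<in>SS. real N * (active_mass \<alpha> (emp N s) i * Q 1 i j + (emp N s i - active_mass \<alpha> (emp N s) i) * Q 0 i j))"
  proof (intro sum.cong refl)
    fix i assume i: "i \<in> SS"
    have "count_state N s i = real N * emp N s i" using N by (simp add: emp_def)
    then show "real (card {n \<in> A. s n = i}) * Q 1 i j + (count_state N s i - real (card {n \<in> A. s n = i})) * Q 0 i j =
      real N * (active_mass \<alpha> (emp N s) i * Q 1 i j + (emp N s i - active_mass \<alpha> (emp N s) i) * Q 0 i j)"
      using wip_active_in_state[OF s N K A pr, of i] i by (simp add: algebra_simps)
  qed
  finally show ?thesis by (simp add: drift_def sum_distrib_left)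
qed

section \<open>Lagrangian bound for the relaxed problem\<close>

definition total_bias :: "nat \<Rightarrow> (nat \<Rightarrow> real) \<Rightarrow> (nat \<Rightarrow> nat) \<Rightarrow> real" where
  "total_bias N h s = (\<Sum>n<N. h (s n))"

context bandit
begin

text \<open>The joint generator acts on an additive function as the sum of the single-bandit
  generators. Paying \<nu> per passive bandit therefore decouples the bandits.\<close>

lemma lagrangian:
  assumes s: "s \<in> joint_states N d" and A: "A \<subseteq> {..<N}"
  shows "reward_act N R A s + \<nu> * (real N - real (card A))
      + apply_on (joint_states N d) (gen_act N d Q A) (total_bias N h) s
    = (\<Sum>n<N. qval d Q R \<nu> h (act A n) (s n))"
proof -
  have "total_bias N h (s(n := i)) - total_bias N h s = h i - h (s n)" if n: "n < N" for n i
  proof -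
    have "(\<Sum>k\<in>{..<N} - {n}. h ((s(n := i)) k)) = (\<Sum>k\<in>{..<N} - {n}. h (s k))"
      by (intro sum.cong) auto
    then show ?thesis
      unfolding total_bias_def using n
        sum.remove[of "{..<N}" n "\<lambda>k. h ((s(n := i)) k)"] sum.remove[of "{..<N}" n "\<lambda>k. h (s k)"] by simp
  qed
  then have "apply_on (joint_states N d) (gen_act N d Q A) (total_bias N h) s
      = (\<Sum>n<N. \<Sum>i\<in>SS. Q (act A n) (s n) i * (h i - h (s n)))"
    unfolding gen_act_apply[OF s] by (intro sum.cong refl) auto
  also have "\<dots> = (\<Sum>n<N. apply_on SS (Q (act A n)) h (s n))"
  proof (intro sum.cong refl)
    fix n assume n: "n \<in> {..<N}"
    have "s n \<in> SS" using joint_statesD[OF s] n by blast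
    from apply_on_shift[where f = h and c = "h (s n)", OF gen[OF act_cases] this]
    show "(\<Sum>i\<in>SS. Q (act A n) (s n) i * (h i - h (s n))) = apply_on SS (Q (act A n)) h (s n)"
      by (simp add: apply_on_def)
  qed
  finally have 1: "apply_on (joint_states N d) (gen_act N d Q A) (total_bias N h) s = (\<Sum>n<N. apply_on SS (Q (act A n)) h (s n))" .
  have "(\<Sum>n<N. if act A n = 0 then \<nu> else 0) = \<nu> * (real N - real (card A))"
  proof -
    have "(\<Sum>n<N. if act A n = 0 then \<nu> else 0) = (\<Sum>n\<in>{..<N} - A. \<nu>)"
      by (rule sum.mono_neutral_cong_right) (auto simp: act_def)
    also have "\<dots> = \<nu> * real (N - card A)"
      using card_Diff_subset[of A "{..<N}"] A finite_subset[of A "{..<N}"] by simp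
    finally show ?thesis using card_mono[of "{..<N}" A] A by (simp add: of_nat_diff)
  qed
  then show ?thesis unfolding 1 reward_act_def qval_eq by (simp add: sum.distrib)
qed

text \<open>Weak duality. The bound holds for every joint state and every set of active bandits,
  whatever its size, and is preserved by randomization. In the time average the bias term vanishes
  and the activity constraint enters through its limit.\<close>

lemma relaxed_upper_bound:
  assumes opt: "\<And>i a. i \<in> SS \<Longrightarrow> a \<in> {0,1} \<Longrightarrow> qval d Q R \<nu> h a i \<le> g"
    and \<pi>: "stat_policy N d \<pi>" and x: "x \<in> joint_states N d"
    and act: "(time_avg (joint_states N d) (gen_pol N d Q \<pi>) (activation_pol N \<pi>) x \<longlongrightarrow> \<alpha> * real N) at_top"
    and rew: "(time_avg (joint_states N d) (gen_pol N d Q \<pi>) (reward_pol N R \<pi>) x \<longlongrightarrow> v) at_top"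
  shows "v \<le> real N * (g - \<nu> * (1 - \<alpha>))"
proof -
  let ?S = "joint_states N d" let ?G = "gen_pol N d Q \<pi>"
  let ?TA = "time_avg ?S ?G"
  let ?H = "total_bias N h"
  have G: "generator_on ?S ?G" by (rule gen_pol_generator[OF gen \<pi>])
  have pt: "reward_pol N R \<pi> s + (- \<nu>) * activation_pol N \<pi> s + apply_on ?S ?G ?H s \<le> real N * g - \<nu> * real N"
    if s: "s \<in> ?S" for s
  proof -
    have p1: "(\<Sum>A\<in>Pow {..<N}. \<pi> s A) = 1" and p0: "\<And>A. 0 \<le> \<pi> s A" using \<pi> s by (auto simp: stat_policy_def)
    have each: "reward_act N R A s + (- \<nu>) * real (card A) + apply_on ?S (gen_act N d Q A) ?H s \<le> real N * g - \<nu> * real N"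
      if A: "A \<in> Pow {..<N}" for A
    proof -
      have "(\<Sum>n<N. qval d Q R \<nu> h (act A n) (s n)) \<le> (\<Sum>n<N. g)"
        using joint_statesD[OF s] act_cases by (intro sum_mono opt) auto
      then show ?thesis using lagrangian[OF s, of A \<nu> h] A by (simp add: algebra_simps)
    qed
    have "reward_pol N R \<pi> s + (- \<nu>) * activation_pol N \<pi> s + apply_on ?S ?G ?H s
       = (\<Sum>A\<in>Pow {..<N}. \<pi> s A * (reward_act N R A s + (- \<nu>) * real (card A) + apply_on ?S (gen_act N d Q A) ?H s))"
      unfolding reward_pol_def activation_pol_def apply_on_gen_pol
      by (simp add: sum_distrib_left sum.distrib algebra_simps sum_subtractf sum_negf)
    also have "\<dots> \<le> (\<Sum>A\<in>Pow {..<N}. \<pi> s A * (real N * g - \<nu> * real N))"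
      using each p0 by (intro sum_mono mult_left_mono) auto
    also have "\<dots> = real N * g - \<nu> * real N" by (simp add: sum_distrib_right[symmetric] p1)
    finally show ?thesis .
  qed
  have "((\<lambda>T. ?TA (reward_pol N R \<pi>) x T + (- \<nu>) * ?TA (activation_pol N \<pi>) x T + ?TA (apply_on ?S ?G ?H) x T)
     \<longlongrightarrow> v + (- \<nu>) * (\<alpha> * real N) + 0) at_top"
    by (intro tendsto_add tendsto_mult_left rew act time_avg_generator_tendsto_0[OF G x])
  moreover have "eventually (\<lambda>T. ?TA (reward_pol N R \<pi>) x T + (- \<nu>) * ?TA (activation_pol N \<pi>) x T + ?TA (apply_on ?S ?G ?H) x T
      \<le> real N * g - \<nu> * real N) at_top"
  proof (rule eventually_at_top_linorderI[of 1])
    fix T :: real assume T: "1 \<le> T"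
    have "?TA (\<lambda>s. reward_pol N R \<pi> s + (- \<nu>) * activation_pol N \<pi> s + apply_on ?S ?G ?H s) x T
      \<le> ?TA (\<lambda>_. real N * g - \<nu> * real N) x T"
      using T by (intro time_avg_le[OF G x] pt) auto
    then show "?TA (reward_pol N R \<pi>) x T + (- \<nu>) * ?TA (activation_pol N \<pi>) x T + ?TA (apply_on ?S ?G ?H) x T
      \<le> real N * g - \<nu> * real N"
      unfolding time_avg_add[OF finite_joint_states x] time_avg_cmult using T time_avg_const[OF G x] by simp
  qed
  ultimately have "v + (- \<nu>) * (\<alpha> * real N) + 0 \<le> real N * g - \<nu> * real N"
    by (intro tendsto_upperbound) auto
  then show ?thesis by (simp add: algebra_simps)
qed

end

section \<open>Concentration around the mean-field limit\<close>

lemma exp_le_quadratic: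
  fixes x :: real
  assumes "\<bar>x\<bar> \<le> 1"
  shows "exp x \<le> 1 + x + x\<^sup>2"
proof (cases "0 \<le> x")
  case True then show ?thesis using assms exp_bound[of x] by simp
next
  case False
  have "1 \<le> (1 + x + x\<^sup>2) * (1 - x)"
  proof -
    have "(1 + x + x\<^sup>2) * (1 - x) = 1 - x * x\<^sup>2" by (simp add: algebra_simps power2_eq_square)
    moreover have "x * x\<^sup>2 \<le> 0" using False by (intro mult_nonpos_nonneg) auto
    ultimately show ?thesis by simp
  qed
  also have "\<dots> \<le> (1 + x + x\<^sup>2) * exp (- x)"
  proof (rule mult_left_mono)
    show "1 - x \<le> exp (- x)" using exp_ge_add_one_self[of "- x"] by simp
    show "0 \<le> 1 + x + x\<^sup>2" using assms by (simp add: abs_le_iff)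
  qed
  finally have "1 \<le> (1 + x + x\<^sup>2) * exp (- x)" .
  then have "exp x * 1 \<le> exp x * ((1 + x + x\<^sup>2) * exp (- x))" by (intro mult_left_mono) auto
  also have "\<dots> = 1 + x + x\<^sup>2" by (simp add: exp_minus)
  finally show ?thesis by simp
qed

text \<open>Dominates the change of each count since the start \<open>x\<close> but, being a sum
  over bandits, still has a tractable exponential moment.\<close>

definition mismatch :: "nat \<Rightarrow> (nat \<Rightarrow> nat) \<Rightarrow> (nat \<Rightarrow> nat) \<Rightarrow> real" where
  "mismatch N x y = (\<Sum>n<N. if y n = x n then 0 else 1)"

lemma sum_upd:
  fixes f :: "nat \<Rightarrow> nat \<Rightarrow> real"
  assumes "n < N"
  shows "(\<Sum>k<N. f k ((y(n := i)) k)) = (\<Sum>k<N. f k (y k)) + (f n i - f n (y n))"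
proof -
  have "(\<Sum>k\<in>{..<N} - {n}. f k ((y(n := i)) k)) = (\<Sum>k\<in>{..<N} - {n}. f k (y k))"
    by (intro sum.cong) auto
  then show ?thesis
    using assms sum.remove[of "{..<N}" n "\<lambda>k. f k ((y(n := i)) k)"] sum.remove[of "{..<N}" n "\<lambda>k. f k (y k)"] by simp
qed

lemma emp_mismatch:
  assumes "0 < N"
  shows "\<bar>emp N y i - emp N x i\<bar> \<le> mismatch N x y / real N"
proof -
  have "\<bar>count_state N y i - count_state N x i\<bar> \<le> mismatch N x y"
    unfolding count_state_sum mismatch_def sum_subtractf[symmetric]
    by (rule order_trans[OF sum_abs]) (intro sum_mono, auto)
  then show ?thesis using assms by (simp add: emp_def diff_divide_distrib[symmetric] divide_right_mono)
qed

locale wip_chain = mean_field +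
  fixes N K :: nat and Act :: "(nat \<Rightarrow> nat) \<Rightarrow> nat set"
  assumes N: "0 < N" and K: "real K = \<alpha> * real N" and wip: "wip_policy N d K Act"
begin

abbreviation "JS \<equiv> joint_states N d"
abbreviation "G \<equiv> det_gen N d Q Act"
abbreviation "Pt t \<equiv> apply_on JS (trans_fun JS G t)"

lemma generator: "generator_on JS G"
  by (rule det_gen_generator[OF gen])

lemma wipD:
  assumes "s \<in> JS"
  shows "Act s \<subseteq> {..<N}" "card (Act s) = K" "\<forall>n\<in>Act s. \<forall>k<N. k \<notin> Act s \<longrightarrow> s n \<le> s k"
  using wip assms by (auto simp: wip_policy_def)

lemma apply_G: "s \<in> JS \<Longrightarrow> apply_on JS G f s = (\<Sum>n<N. \<Sum>i\<in>SS. Q (act (Act s) n) (s n) i * (f (s(n := i)) - f s))"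
  using gen_act_apply[of s N d Q "Act s" f] by (simp add: apply_on_def det_gen_def)

text \<open>One bandit's contribution to the generator applied to \<open>exp (\<theta> count + \<kappa> mismatch)\<close>.\<close>

lemma single_jump_bound:
  assumes y: "y \<in> JS" and n: "n < N" and j: "j \<in> SS" and xn: "x n \<in> SS"
    and \<theta>: "\<bar>\<theta>\<bar> \<le> 1 / 2" and \<kappa>: "0 \<le> \<kappa>" "\<kappa> \<le> \<bar>\<theta>\<bar>" and a: "a \<in> {0, 1}"
    and \<Delta>: "\<And>i. \<Delta> i = \<theta> * ((if i = j then 1 else 0) - (if y n = j then 1 else 0))
                    + \<kappa> * ((if i = x n then 0 else 1) - (if y n = x n then 0 else 1))"
  shows "(\<Sum>i\<in>SS. Q a (y n) i * (exp (\<Delta> i) - 1)) \<le> \<theta> * Q a (y n) j + \<kappa> * rate + 4 * \<theta>\<^sup>2 * rate"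
proof -
  have yn: "y n \<in> SS" by (rule joint_statesD[OF y n])
  note Ga = gen[OF a]
  \<comment> \<open>One jump changes each indicator by at most 1, and \<kappa> is at most
    \<bar>\<theta>\<bar>. With \<bar>\<theta>\<bar> at most \<open>1 / 2\<close> the exponent stays
    in the range of the quadratic bound, whose remainder is at most
    \<open>4 * \<theta>\<^sup>2\<close>.\<close>
  have \<Delta>_abs: "\<bar>\<Delta> i\<bar> \<le> 2 * \<bar>\<theta>\<bar>" for i
    unfolding \<Delta> using \<kappa> by (auto simp: abs_if)
  have each: "Q a (y n) i * (exp (\<Delta> i) - 1) \<le> Q a (y n) i * \<Delta> i + \<bar>Q a (y n) i\<bar> * (4 * \<theta>\<^sup>2)" if i: "i \<in> SS" for i
  proof (cases "i = y n")
    case True then show ?thesis by (simp add: \<Delta>)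
  next
    case False
    have q: "0 \<le> Q a (y n) i" using generator_onD(2)[OF Ga yn i] False by auto
    have "\<bar>\<Delta> i\<bar>\<^sup>2 \<le> (2 * \<bar>\<theta>\<bar>)\<^sup>2" using \<Delta>_abs by (intro power_mono) auto
    then have "(\<Delta> i)\<^sup>2 \<le> 4 * \<theta>\<^sup>2" by (simp add: power_mult_distrib)
    moreover have "exp (\<Delta> i) \<le> 1 + \<Delta> i + (\<Delta> i)\<^sup>2"
      using \<Delta>_abs[of i] \<theta> by (intro exp_le_quadratic) linarith
    ultimately have "Q a (y n) i * (exp (\<Delta> i) - 1) \<le> Q a (y n) i * (\<Delta> i + 4 * \<theta>\<^sup>2)"
      using q by (intro mult_left_mono) auto
    then show ?thesis using q by (simp add: distrib_left)
  qed
  have lin: "(\<Sum>i\<in>SS. Q a (y n) i * \<Delta> i) \<le> \<theta> * Q a (y n) j + \<kappa> * rate"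
  proof -
    have e1: "apply_on SS (Q a) (\<lambda>i. if i = j then 1 else 0) (y n) = Q a (y n) j"
      unfolding apply_on_def using j by (simp add: if_distrib cong: if_cong)
    have e2: "apply_on SS (Q a) (\<lambda>i. (if i = x n then 0 else 1)) (y n) = - Q a (y n) (x n)"
    proof -
      have "apply_on SS (Q a) (\<lambda>i. (if i = x n then 0 else 1)) (y n) = apply_on SS (Q a) (\<lambda>i. 1 - (if i = x n then 1 else 0)) (y n)"
        by (rule apply_on_cong) simp
      also have "\<dots> = 0 - apply_on SS (Q a) (\<lambda>i. if i = x n then 1 else 0) (y n)"
        unfolding apply_on_diff generator_apply_const[OF Ga yn] ..
      also have "apply_on SS (Q a) (\<lambda>i. if i = x n then 1 else 0) (y n) = Q a (y n) (x n)"
        unfolding apply_on_def using xn by (simp add: if_distrib cong: if_cong)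
      finally show ?thesis by simp
    qed
    have "(\<Sum>i\<in>SS. Q a (y n) i * \<Delta> i) = apply_on SS (Q a) \<Delta> (y n)" by (simp add: apply_on_def)
    also have "\<dots> = apply_on SS (Q a) (\<lambda>i. \<theta> * ((if i = j then 1 else 0) - (if y n = j then 1 else 0))
                    + \<kappa> * ((if i = x n then 0 else 1) - (if y n = x n then 0 else 1))) (y n)"
      by (rule apply_on_cong) (rule \<Delta>)
    also have "\<dots> = \<theta> * Q a (y n) j + \<kappa> * (- Q a (y n) (x n))"
      unfolding apply_on_add apply_on_cmult apply_on_shift[OF Ga yn] e1 e2 ..
    also have "\<dots> \<le> \<theta> * Q a (y n) j + \<kappa> * rate"
      using Q_le_rate[OF yn xn a] \<kappa> by (intro add_left_mono mult_left_mono) (auto simp: abs_le_iff)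
    finally show ?thesis .
  qed
  have "(\<Sum>i\<in>SS. Q a (y n) i * (exp (\<Delta> i) - 1)) \<le> (\<Sum>i\<in>SS. Q a (y n) i * \<Delta> i + \<bar>Q a (y n) i\<bar> * (4 * \<theta>\<^sup>2))"
    by (intro sum_mono each)
  also have "\<dots> = (\<Sum>i\<in>SS. Q a (y n) i * \<Delta> i) + (\<Sum>i\<in>SS. \<bar>Q a (y n) i\<bar>) * (4 * \<theta>\<^sup>2)"
    by (simp add: sum.distrib sum_distrib_right)
  also have "\<dots> \<le> (\<theta> * Q a (y n) j + \<kappa> * rate) + rate * (4 * \<theta>\<^sup>2)"
    using lin row_le_rate[OF yn a] by (intro add_mono mult_right_mono) auto
  finally show ?thesis by (simp add: mult_ac)
qed

lemma exp_moment_bound: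
  assumes x: "x \<in> JS" and j: "j \<in> SS" and \<theta>: "\<bar>\<theta>\<bar> \<le> 1 / 2" and \<delta>: "0 \<le> \<delta>" "lip * \<delta> \<le> 1"
  shows "Pt \<delta> (\<lambda>y. exp (\<theta> * count_state N y j)) x
    \<le> exp (\<theta> * count_state N x j + real N * \<delta> * (\<theta> * drift (emp N x) j + \<bar>\<theta>\<bar> * lip * \<delta> * rate + 4 * \<theta>\<^sup>2 * rate))"
proof -
  \<comment> \<open>Per bandit and unit time: the drift frozen at \<open>x\<close>, the growth of
    the mismatch term at its largest coefficient, and the second-order remainder of the
    exponential.\<close>
  define c where "c = \<theta> * drift (emp N x) j + \<bar>\<theta>\<bar> * lip * \<delta> * rate + 4 * \<theta>\<^sup>2 * rate"
  \<comment> \<open>The time derivative of the mismatch coefficient is exactly what is needed to pay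
    for replacing the drift at \<open>y\<close> by the drift at \<open>x\<close>. The extra factor
    equals 1 at \<open>t = 0\<close>, and also at \<open>y = x\<close>, so it leaves no trace in the
    conclusion.\<close>
  define u where "u t y = exp (\<theta> * count_state N y j + \<bar>\<theta>\<bar> * lip * t * mismatch N x y + real N * t * c)" for t y
  have "apply_on JS (trans_fun JS G \<delta>) (u 0) x \<le> u \<delta> x"
  proof (rule trans_fun_supersolution[OF finite_joint_states \<delta>(1) x])
    fix t y assume t: "0 \<le> t" "t \<le> \<delta>" and y: "y \<in> JS"
    show "0 \<le> trans_fun JS G t x y" by (rule trans_fun_nonneg[OF generator x y t(1)])
    show "((\<lambda>t. u t y) has_real_derivative u t y * (\<bar>\<theta>\<bar> * lip * mismatch N x y + real N * c)) (at t)"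
      unfolding u_def by (auto intro!: derivative_eq_intros)
    define \<kappa> where "\<kappa> = \<bar>\<theta>\<bar> * lip * t"
    have \<kappa>0: "0 \<le> \<kappa>" using lip_nonneg t by (simp add: \<kappa>_def)
    have "lip * t \<le> lip * \<delta>" using t lip_nonneg by (intro mult_left_mono) auto
    then have \<kappa>1: "\<kappa> \<le> \<bar>\<theta>\<bar>" and \<kappa>2: "\<kappa> \<le> \<bar>\<theta>\<bar> * lip * \<delta>"
      using \<delta> mult_left_mono[of "lip * t" "lip * \<delta>" "\<bar>\<theta>\<bar>"] mult_left_mono[of "lip * t" 1 "\<bar>\<theta>\<bar>"] by (auto simp: \<kappa>_def mult.assoc)
    define D where "D n i = \<theta> * ((if i = j then 1 else 0) - (if y n = j then 1 else 0))
                    + \<kappa> * ((if i = x n then 0 else 1) - (if y n = x n then 0 else 1))" for n i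
    have ratio: "u t (y(n := i)) - u t y = u t y * (exp (D n i) - 1)" if n: "n < N" for n i
    proof -
      have 1: "count_state N (y(n := i)) j = count_state N y j + ((if i = j then 1 else 0) - (if y n = j then 1 else 0))"
        unfolding count_state_sum by (rule sum_upd[OF n, of "\<lambda>k z. if z = j then 1 else 0"])
      have 2: "mismatch N x (y(n := i)) = mismatch N x y + ((if i = x n then 0 else 1) - (if y n = x n then 0 else 1))"
        unfolding mismatch_def by (rule sum_upd[OF n, of "\<lambda>k z. if z = x k then 0 else 1"])
      have "u t (y(n := i)) = u t y * exp (D n i)"
        unfolding u_def 1 2 D_def \<kappa>_def exp_add[symmetric] by (rule arg_cong[of _ _ exp]) (simp only: algebra_simps)
      then show ?thesis by (simp add: algebra_simps)
    qed
    have up: "0 < u t y" by (simp add: u_def)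
    have "apply_on JS G (u t) y = (\<Sum>n<N. \<Sum>i\<in>SS. Q (act (Act y) n) (y n) i * (u t y * (exp (D n i) - 1)))"
      unfolding apply_G[OF y]
    proof (intro sum.cong refl)
      fix n i assume "n \<in> {..<N}"
      then have n: "n < N" by simp
      show "Q (act (Act y) n) (y n) i * (u t (y(n := i)) - u t y) = Q (act (Act y) n) (y n) i * (u t y * (exp (D n i) - 1))"
        unfolding ratio[OF n] ..
    qed
    also have "\<dots> = u t y * (\<Sum>n<N. \<Sum>i\<in>SS. Q (act (Act y) n) (y n) i * (exp (D n i) - 1))"
      by (simp add: sum_distrib_left mult_ac)
    finally have gen_u: "apply_on JS G (u t) y = u t y * (\<Sum>n<N. \<Sum>i\<in>SS. Q (act (Act y) n) (y n) i * (exp (D n i) - 1))" .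
    have "(\<Sum>n<N. \<Sum>i\<in>SS. Q (act (Act y) n) (y n) i * (exp (D n i) - 1))
       \<le> (\<Sum>n<N. \<theta> * Q (act (Act y) n) (y n) j + \<kappa> * rate + 4 * \<theta>\<^sup>2 * rate)"
    proof (intro sum_mono)
      fix n assume "n \<in> {..<N}"
      then have n: "n < N" by simp
      show "(\<Sum>i\<in>SS. Q (act (Act y) n) (y n) i * (exp (D n i) - 1)) \<le> \<theta> * Q (act (Act y) n) (y n) j + \<kappa> * rate + 4 * \<theta>\<^sup>2 * rate"
        by (rule single_jump_bound[where x = x, OF y n j joint_statesD[OF x n] \<theta> \<kappa>0 \<kappa>1 act_cases D_def])
    qed
    also have "\<dots> = \<theta> * (\<Sum>n<N. Q (act (Act y) n) (y n) j) + real N * (\<kappa> * rate + 4 * \<theta>\<^sup>2 * rate)"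
      by (simp add: sum.distrib sum_distrib_left algebra_simps)
    also have "\<dots> = \<theta> * (real N * drift (emp N y) j) + real N * (\<kappa> * rate + 4 * \<theta>\<^sup>2 * rate)"
      unfolding wip_drift[OF y N K wipD[OF y]] ..
    finally have 1: "(\<Sum>n<N. \<Sum>i\<in>SS. Q (act (Act y) n) (y n) i * (exp (D n i) - 1))
      \<le> \<theta> * (real N * drift (emp N y) j) + real N * (\<kappa> * rate + 4 * \<theta>\<^sup>2 * rate)" .
    have 2: "\<theta> * (real N * drift (emp N y) j) \<le> \<theta> * (real N * drift (emp N x) j) + \<bar>\<theta>\<bar> * lip * mismatch N x y"
    proof -
      have "\<bar>drift (emp N y) j - drift (emp N x) j\<bar> \<le> lip * (mismatch N x y / real N)"
        by (rule drift_lipschitz[OF emp_mismatch[OF N] j])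
      then have "\<bar>\<theta>\<bar> * real N * \<bar>drift (emp N y) j - drift (emp N x) j\<bar> \<le> \<bar>\<theta>\<bar> * real N * (lip * (mismatch N x y / real N))"
        by (intro mult_left_mono) auto
      also have "\<dots> = \<bar>\<theta>\<bar> * lip * mismatch N x y" using N by simp
      finally have "\<bar>\<theta> * real N * (drift (emp N y) j - drift (emp N x) j)\<bar> \<le> \<bar>\<theta>\<bar> * lip * mismatch N x y"
        by (simp add: abs_mult)
      then have "\<theta> * real N * (drift (emp N y) j - drift (emp N x) j) \<le> \<bar>\<theta>\<bar> * lip * mismatch N x y"
        by (rule order_trans[OF abs_ge_self])
      then show ?thesis by (simp add: algebra_simps)
    qed
    have 3: "real N * (\<kappa> * rate + 4 * \<theta>\<^sup>2 * rate) \<le> real N * (\<bar>\<theta>\<bar> * lip * \<delta> * rate + 4 * \<theta>\<^sup>2 * rate)"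
      using \<kappa>2 rate_pos by (intro mult_left_mono add_right_mono mult_right_mono) auto
    have "apply_on JS G (u t) y \<le> u t y * (\<theta> * (real N * drift (emp N x) j) + \<bar>\<theta>\<bar> * lip * mismatch N x y
        + real N * (\<bar>\<theta>\<bar> * lip * \<delta> * rate + 4 * \<theta>\<^sup>2 * rate))"
      unfolding gen_u by (rule mult_left_mono) (use 1 2 3 up in linarith)+
    then show "apply_on JS G (u t) y \<le> u t y * (\<bar>\<theta>\<bar> * lip * mismatch N x y + real N * c)"
      by (simp add: c_def algebra_simps)
  qed
  moreover have "u 0 = (\<lambda>y. exp (\<theta> * count_state N y j))" by (rule ext) (simp add: u_def)
  moreover have "u \<delta> x = exp (\<theta> * count_state N x j + real N * \<delta> * c)" by (simp add: u_def mismatch_def)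
  ultimately show ?thesis by (simp add: c_def)
qed

text \<open>Exponential Markov inequality; the sign of \<theta> selects the tail.\<close>

lemma one_sided_deviation:
  assumes x: "x \<in> JS" and j: "j \<in> SS" and \<theta>: "\<bar>\<theta>\<bar> \<le> 1 / 2" "16 * rate * \<bar>\<theta>\<bar> \<le> \<eta>"
    and \<delta>: "0 \<le> \<delta>" "lip * \<delta> \<le> 1" "4 * lip * rate * \<delta> \<le> \<eta>"
  shows "Pt \<delta> (\<lambda>y. if \<bar>\<theta>\<bar> * \<eta> * \<delta> \<le> \<theta> * (emp N y j - emp N x j - \<delta> * drift (emp N x) j) then 1 else 0) x
    \<le> exp (- (\<delta> * \<bar>\<theta>\<bar> * \<eta> / 2) * real N)"
proof -
  define c where "c = - \<theta> * count_state N x j - real N * \<delta> * \<theta> * drift (emp N x) j - real N * \<bar>\<theta>\<bar> * \<eta> * \<delta>"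
  have cs: "count_state N y j = real N * emp N y j" for y using N by (simp add: emp_def)
  have "Pt \<delta> (\<lambda>y. if \<bar>\<theta>\<bar> * \<eta> * \<delta> \<le> \<theta> * (emp N y j - emp N x j - \<delta> * drift (emp N x) j) then 1 else 0) x
      \<le> Pt \<delta> (\<lambda>y. exp c * exp (\<theta> * count_state N y j)) x"
  proof (rule semigroup_mono[OF generator \<delta>(1) x])
    fix y
    have eq: "c + \<theta> * count_state N y j = real N * (\<theta> * (emp N y j - emp N x j - \<delta> * drift (emp N x) j) - \<bar>\<theta>\<bar> * \<eta> * \<delta>)"
      unfolding c_def cs by (simp add: algebra_simps)
    show "(if \<bar>\<theta>\<bar> * \<eta> * \<delta> \<le> \<theta> * (emp N y j - emp N x j - \<delta> * drift (emp N x) j) then 1 else 0) \<le> exp c * exp (\<theta> * count_state N y j)"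
      unfolding exp_add[symmetric] eq by simp
  qed
  also have "\<dots> \<le> exp c * exp (\<theta> * count_state N x j + real N * \<delta> * (\<theta> * drift (emp N x) j + \<bar>\<theta>\<bar> * lip * \<delta> * rate + 4 * \<theta>\<^sup>2 * rate))"
    unfolding apply_on_cmult by (intro mult_left_mono exp_moment_bound x j \<theta> \<delta>) simp
  also have "\<dots> = exp (real N * \<delta> * \<bar>\<theta>\<bar> * (lip * rate * \<delta> + 4 * rate * \<bar>\<theta>\<bar> - \<eta>))"
  proof -
    have "\<theta>\<^sup>2 = \<bar>\<theta>\<bar> * \<bar>\<theta>\<bar>" by (simp add: power2_eq_square)
    then show ?thesis unfolding exp_add[symmetric] c_def by (intro arg_cong[of _ _ exp]) (simp only: algebra_simps)
  qed
  also have "\<dots> \<le> exp (- (\<delta> * \<bar>\<theta>\<bar> * \<eta> / 2) * real N)"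
  proof -
    \<comment> \<open>The two smallness assumptions cost at most \<eta>\<open>/ 4\<close> each,
      which leaves half of the gain \<eta>.\<close>
    have "lip * rate * \<delta> + 4 * rate * \<bar>\<theta>\<bar> - \<eta> \<le> - \<eta> / 2" using \<theta>(2) \<delta>(3) by linarith
    then have "real N * \<delta> * \<bar>\<theta>\<bar> * (lip * rate * \<delta> + 4 * rate * \<bar>\<theta>\<bar> - \<eta>) \<le> real N * \<delta> * \<bar>\<theta>\<bar> * (- \<eta> / 2)"
      using \<delta>(1) by (intro mult_left_mono) auto
    then show ?thesis by (simp add: mult_ac)
  qed
  finally show ?thesis .
qed

text \<open>Union bound over \<open>d\<close> coordinates and two signs.\<close>

lemma step_deviation:
  assumes x: "x \<in> JS" and \<theta>: "0 < \<theta>" "\<theta> \<le> 1 / 2" "16 * rate * \<theta> \<le> \<eta>"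
    and \<delta>: "0 \<le> \<delta>" "lip * \<delta> \<le> 1" "4 * lip * rate * \<delta> \<le> \<eta>"
  shows "Pt \<delta> (\<lambda>y. if \<exists>j\<in>SS. \<eta> * \<delta> < \<bar>emp N y j - emp N x j - \<delta> * drift (emp N x) j\<bar> then 1 else 0) x
    \<le> 2 * real d * exp (- (\<delta> * \<theta> * \<eta> / 2) * real N)"
proof -
  let ?e = "\<lambda>y j. emp N y j - emp N x j - \<delta> * drift (emp N x) j"
  let ?i = "\<lambda>\<theta> j y. if \<bar>\<theta>\<bar> * \<eta> * \<delta> \<le> \<theta> * ?e y j then 1 else (0::real)"
  have "Pt \<delta> (\<lambda>y. if \<exists>j\<in>SS. \<eta> * \<delta> < \<bar>?e y j\<bar> then 1 else 0) x \<le> Pt \<delta> (\<lambda>y. \<Sum>j\<in>SS. ?i \<theta> j y + ?i (- \<theta>) j y) x"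
  proof (rule semigroup_mono[OF generator \<delta>(1) x])
    fix y
    show "(if \<exists>j\<in>SS. \<eta> * \<delta> < \<bar>?e y j\<bar> then 1 else 0) \<le> (\<Sum>j\<in>SS. ?i \<theta> j y + ?i (- \<theta>) j y)"
    proof (cases "\<exists>j\<in>SS. \<eta> * \<delta> < \<bar>?e y j\<bar>")
      case True
      then obtain j where j: "j \<in> SS" "\<eta> * \<delta> < \<bar>?e y j\<bar>" by blast
      have "\<theta> * (\<eta> * \<delta>) \<le> \<theta> * \<bar>?e y j\<bar>" using j(2) \<theta>(1) by (intro mult_left_mono) auto
      moreover have "\<bar>\<theta>\<bar> * \<eta> * \<delta> \<le> \<theta> * e \<or> \<bar>- \<theta>\<bar> * \<eta> * \<delta> \<le> (- \<theta>) * e" if "\<theta> * (\<eta> * \<delta>) \<le> \<theta> * \<bar>e\<bar>" for e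
        using that \<theta>(1) by (cases "0 \<le> e") (simp_all add: mult.assoc)
      ultimately have "\<bar>\<theta>\<bar> * \<eta> * \<delta> \<le> \<theta> * ?e y j \<or> \<bar>- \<theta>\<bar> * \<eta> * \<delta> \<le> (- \<theta>) * ?e y j" by blast
      then have "1 \<le> ?i \<theta> j y + ?i (- \<theta>) j y" by (elim disjE) simp_all
      also have "\<dots> \<le> (\<Sum>j\<in>SS. ?i \<theta> j y + ?i (- \<theta>) j y)"
        using j(1) by (intro member_le_sum[where f = "\<lambda>j. ?i \<theta> j y + ?i (- \<theta>) j y"]) auto
      finally show ?thesis using True by simp
    qed (auto intro: sum_nonneg)
  qed
  also have "\<dots> = (\<Sum>j\<in>SS. Pt \<delta> (?i \<theta> j) x + Pt \<delta> (?i (- \<theta>) j) x)"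
  proof -
    have "Pt \<delta> (\<lambda>y. \<Sum>j\<in>SS. ?i \<theta> j y + ?i (- \<theta>) j y) x = (\<Sum>y\<in>JS. \<Sum>j\<in>SS. trans_fun JS G \<delta> x y * (?i \<theta> j y + ?i (- \<theta>) j y))"
      by (simp only: apply_on_def sum_distrib_left)
    also have "\<dots> = (\<Sum>j\<in>SS. Pt \<delta> (\<lambda>y. ?i \<theta> j y + ?i (- \<theta>) j y) x)"
      unfolding apply_on_def by (rule sum.swap)
    finally show ?thesis by (simp only: apply_on_add)
  qed
  also have "\<dots> \<le> (\<Sum>j\<in>SS. 2 * exp (- (\<delta> * \<theta> * \<eta> / 2) * real N))"
  proof (intro sum_mono)
    fix j assume j: "j \<in> SS"
    show "Pt \<delta> (?i \<theta> j) x + Pt \<delta> (?i (- \<theta>) j) x \<le> 2 * exp (- (\<delta> * \<theta> * \<eta> / 2) * real N)"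
      using one_sided_deviation[OF x j, of \<theta> \<eta> \<delta>] one_sided_deviation[OF x j, of "- \<theta>" \<eta> \<delta>] \<theta> \<delta> by simp
  qed
  also have "\<dots> = 2 * real d * exp (- (\<delta> * \<theta> * \<eta> / 2) * real N)" by simp
  finally show ?thesis .
qed

text \<open>The Markov property lets the error bounds of the Euler scheme be iterated step by step; no
  path space is needed.\<close>

lemma flow_deviation:
  assumes x: "x \<in> JS" and \<theta>: "0 < \<theta>" "\<theta> \<le> 1 / 2" "16 * rate * \<theta> \<le> \<eta>"
    and \<delta>: "0 \<le> \<delta>" "lip * \<delta> \<le> 1" "4 * lip * rate * \<delta> \<le> \<eta>"
    and X: "ode_traj d Q \<alpha> (emp N x) X" "admissible X"
  shows "Pt (real k * \<delta>) (\<lambda>y. if \<exists>j\<in>SS. 2 * \<eta> * (real k * \<delta>) * exp (lip * (real k * \<delta>)) < \<bar>emp N y j - X (real k * \<delta>) j\<bar> then 1 else 0) x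
    \<le> real k * (2 * real d * exp (- (\<delta> * \<theta> * \<eta> / 2) * real N))"
proof (induction k)
  case 0
  have "Pt 0 f x = f x" for f
    using x finite_joint_states[of N d] by (simp add: apply_on_def trans_fun_0 if_zero_mult)
  then show ?case using X(1) by (auto simp: ode_traj_def)
next
  case (Suc k)
  define b where "b = 2 * real d * exp (- (\<delta> * \<theta> * \<eta> / 2) * real N)"
  have b0: "0 \<le> b" by (simp add: b_def)
  let ?t = "real k * \<delta>"
  let ?r = "\<lambda>t. 2 * \<eta> * t * exp (lip * t)"
  let ?bad = "\<lambda>t y. if \<exists>j\<in>SS. ?r t < \<bar>emp N y j - X t j\<bar> then 1 else (0::real)"
  let ?step = "\<lambda>z y. if \<exists>j\<in>SS. \<eta> * \<delta> < \<bar>emp N y j - emp N z j - \<delta> * drift (emp N z) j\<bar> then 1 else (0::real)"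
  have t: "0 \<le> ?t" using \<delta> by simp
  have St: "real (Suc k) * \<delta> = ?t + \<delta>" by (simp add: algebra_simps)
  have \<eta>: "0 \<le> \<eta>"
  proof -
    have "0 \<le> 16 * rate * \<theta>" using rate_pos \<theta>(1) by simp
    then show ?thesis using \<theta>(3) by linarith
  qed
  \<comment> \<open>Discrete Gronwall estimate. The factor 2 in the radius covers two errors of at
    most \<eta>\<delta> per step: the random deviation and the discretization error of the
    ODE.\<close>
  have r: "(1 + lip * \<delta>) * ?r ?t + \<eta> * \<delta> + lip * rate * \<delta> * \<delta> \<le> ?r (?t + \<delta>)"
  proof -
    have e1: "1 + lip * \<delta> \<le> exp (lip * \<delta>)" by (rule exp_ge_add_one_self)
    have "(1 + lip * \<delta>) * ?r ?t \<le> exp (lip * \<delta>) * ?r ?t"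
      using e1 \<eta> t by (intro mult_right_mono) auto
    also have "\<dots> = 2 * \<eta> * ?t * exp (lip * (?t + \<delta>))" by (simp add: distrib_left exp_add)
    finally have 1: "(1 + lip * \<delta>) * ?r ?t \<le> 2 * \<eta> * ?t * exp (lip * (?t + \<delta>))" .
    have "lip * rate * \<delta> \<le> \<eta>"
    proof -
      have "0 \<le> lip * rate * \<delta>" using lip_nonneg rate_pos \<delta> by simp
      then show ?thesis using \<delta>(3) by linarith
    qed
    then have "lip * rate * \<delta> * \<delta> \<le> \<eta> * \<delta>" using \<delta> by (intro mult_right_mono) auto
    then have "\<eta> * \<delta> + lip * rate * \<delta> * \<delta> \<le> 2 * \<eta> * \<delta> * 1" by linarith
    also have "\<dots> \<le> 2 * \<eta> * \<delta> * exp (lip * (?t + \<delta>))"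
      using \<eta> \<delta> t lip_nonneg by (intro mult_left_mono) auto
    finally have 2: "\<eta> * \<delta> + lip * rate * \<delta> * \<delta> \<le> 2 * \<eta> * \<delta> * exp (lip * (?t + \<delta>))" .
    have "?r (?t + \<delta>) = 2 * \<eta> * ?t * exp (lip * (?t + \<delta>)) + 2 * \<eta> * \<delta> * exp (lip * (?t + \<delta>))"
      by (simp only: algebra_simps)
    then show ?thesis using 1 2 by linarith
  qed
  \<comment> \<open>If \<open>z\<close> has already left the tube, its indicator pays for
    everything. Otherwise leaving it during the next step forces a one-step deviation, whose
    probability is at most \<open>b\<close> from every \<open>z\<close>.\<close>
  have one: "Pt \<delta> (?bad (?t + \<delta>)) z \<le> ?bad ?t z + b" if z: "z \<in> JS" for z
  proof (cases "\<exists>j\<in>SS. ?r ?t < \<bar>emp N z j - X ?t j\<bar>")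
    case True
    have "Pt \<delta> (?bad (?t + \<delta>)) z \<le> 1" by (rule semigroup_le_const[OF generator \<delta>(1) z]) simp
    then show ?thesis using True b0 by simp
  next
    case False
    then have close: "\<bar>emp N z i - X ?t i\<bar> \<le> ?r ?t" if "i \<in> SS" for i using that by force
    have "Pt \<delta> (?bad (?t + \<delta>)) z \<le> Pt \<delta> (?step z) z"
    proof (rule semigroup_mono[OF generator \<delta>(1) z])
      fix y
      have "\<bar>emp N y j - X (?t + \<delta>) j\<bar> \<le> ?r (?t + \<delta>)"
        if s: "\<And>j. j \<in> SS \<Longrightarrow> \<bar>emp N y j - emp N z j - \<delta> * drift (emp N z) j\<bar> \<le> \<eta> * \<delta>" and j: "j \<in> SS" for j
      proof -
        have "\<bar>X (?t + \<delta>) j - X ?t j - \<delta> * drift (X ?t) j\<bar> \<le> lip * rate * \<delta> * \<delta>"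
          by (rule trajectory_step[OF X j t \<delta>(1)])
        moreover have "\<bar>\<delta> * drift (emp N z) j - \<delta> * drift (X ?t) j\<bar> \<le> lip * \<delta> * ?r ?t"
        proof -
          have "\<bar>drift (emp N z) j - drift (X ?t) j\<bar> \<le> lip * ?r ?t"
            by (rule drift_lipschitz[OF close j])
          then have "\<delta> * \<bar>drift (emp N z) j - drift (X ?t) j\<bar> \<le> \<delta> * (lip * ?r ?t)"
            using \<delta>(1) by (rule mult_left_mono)
          then show ?thesis using \<delta>(1) by (simp add: right_diff_distrib[symmetric] abs_mult mult_ac)
        qed
        moreover note s[OF j] close[OF j]
        ultimately have "\<bar>emp N y j - X (?t + \<delta>) j\<bar> \<le> ?r ?t + lip * \<delta> * ?r ?t + \<eta> * \<delta> + lip * rate * \<delta> * \<delta>"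
          by linarith
        also have "\<dots> = (1 + lip * \<delta>) * ?r ?t + \<eta> * \<delta> + lip * rate * \<delta> * \<delta>" by (simp only: algebra_simps)
        finally show ?thesis using r by linarith
      qed
      then show "?bad (?t + \<delta>) y \<le> ?step z y" by (force simp: not_less)
    qed
    also have "\<dots> \<le> b" unfolding b_def by (rule step_deviation[OF z \<theta> \<delta>])
    finally show ?thesis using False by simp
  qed
  have "Pt (?t + \<delta>) (?bad (?t + \<delta>)) x = Pt ?t (Pt \<delta> (?bad (?t + \<delta>))) x"
    by (rule semigroup_apply[OF generator t x])
  also have "\<dots> \<le> Pt ?t (\<lambda>z. ?bad ?t z + b) x"
    by (rule semigroup_mono[OF generator t x one])
  also have "\<dots> = Pt ?t (?bad ?t) x + b"
    unfolding apply_on_add semigroup_const[OF generator t x] ..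
  also have "\<dots> \<le> real k * b + b" using Suc.IH by (simp add: b_def)
  finally show ?case unfolding St b_def[symmetric] by (simp add: algebra_simps)
qed

end

lemma (in mean_field) attractor_concentration:
  assumes attr: "uniform_global_attractor d Q \<alpha> mstar" and \<epsilon>: "0 < \<epsilon>"
  shows "\<exists>T b c. 0 \<le> T \<and> 0 < b \<and> 0 < c \<and>
    (\<forall>N K Act x. 0 < N \<longrightarrow> real K = \<alpha> * real N \<longrightarrow> wip_policy N d K Act \<longrightarrow> x \<in> joint_states N d \<longrightarrow>
      apply_on (joint_states N d) (trans_fun (joint_states N d) (det_gen N d Q Act) T)
        (\<lambda>y. if \<exists>j\<in>SS. \<epsilon> < \<bar>emp N y j - mstar j\<bar> then 1 else 0) x \<le> b * exp (- c * real N))"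
proof -
  obtain T0 where T0: "\<And>m x t. m \<in> prob_simplex d \<Longrightarrow> ode_traj d Q \<alpha> m x \<Longrightarrow> T0 \<le> t \<Longrightarrow> supdist d (x t) mstar \<le> \<epsilon> / 2"
    using attr \<epsilon> unfolding uniform_global_attractor_def by (metis half_gt_zero)
  define T where "T = max T0 1"
  have T: "1 \<le> T" "T0 \<le> T" by (auto simp: T_def)
  define E where "E = T * exp (lip * T)"
  have E: "0 < E" using T by (simp add: E_def)
  \<comment> \<open>Makes the tube radius at time \<open>T\<close> equal to
    \<epsilon>\<open>/ 2\<close>; the attractor supplies the other half.\<close>
  define \<eta> where "\<eta> = \<epsilon> / (4 * E)"
  have \<eta>: "0 < \<eta>" "2 * \<eta> * E = \<epsilon> / 2" using \<epsilon> E by (auto simp: \<eta>_def)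
  define \<theta> where "\<theta> = min (1 / 2) (\<eta> / (16 * rate))"
  have "\<theta> \<le> \<eta> / (16 * rate)" by (simp add: \<theta>_def)
  then have "16 * rate * \<theta> \<le> \<eta>" using rate_pos by (simp add: pos_le_divide_eq mult_ac)
  moreover have "0 < \<theta>" "\<theta> \<le> 1 / 2" using \<eta> rate_pos by (auto simp: \<theta>_def)
  ultimately have \<theta>: "0 < \<theta>" "\<theta> \<le> 1 / 2" "16 * rate * \<theta> \<le> \<eta>" by blast+
  \<comment> \<open>The three summands give the two bounds on the step
    \<delta>\<open>= T / k\<close> and, as \<open>T\<close> is at least 1, the positivity of
    \<open>k\<close>. Neither \<open>k\<close> nor \<delta> depends on \<open>N\<close>.\<close>
  obtain k :: nat where k: "T * (lip + 4 * lip * rate / \<eta> + 1) \<le> real k"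
    using real_arch_simple by blast
  have k_parts: "0 \<le> T * lip" "0 \<le> T * (4 * lip * rate / \<eta>)" "1 \<le> T * 1"
    using T lip_nonneg rate_pos \<eta> by auto
  have k3: "T * lip \<le> real k" "T * (4 * lip * rate / \<eta>) \<le> real k" "1 \<le> real k"
    using k k_parts unfolding distrib_left by linarith+
  define \<delta> where "\<delta> = T / real k"
  have k\<delta>: "real k * \<delta> = T" using k3 by (simp add: \<delta>_def)
  have \<delta>0: "0 < \<delta>" using T k3 by (simp add: \<delta>_def)
  have \<delta>: "0 \<le> \<delta>" "lip * \<delta> \<le> 1" "4 * lip * rate * \<delta> \<le> \<eta>"
    using \<delta>0 k3 \<eta> T by (auto simp: \<delta>_def field_simps)
  show ?thesis
  proof (rule exI[of _ T], rule exI[of _ "real k * (2 * real d)"], rule exI[of _ "\<delta> * \<theta> * \<eta> / 2"], intro conjI allI impI)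
    show "0 \<le> T" "0 < real k * (2 * real d)" "0 < \<delta> * \<theta> * \<eta> / 2" using T k3 d \<delta>0 \<theta> \<eta> by auto
    fix N K Act x
    assume N: "0 < N" and K: "real K = \<alpha> * real N" and wip: "wip_policy N d K Act" and x: "x \<in> joint_states N d"
    interpret wip_chain d Q R \<alpha> N K Act by unfold_locales (rule N K wip)+
    obtain X where X: "ode_traj d Q \<alpha> (emp N x) X" "admissible X"
      using trajectory_exists[OF emp_simplex[OF x N]] by blast
    have sup: "\<bar>X T j - mstar j\<bar> \<le> \<epsilon> / 2" if "j \<in> SS" for j
    proof -
      have "\<bar>X T j - mstar j\<bar> \<le> supdist d (X T) mstar"
        unfolding supdist_def using that by (intro Max_ge) auto
      also have "\<dots> \<le> \<epsilon> / 2" by (rule T0[OF emp_simplex[OF x N] X(1) T(2)])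
      finally show ?thesis .
    qed
    have "Pt T (\<lambda>y. if \<exists>j\<in>SS. \<epsilon> < \<bar>emp N y j - mstar j\<bar> then 1 else 0) x
      \<le> Pt T (\<lambda>y. if \<exists>j\<in>SS. 2 * \<eta> * T * exp (lip * T) < \<bar>emp N y j - X T j\<bar> then 1 else 0) x"
    proof (rule semigroup_mono[OF generator _ x])
      show "0 \<le> T" using T by simp
      fix y
      have e2: "2 * \<eta> * T * exp (lip * T) = \<epsilon> / 2" using \<eta>(2) by (simp add: E_def)
      have "2 * \<eta> * T * exp (lip * T) < \<bar>emp N y j - X T j\<bar>" if "j \<in> SS" "\<epsilon> < \<bar>emp N y j - mstar j\<bar>" for j
        using sup[OF that(1)] that(2) unfolding e2 by linarith
      then show "(if \<exists>j\<in>SS. \<epsilon> < \<bar>emp N y j - mstar j\<bar> then 1 else (0::real))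
          \<le> (if \<exists>j\<in>SS. 2 * \<eta> * T * exp (lip * T) < \<bar>emp N y j - X T j\<bar> then 1 else 0)"
        by (simp only: split: if_split) (blast intro: zero_le_one order_refl)
    qed
    also have "\<dots> \<le> real k * (2 * real d * exp (- (\<delta> * \<theta> * \<eta> / 2) * real N))"
      using flow_deviation[OF x \<theta> \<delta> X, of k] unfolding k\<delta> .
    finally show "Pt T (\<lambda>y. if \<exists>j\<in>SS. \<epsilon> < \<bar>emp N y j - mstar j\<bar> then 1 else 0) x
      \<le> real k * (2 * real d) * exp (- (\<delta> * \<theta> * \<eta> / 2) * real N)" by (simp only: mult.assoc)
  qed
qed

section \<open>Value of the index policy\<close>

text \<open>Hence both actions occur only in state \<open>s\<close>, where both are optimal.\<close>

lemma (in wip_chain) wip_threshold: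
  assumes y: "y \<in> JS" and close: "\<And>j. j \<in> SS \<Longrightarrow> \<bar>emp N y j - m j\<bar> \<le> \<epsilon>"
    and s: "s \<in> SS" and \<epsilon>: "0 \<le> \<epsilon>" "cum m (s - 1) + real d * \<epsilon> < \<alpha>" "\<alpha> < cum m s - real d * \<epsilon>" and n: "n < N"
  shows "n \<in> Act y \<Longrightarrow> y n \<le> s" "n \<notin> Act y \<Longrightarrow> s \<le> y n"
proof -
  have finA: "finite (Act y)" by (rule finite_subset[OF wipD(1)[OF y] finite_lessThan])
  have "\<bar>cum (emp N y) (s - 1) - cum m (s - 1)\<bar> \<le> real d * \<epsilon>" "\<bar>cum (emp N y) s - cum m s\<bar> \<le> real d * \<epsilon>"
    using s by (auto intro!: cum_lipschitz[OF close _ \<epsilon>(1)])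
  then have c: "cum (emp N y) (s - 1) < \<alpha>" "\<alpha> < cum (emp N y) s" using \<epsilon> by linarith+
  have lo: "card {n. n < N \<and> y n \<le> s - 1} < K"
  proof -
    have "real N * cum (emp N y) (s - 1) < real N * \<alpha>" using c(1) N by (intro mult_strict_left_mono) auto
    then have "real (card {n. n < N \<and> y n \<le> s - 1}) < real K" unfolding cum_emp[OF y N] K by (simp only: mult.commute)
    then show ?thesis by (simp only: of_nat_less_iff)
  qed
  have hi: "K < card {n. n < N \<and> y n \<le> s}"
  proof -
    have "real N * \<alpha> < real N * cum (emp N y) s" using c(2) N by (intro mult_strict_left_mono) auto
    then have "real K < real (card {n. n < N \<and> y n \<le> s})" unfolding cum_emp[OF y N] K by (simp only: mult.commute)
    then show ?thesis by (simp only: of_nat_less_iff)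
  qed
  show "y n \<le> s" if "n \<in> Act y"
  proof (rule ccontr)
    assume "\<not> y n \<le> s"
    then have "{n. n < N \<and> y n \<le> s} \<subseteq> Act y" using wipD(3)[OF y] that by force
    then show False using card_mono[OF finA] hi wipD(2)[OF y] by (metis leD)
  qed
  show "s \<le> y n" if "n \<notin> Act y"
  proof (rule ccontr)
    assume "\<not> s \<le> y n"
    then have "Act y \<subseteq> {n. n < N \<and> y n \<le> s - 1}" using wipD(1,3)[OF y] that n by force
    then have "card (Act y) \<le> card {n. n < N \<and> y n \<le> s - 1}" by (intro card_mono) auto
    then show False using lo wipD(2)[OF y] by simp
  qed
qed

text \<open>The part before \<open>T0\<close> is lost in the factor \<open>1 / T\<close>. At later
  times restart the chain at \<open>t - T0\<close>: the bound at time \<open>T0\<close> holds from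
  every state, hence on average.\<close>

lemma time_avg_eventual_bound:
  assumes G: "generator_on S G" and x: "x \<in> S" and T0: "0 \<le> T0" "T0 \<le> T" "0 < T"
    and f: "\<And>y. y \<in> S \<Longrightarrow> f y \<le> C" and late: "\<And>y. y \<in> S \<Longrightarrow> apply_on S (trans_fun S G T0) f y \<le> B" and B: "0 \<le> B"
  shows "time_avg S G f x T \<le> T0 * C / T + B"
proof -
  let ?p = "\<lambda>t. apply_on S (trans_fun S G t) f x"
  note int = semigroup_integrable[OF generator_onD(1)[OF G] x, of G f]
  have "integral {0..T} ?p = integral {0..T0} ?p + integral {T0..T} ?p"
    using T0 by (intro Henstock_Kurzweil_Integration.integral_combine[symmetric] int) auto
  moreover have "integral {0..T0} ?p \<le> integral {0..T0} (\<lambda>_. C)"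
    using semigroup_le_const[OF G _ x f] by (intro integral_le int) auto
  moreover have "integral {T0..T} ?p \<le> integral {T0..T} (\<lambda>_. B)"
  proof (intro integral_le int)
    fix t assume t: "t \<in> {T0..T}"
    have "?p ((t - T0) + T0) = apply_on S (trans_fun S G (t - T0)) (apply_on S (trans_fun S G T0) f) x"
      using t by (intro semigroup_apply[OF G _ x]) auto
    also have "\<dots> \<le> B" using t late by (intro semigroup_le_const[OF G _ x]) auto
    finally show "?p t \<le> B" by simp
  qed auto
  ultimately have "integral {0..T} ?p \<le> T0 * C + (T - T0) * B" using T0 by simp
  also have "\<dots> \<le> T0 * C + T * B" using T0 B by (intro add_left_mono mult_right_mono) auto
  finally have "integral {0..T} ?p / T \<le> (T0 * C + T * B) / T" using T0 by (intro divide_right_mono) auto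
  then show ?thesis using T0 by (simp add: time_avg_eq add_divide_distrib)
qed

text \<open>The Lagrangian identity read as an equality: reward plus bias drift plus suboptimality
  of the chosen actions is constant. The long-run loss is therefore the average suboptimality,
  bounded by \<open>B\<close>.\<close>

lemma (in bandit) wip_lower_bound:
  assumes opt: "\<And>i a. i \<in> SS \<Longrightarrow> a \<in> {0,1} \<Longrightarrow> qval d Q R \<nu> h a i \<le> g"
    and K: "real K = \<alpha> * real N" and wip: "wip_policy N d K Act" and x: "x \<in> joint_states N d"
    and T0: "0 \<le> T0" and B: "0 \<le> B"
    and gap: "\<And>y. y \<in> joint_states N d \<Longrightarrow> apply_on (joint_states N d) (trans_fun (joint_states N d) (det_gen N d Q Act) T0)
        (\<lambda>y. \<Sum>n<N. g - qval d Q R \<nu> h (act (Act y) n) (y n)) y \<le> B"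
    and lim: "(time_avg (joint_states N d) (det_gen N d Q Act) (det_reward N R Act) x \<longlongrightarrow> L) at_top"
  shows "real N * (g - \<nu> * (1 - \<alpha>)) - B \<le> L"
proof -
  let ?S = "joint_states N d" let ?G = "det_gen N d Q Act" let ?TA = "time_avg ?S ?G"
  let ?H = "total_bias N h"
  define gp where "gp y = (\<Sum>n<N. g - qval d Q R \<nu> h (act (Act y) n) (y n))" for y
  have G: "generator_on ?S ?G" by (rule det_gen_generator[OF gen])
  note fin = finite_joint_states
  have id: "(det_reward N R Act y + apply_on ?S ?G ?H y) + gp y = real N * (g - \<nu> * (1 - \<alpha>))" if y: "y \<in> ?S" for y
  proof -
    have A: "Act y \<subseteq> {..<N}" "card (Act y) = K" using wip y by (auto simp: wip_policy_def)
    have "apply_on ?S ?G ?H y = apply_on ?S (gen_act N d Q (Act y)) ?H y" by (simp add: apply_on_def det_gen_def)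
    then have "det_reward N R Act y + apply_on ?S ?G ?H y = (\<Sum>n<N. qval d Q R \<nu> h (act (Act y) n) (y n)) - \<nu> * (real N - real K)"
      using lagrangian[OF y A(1), of \<nu> h] by (simp add: det_reward_def A(2))
    then show ?thesis by (simp add: gp_def sum_subtractf K algebra_simps)
  qed
  define C where "C = (\<Sum>y\<in>?S. \<bar>gp y\<bar>)"
  have C: "gp y \<le> C" if "y \<in> ?S" for y
  proof -
    have "\<bar>gp y\<bar> \<le> C" unfolding C_def using fin that by (intro member_le_sum) auto
    then show ?thesis by simp
  qed
  have bound: "real N * (g - \<nu> * (1 - \<alpha>)) - (T0 * C / T + B) \<le> ?TA (det_reward N R Act) x T + ?TA (apply_on ?S ?G ?H) x T"
    if T: "max T0 1 \<le> T" for T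
  proof -
    have T': "0 < T" "T0 \<le> T" using T by auto
    have "(?TA (det_reward N R Act) x T + ?TA (apply_on ?S ?G ?H) x T) + ?TA gp x T
       = ?TA (\<lambda>y. (det_reward N R Act y + apply_on ?S ?G ?H y) + gp y) x T"
      by (simp only: time_avg_add[OF fin x])
    also have "\<dots> = ?TA (\<lambda>_. real N * (g - \<nu> * (1 - \<alpha>))) x T" by (rule time_avg_cong) (rule id)
    also have "\<dots> = real N * (g - \<nu> * (1 - \<alpha>))" by (rule time_avg_const[OF G x T'(1)])
    finally have "(?TA (det_reward N R Act) x T + ?TA (apply_on ?S ?G ?H) x T) + ?TA gp x T = real N * (g - \<nu> * (1 - \<alpha>))" .
    moreover have "?TA gp x T \<le> T0 * C / T + B"
    proof (rule time_avg_eventual_bound[OF G x T0 T'(2,1) C _ B])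
      show "apply_on ?S (trans_fun ?S ?G T0) gp y \<le> B" if "y \<in> ?S" for y
        using gap[OF that] unfolding gp_def .
    qed
    ultimately show ?thesis by linarith
  qed
  have "((\<lambda>T. T0 * C / T) \<longlongrightarrow> 0) at_top"
    by (intro tendsto_divide_0[OF tendsto_const] filterlim_at_top_imp_at_infinity filterlim_ident)
  then have "((\<lambda>T. real N * (g - \<nu> * (1 - \<alpha>)) - (T0 * C / T + B)) \<longlongrightarrow> real N * (g - \<nu> * (1 - \<alpha>)) - (0 + B)) at_top"
    by (intro tendsto_intros)
  then have "real N * (g - \<nu> * (1 - \<alpha>)) - (0 + B) \<le> L + 0"
  proof (rule tendsto_le[OF trivial_limit_at_top_linorder, rotated])
    show "((\<lambda>T. ?TA (det_reward N R Act) x T + ?TA (apply_on ?S ?G ?H) x T) \<longlongrightarrow> L + 0) at_top"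
      by (intro tendsto_add lim time_avg_generator_tendsto_0[OF G x])
    show "eventually (\<lambda>T. real N * (g - \<nu> * (1 - \<alpha>)) - (T0 * C / T + B) \<le> ?TA (det_reward N R Act) x T + ?TA (apply_on ?S ?G ?H) x T) at_top"
      by (rule eventually_at_top_linorderI[of "max T0 1"]) (rule bound)
  qed
  then show ?thesis by simp
qed

section \<open>The index policy as a competitor in the relaxed problem\<close>

lemma mpow_cong:
  assumes "\<And>x y. x \<in> S \<Longrightarrow> y \<in> S \<Longrightarrow> G x y = G' x y" "x \<in> S"
  shows "mpow S G k x y = mpow S G' k x y"
  using assms(2)
proof (induction k arbitrary: x)
  case (Suc k) then show ?case using assms(1) by simp
qed simp

text \<open>The generator of the point-mass policy and \<open>det_gen\<close> agree only on joint
  states, so their time averages have to be compared through restricted agreement.\<close>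

lemma time_avg_gen_cong:
  assumes "\<And>x y. x \<in> S \<Longrightarrow> y \<in> S \<Longrightarrow> G x y = G' x y" "x \<in> S" "\<And>y. y \<in> S \<Longrightarrow> f y = f' y"
  shows "time_avg S G f x = time_avg S G' f' x"
proof -
  have "trans_fun S G t x y = trans_fun S G' t x y" for t y
    unfolding trans_fun_def using mpow_cong[of S G G', OF assms(1,2)] by simp
  then show ?thesis using assms(3) by (intro ext) (simp add: time_avg_def)
qed

lemma wip_value_admissible:
  assumes gen: "\<And>a. a \<in> {0,1} \<Longrightarrow> generator_on {1..d} (Q a)"
    and K: "real K = \<alpha> * real N" and wip: "wip_policy N d K Act" and x: "x \<in> joint_states N d"
    and lim: "(time_avg (joint_states N d) (det_gen N d Q Act) (det_reward N R Act) x \<longlongrightarrow> L) at_top"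
  shows "\<exists>\<pi> x. stat_policy N d \<pi> \<and> x \<in> joint_states N d \<and>
        (time_avg (joint_states N d) (gen_pol N d Q \<pi>) (activation_pol N \<pi>) x \<longlongrightarrow> \<alpha> * real N) at_top \<and>
        (time_avg (joint_states N d) (gen_pol N d Q \<pi>) (reward_pol N R \<pi>) x \<longlongrightarrow> L) at_top"
proof -
  let ?S = "joint_states N d" let ?G = "det_gen N d Q Act"
  define \<pi> where "\<pi> s A = (if A = Act s then 1 else 0 :: real)" for s A
  have pick: "(\<Sum>A\<in>Pow {..<N}. \<pi> s A * f A) = f (Act s)" if "s \<in> ?S" for s and f :: "nat set \<Rightarrow> real"
  proof -
    have "Act s \<in> Pow {..<N}" using wip that by (auto simp: wip_policy_def)
    then show ?thesis by (simp add: \<pi>_def if_zero_mult)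
  qed
  have \<pi>: "stat_policy N d \<pi>"
    using pick[of _ "\<lambda>_. 1"] by (auto simp: stat_policy_def \<pi>_def)
  have ta: "time_avg ?S (gen_pol N d Q \<pi>) f x = time_avg ?S ?G f' x" if "\<And>y. y \<in> ?S \<Longrightarrow> f y = f' y" for f f'
    using that by (intro time_avg_gen_cong x) (auto simp: gen_pol_def pick det_gen_def)
  have rew: "time_avg ?S (gen_pol N d Q \<pi>) (reward_pol N R \<pi>) x = time_avg ?S ?G (det_reward N R Act) x"
    by (rule ta) (simp add: reward_pol_def pick det_reward_def)
  have act: "time_avg ?S (gen_pol N d Q \<pi>) (activation_pol N \<pi>) x = time_avg ?S ?G (\<lambda>_. \<alpha> * real N) x"
    by (rule ta) (use wip K in \<open>simp add: activation_pol_def pick wip_policy_def\<close>)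
  have "(time_avg ?S ?G (\<lambda>_. \<alpha> * real N) x \<longlongrightarrow> \<alpha> * real N) at_top"
  proof (rule tendsto_eventually, rule eventually_at_top_linorderI[of 1])
    fix T :: real assume "1 \<le> T"
    then show "time_avg ?S ?G (\<lambda>_. \<alpha> * real N) x T = \<alpha> * real N"
      by (intro time_avg_const[OF det_gen_generator[OF gen] x]) auto
  qed
  then have "(time_avg ?S (gen_pol N d Q \<pi>) (activation_pol N \<pi>) x \<longlongrightarrow> \<alpha> * real N) at_top"
    "(time_avg ?S (gen_pol N d Q \<pi>) (reward_pol N R \<pi>) x \<longlongrightarrow> L) at_top"
    unfolding act rew using lim by auto
  with \<pi> x show ?thesis by blast
qed

text \<open>The total suboptimality is zero while the empirical measure is close to
  \<open>m\<close>, since the chosen actions are then optimal, and at most \<open>N * C\<close>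
  otherwise.\<close>

lemma (in mean_field) gap_expectation:
  assumes opt: "\<And>i a. i \<in> SS \<Longrightarrow> a \<in> {0,1} \<Longrightarrow> qval d Q R \<nu> h a i \<le> g"
    and thr: "\<And>i. i \<in> SS \<Longrightarrow> i \<le> s \<Longrightarrow> qval d Q R \<nu> h 1 i = g" "\<And>i. i \<in> SS \<Longrightarrow> s \<le> i \<Longrightarrow> qval d Q R \<nu> h 0 i = g"
    and s: "s \<in> SS" and \<epsilon>: "0 \<le> \<epsilon>" "cum m (s - 1) + real d * \<epsilon> < \<alpha>" "\<alpha> < cum m s - real d * \<epsilon>"
    and N: "0 < N" and K: "real K = \<alpha> * real N" and wip: "wip_policy N d K Act"
    and C: "\<And>i a. i \<in> SS \<Longrightarrow> a \<in> {0,1} \<Longrightarrow> g - qval d Q R \<nu> h a i \<le> C" "0 \<le> C"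
    and T: "0 \<le> T" and x: "x \<in> joint_states N d"
    and prob: "apply_on (joint_states N d) (trans_fun (joint_states N d) (det_gen N d Q Act) T)
        (\<lambda>y. if \<exists>j\<in>SS. \<epsilon> < \<bar>emp N y j - m j\<bar> then 1 else 0) x \<le> p"
  shows "apply_on (joint_states N d) (trans_fun (joint_states N d) (det_gen N d Q Act) T)
        (\<lambda>y. \<Sum>n<N. g - qval d Q R \<nu> h (act (Act y) n) (y n)) x \<le> real N * C * p"
proof -
  interpret wip_chain d Q R \<alpha> N K Act by unfold_locales (rule N K wip)+
  let ?far = "\<lambda>y. if \<exists>j\<in>SS. \<epsilon> < \<bar>emp N y j - m j\<bar> then 1 else (0::real)"
  have "Pt T (\<lambda>y. \<Sum>n<N. g - qval d Q R \<nu> h (act (Act y) n) (y n)) x \<le> Pt T (\<lambda>y. (real N * C) * ?far y) x"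
  proof (rule semigroup_mono[OF generator T x])
    fix y assume y: "y \<in> JS"
    show "(\<Sum>n<N. g - qval d Q R \<nu> h (act (Act y) n) (y n)) \<le> (real N * C) * ?far y"
    proof (cases "\<exists>j\<in>SS. \<epsilon> < \<bar>emp N y j - m j\<bar>")
      case True
      have "(\<Sum>n<N. g - qval d Q R \<nu> h (act (Act y) n) (y n)) \<le> (\<Sum>n<N. C)"
        using joint_statesD[OF y] act_cases by (intro sum_mono C) auto
      then show ?thesis using True by simp
    next
      case False
      then have close: "\<bar>emp N y j - m j\<bar> \<le> \<epsilon>" if "j \<in> SS" for j using that by force
      have "g - qval d Q R \<nu> h (act (Act y) n) (y n) = 0" if n: "n < N" for n
        using wip_threshold[OF y close s \<epsilon> n] thr[OF joint_statesD[OF y n]]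
        by (cases "n \<in> Act y") (simp_all add: act_def)
      then show ?thesis using False by simp
    qed
  qed
  also have "\<dots> \<le> (real N * C) * p"
    unfolding apply_on_cmult using prob C by (intro mult_left_mono) auto
  finally show ?thesis .
qed

theorem theorem3:
  fixes d :: nat and Q :: "nat \<Rightarrow> nat \<Rightarrow> nat \<Rightarrow> real" and R :: "nat \<Rightarrow> nat \<Rightarrow> real"
    and \<alpha> :: real and mstar :: "nat \<Rightarrow> real"
  assumes alpha: "0 < \<alpha>" "\<alpha> < 1"
    and gen0: "is_generator d (Q 0)" and gen1: "is_generator d (Q 1)"
    and uni: "unichain d Q"
    and sidx: "strictly_indexable d Q R"
    and labels: "index_decreasing_labels d Q R"
    and fixpt: "mstar \<in> prob_simplex d" "\<forall>j\<in>{1..d}. phi d Q \<alpha> mstar j = mstar j"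
    and attr: "uniform_global_attractor d Q \<alpha> mstar"
    and nonsing: "\<not> singular d \<alpha> mstar"
  shows "\<exists>b c. 0 < b \<and> 0 < c \<and>
           (\<forall>N K Act. real K = \<alpha> * real N \<longrightarrow> wip_policy N d K Act \<longrightarrow>
              (\<forall>x\<in>joint_states N d. \<exists>g.
                 (time_avg (joint_states N d) (det_gen N d Q Act) (det_reward N R Act) x \<longlongrightarrow> g) at_top \<and>
                 0 \<le> V_rel d Q R \<alpha> N - g \<and>
                 V_rel d Q R \<alpha> N - g \<le> b * exp (- c * real N)))"
proof -
  have d: "1 \<le> d"
  proof (rule ccontr)
    assume "\<not> 1 \<le> d"
    then show False using simplexD(3)[OF fixpt(1)] by simp
  qed
  interpret mean_field d Q R \<alpha>
    using d gen0 gen1 uni alpha by unfold_locales (auto simp: is_generator_iff)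
  obtain s where s: "s \<in> SS" and s1: "cum mstar (s - 1) \<le> \<alpha>" and s2: "\<alpha> < cum mstar s"
    using s_of_exists[OF fixpt(1) alpha] by blast
  \<comment> \<open>Nonsingularity speaks about the indices from 1 on; the empty sum at
    \<open>s = 1\<close> is covered by \<alpha> being positive.\<close>
  have s1': "cum mstar (s - 1) < \<alpha>"
  proof (cases "s = 1")
    case True then show ?thesis using alpha by (simp add: cum_def)
  next
    case False
    then have "s - 1 \<in> SS" using s by auto
    then have "cum mstar (s - 1) \<noteq> \<alpha>" using nonsing unfolding singular_def cum_def by blast
    then show ?thesis using s1 by simp
  qed
  obtain \<nu> g h where bell: "\<And>i. i \<in> SS \<Longrightarrow> qval d Q R \<nu> h 0 i \<le> g \<and> qval d Q R \<nu> h 1 i \<le> g \<and>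
      (i \<le> s \<longrightarrow> qval d Q R \<nu> h 1 i = g) \<and> (s \<le> i \<longrightarrow> qval d Q R \<nu> h 0 i = g)"
    using bellman_at_index[OF _ labels s] sidx unfolding strictly_indexable_def by blast
  have opt: "qval d Q R \<nu> h a i \<le> g" if "i \<in> SS" "a \<in> {0,1}" for i a using bell that by auto
  \<comment> \<open>A cumulative sum moves by at most \<open>d * \<epsilon>\<close>, here half of
    the smaller distance from \<alpha>, so \<open>s\<close> remains marginal.\<close>
  define \<epsilon> where "\<epsilon> = min (\<alpha> - cum mstar (s - 1)) (cum mstar s - \<alpha>) / (2 * real d)"
  have \<epsilon>: "0 < \<epsilon>" using s1' s2 d by (simp add: \<epsilon>_def)
  have "real d * \<epsilon> = min (\<alpha> - cum mstar (s - 1)) (cum mstar s - \<alpha>) / 2" using d by (simp add: \<epsilon>_def)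
  then have \<epsilon>s: "cum mstar (s - 1) + real d * \<epsilon> < \<alpha>" "\<alpha> < cum mstar s - real d * \<epsilon>"
    using s1' s2 by (auto simp: min_def split: if_splits)
  obtain T b c where T: "0 \<le> T" and b: "0 < b" and c: "0 < c" and conc:
    "\<And>N K Act x. 0 < N \<Longrightarrow> real K = \<alpha> * real N \<Longrightarrow> wip_policy N d K Act \<Longrightarrow> x \<in> joint_states N d \<Longrightarrow>
      apply_on (joint_states N d) (trans_fun (joint_states N d) (det_gen N d Q Act) T)
        (\<lambda>y. if \<exists>j\<in>SS. \<epsilon> < \<bar>emp N y j - mstar j\<bar> then 1 else 0) x \<le> b * exp (- c * real N)"
    using attractor_concentration[OF attr \<epsilon>] by blast
  define C where "C = (\<Sum>i\<in>SS. (g - qval d Q R \<nu> h 0 i) + (g - qval d Q R \<nu> h 1 i))"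
  have nn: "0 \<le> (g - qval d Q R \<nu> h 0 i) + (g - qval d Q R \<nu> h 1 i)" if "i \<in> SS" for i
    using opt[OF that, of 0] opt[OF that, of 1] by simp
  have C: "g - qval d Q R \<nu> h a i \<le> C" if i: "i \<in> SS" and a: "a \<in> {0,1}" for i a
  proof -
    have "g - qval d Q R \<nu> h a i \<le> (g - qval d Q R \<nu> h 0 i) + (g - qval d Q R \<nu> h 1 i)"
      using opt[OF i, of 0] opt[OF i, of 1] a by auto
    also have "\<dots> \<le> C" unfolding C_def
      by (rule member_le_sum[where f = "\<lambda>i. (g - qval d Q R \<nu> h 0 i) + (g - qval d Q R \<nu> h 1 i)"]) (use i nn in blast)+
    finally show ?thesis .
  qed
  have C0: "0 \<le> C" unfolding C_def by (rule sum_nonneg) (rule nn)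
  \<comment> \<open>Half of the exponent absorbs the factor \<open>N\<close>, by
    \<open>x <= exp x\<close>. The added 1 keeps the constant positive when
    \<open>C = 0\<close>.\<close>
  have poly_exp: "real N * C * (b * exp (- c * real N)) \<le> (2 * C * b / c + 1) * exp (- (c / 2) * real N)" for N
  proof -
    let ?e = "exp (- (c / 2) * real N)"
    have "(c / 2) * real N \<le> exp ((c / 2) * real N)" using exp_ge_add_one_self[of "(c / 2) * real N"] by linarith
    then have "(c / 2) * real N * ?e \<le> exp ((c / 2) * real N) * ?e" by (intro mult_right_mono) auto
    also have "\<dots> = 1" by (simp add: exp_add[symmetric])
    finally have le1: "real N * ?e \<le> 2 / c" using c by (simp add: field_simps)
    have ee: "exp (- c * real N) = ?e * ?e" unfolding exp_add[symmetric] by (rule arg_cong[of _ _ exp]) simp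
    have "real N * C * (b * exp (- c * real N)) = (real N * ?e) * (C * b * ?e)" unfolding ee by (simp only: mult_ac)
    also have "\<dots> \<le> (2 / c) * (C * b * ?e)" using le1 C0 b by (intro mult_right_mono) auto
    also have "\<dots> = (2 * C * b / c) * ?e" by simp
    also have "\<dots> \<le> (2 * C * b / c + 1) * ?e" by (intro mult_right_mono) auto
    finally show ?thesis .
  qed
  show ?thesis
  proof (rule exI[of _ "2 * C * b / c + 1"], rule exI[of _ "c / 2"], intro conjI allI impI ballI)
    show "0 < 2 * C * b / c + 1" using C0 b c by (intro add_nonneg_pos) auto
    show "0 < c / 2" using c by simp
    fix N K Act x
    assume K: "real K = \<alpha> * real N" and wip: "wip_policy N d K Act" and x: "x \<in> joint_states N d"
    obtain L where L: "(time_avg (joint_states N d) (det_gen N d Q Act) (det_reward N R Act) x \<longlongrightarrow> L) at_top"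
      by (rule exE[OF time_avg_converges[OF det_gen_generator[of d Q, OF gen] x]])
    let ?V = "{v. \<exists>\<pi> x. stat_policy N d \<pi> \<and> x \<in> joint_states N d \<and>
        (time_avg (joint_states N d) (gen_pol N d Q \<pi>) (activation_pol N \<pi>) x \<longlongrightarrow> \<alpha> * real N) at_top \<and>
        (time_avg (joint_states N d) (gen_pol N d Q \<pi>) (reward_pol N R \<pi>) x \<longlongrightarrow> v) at_top}"
    have upper: "v \<le> real N * (g - \<nu> * (1 - \<alpha>))" if "v \<in> ?V" for v
      using that relaxed_upper_bound[OF opt] by blast
    have LV: "L \<in> ?V" using wip_value_admissible[OF gen K wip x L] by blast
    have lower: "real N * (g - \<nu> * (1 - \<alpha>)) - real N * C * (b * exp (- c * real N)) \<le> L"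
    proof (rule wip_lower_bound[OF opt K wip x T _ _ L])
      show "0 \<le> real N * C * (b * exp (- c * real N))" using C0 b by simp
      fix y assume y: "y \<in> joint_states N d"
      show "apply_on (joint_states N d) (trans_fun (joint_states N d) (det_gen N d Q Act) T)
        (\<lambda>y. \<Sum>n<N. g - qval d Q R \<nu> h (act (Act y) n) (y n)) y \<le> real N * C * (b * exp (- c * real N))"
      \<comment> \<open>The empirical measure is meaningful for positive \<open>N\<close> only; with
        no bandits the suboptimality is an empty sum.\<close>
      proof (cases "N = 0")
        case True then show ?thesis by (simp add: apply_on_def)
      next
        case False
        then have N: "0 < N" by simp
        show ?thesis
          by (rule gap_expectation[OF opt _ _ s _ \<epsilon>s N K wip C C0 T y conc[OF N K wip y]])
            (use bell \<epsilon> in auto)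
      qed
    qed
    \<comment> \<open>The index policy shows that the set of relaxed values is nonempty and weak
      duality that it is bounded above, so its supremum is a genuine one.\<close>
    have "V_rel d Q R \<alpha> N \<le> real N * (g - \<nu> * (1 - \<alpha>))"
      unfolding V_rel_def by (rule cSup_least) (use LV upper in blast)+
    moreover have "L \<le> V_rel d Q R \<alpha> N"
      unfolding V_rel_def by (rule cSup_upper[OF LV]) (rule bdd_aboveI, rule upper)
    ultimately have "0 \<le> V_rel d Q R \<alpha> N - L" "V_rel d Q R \<alpha> N - L \<le> (2 * C * b / c + 1) * exp (- (c / 2) * real N)"
      using lower poly_exp[of N] by linarith+
    then show "\<exists>g. (time_avg (joint_states N d) (det_gen N d Q Act) (det_reward N R Act) x \<longlongrightarrow> g) at_top \<and>
        0 \<le> V_rel d Q R \<alpha> N - g \<and> V_rel d Q R \<alpha> N - g \<le> (2 * C * b / c + 1) * exp (- (c / 2) * real N)"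
      using L by blast
  qed
qed

end
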